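(* Let $\mathfrak g$ be a simple complex Lie algebra and $\Bbbk$ a field. For tensor words $B_\epsilon,B_{\epsilon'}$ in the fundamental crystals, let $\mathcal B(\epsilon,\epsilon')=\{\overline f\circ P\circ g\mid f\in\mathcal D_{\epsilon',\lambda},\,g\in\mathcal D_{\epsilon,\lambda},\,\lambda\in\Lambda_+\}$, and for $\nu=\overline f\circ P\circ g\in\mathcal B(\epsilon,\epsilon')$, with $P$ of codomain $B_\delta$, put $\hat\nu:=\overline f\circ j_\delta\circ P\circ g$. Then $\hat{\mathcal B}(\epsilon,\epsilon')=\{\hat\nu\mid\nu\in\mathcal B(\epsilon,\epsilon')\}$ is a matrix-unit basis of $\mathrm{Hom}_{\mathfrak g\text{-}\mathrm{Crys}}(B_\epsilon,B_{\epsilon'})$ consisting of basic morphisms. Explicitly, it is a basis, and if $\nu=\overline f\circ P\circ g\in\mathcal B(\epsilon,\epsilon')$ and $\mu=\overline{f'}\circ P'\circ g'\in\mathcal B(\epsilon',\epsilon'')$, then $$\hat\mu\circ\hat\nu=\begin{cases}\hat\eta&\text{if }g'=f,\\0&\text{otherwise,}\end{cases}$$ where, when $g'=f$, $\eta=\overline{f'}\circ P''\circ g$ for any compatible permutation $P''$ (from the codomain of $g$ to the codomain of $f'$).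
   Context: **Crystals.** $\mathfrak g$ has simple roots $\alpha_i$, simple coroots $\alpha_i^\vee$ ($1\le i\le n$), weight lattice $\Lambda$, dominant weights $\Lambda_+$, fundamental weights $\omega_i$. A $\mathfrak g$-crystal is a finite set $B$ with maps $\mathrm{wt}:B\to\Lambda$, $e_i,f_i:B\to B\sqcup\{0\}$ such that $\mathrm{wt}(e_ib)=\mathrm{wt}(b)+\alpha_i$ if $e_ib\ne0$, $\mathrm{wt}(f_ib)=\mathrm{wt}(b)-\alpha_i$ if $f_ib\ne0$; $e_ib=b'\iff b=f_ib'$; and $\varphi_i(b)-\varepsilon_i(b)=\langle\mathrm{wt}(b),\alpha_i^\vee\rangle$, where $\varepsilon_i(b)=\max\{m:e_i^mb\ne0\}$, $\varphi_i(b)=\max\{m:f_i^mb\ne0\}$. The tensor product $B\otimes C$ is $B\times C$ with $\mathrm{wt}(b\otimes c)=\mathrm{wt}(b)+\mathrm{wt}(c)$, $e_i(b\otimes c)=e_ib\otimes c$ if $\varphi_i(b)\ge\varepsilon_i(c)$ and $b\otimes e_ic$ otherwise, $f_i(b\otimes c)=f_ib\otimes c$ if $\varphi_i(b)>\varepsilon_i(c)$ and $b\otimes f_ic$ otherwise. A (strict) morphism is a map $B\sqcup\{0\}\to C\sqcup\{0\}$ with $0\mapsto0$, preserving weights (of elements not sent to $0$) and commuting with all $e_i,f_i$. $B(\lambda)$ is the connected crystal of the simple module of highest weight $\lambda\in\Lambda_+$; $B_i:=B(\omega_i)$. $\mathfrak g$-Crys is the (strictified) $\Bbbk$-linear monoidal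 category with objects finite direct sums (disjoint unions) of crystals $B(\lambda)$ and morphisms the $\Bbbk$-linear combinations of crystal morphisms (viewed as linear maps between the $\Bbbk$-spans, $0\mapsto0$). For a word $\epsilon=(\epsilon_1,\dots,\epsilon_m)$ in $\{1,\dots,n\}$, $B_\epsilon=B_{\epsilon_1}\otimes\cdots\otimes B_{\epsilon_m}$ (empty word: unit $\mathbb 1$). The top component of $B_\epsilon$ is its unique component of highest weight $\sum_k\omega_{\epsilon_k}$ (the weight of $B_\epsilon$); its highest weight element is the highest element of $B_\epsilon$. A morphism is basic if it is zero on all but a single connected component of its domain. **Atoms.** For $b\in B_k$ let $B_{\epsilon(b)}=B_1^{\otimes\varepsilon_1(b)}\otimes\cdots\otimes B_n^{\otimes\varepsilon_n(b)}$, $B_{\delta(b)}=B_1^{\otimes\varphi_1(b)}\otimes\cdots\otimes B_n^{\otimes\varphi_n(b)}$, and $c$ the highest element of $B_{\epsilon(b)}$. The atom $f_b:B_{\epsilon(b)}\otimes B_k\to B_{\delta(b)}$ maps the component generated by the highest weight element $c\otimes b$ onto the top component of $B_{\delta(b)}$ and is zero on all other components. **Crossings and permutations.** Crossings are one fixed choice of isomorphisms $\beta_{i,j}:B_i\otimes B_j\to B_j\otimes B_i$ for $i\ne j$, with $\beta_{i,j}^{-1}=\beta_{j,i}$. A permutation is a composite of identity-padded crossings rearranging the factors of a tensor word; as a fixed convention, strands of equal label never cross, two strands cross at most once, and three completely reversed strands with distinct labels $i,j,k$ are reversed by $(\beta_{j,k}\otimes\mathrm{id})(\mathrm{id}\otimes\beta_{i,k})(\beta_{i,j}\otimes\mathrm{id})$.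 In $\mathcal B(\epsilon,\epsilon')$ the permutation $P$ goes from the codomain of $g$ to the codomain of $f$, one $P$ for each pair $(f,g)$. **Flip.** If $f$ is a map of crystals injective outside its kernel (as atoms, crossings and their composites/tensor products are), $\overline f$ is the map in the opposite direction inverting $f$ on its image and sending all other elements to $0$. **Distinguished bottom diagrams.** $\mathcal D_\epsilon$ is defined recursively: for the empty word it contains only the empty morphism. A connected component of $B_{\epsilon_1}\otimes\cdots\otimes B_{\epsilon_m}$ has highest weight element $b_1\otimes\cdots\otimes b_m$, whose prefixes are all highest weight elements. If $D'$ is the diagram attached to the component of $b_1\otimes\cdots\otimes b_{m-1}$, the diagram attached to that of $b_1\otimes\cdots\otimes b_m$ is $(\mathrm{id}\otimes f_{b_m})\circ((\beta\circ D')\otimes\mathrm{id}_{B_{\epsilon_m}})$, where $\beta$ is a minimal permutation (fewest crossings) such that the rightmost factors of its codomain form the word $B_{\epsilon(b_m)}$. The weight of $D\in\mathcal D_\epsilon$ is the weight of its codomain; $\mathcal D_{\epsilon,\lambda}=\{D\in\mathcal D_\epsilon:\mathrm{wt}(D)=\lambda\}$. **Jones--Wenzl projector.** $j_\delta\in\mathrm{End}(B_\delta)$ is the identity on the top component of $B_\delta$ and zero on all other components. *)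

theory Defs
  imports
    Complex_Main
    "HOL-Library.Function_Algebras"
    "HOL-Computational_Algebra.Polynomial"
    "HOL-Computational_Algebra.Fraction_Field"
begin

section \<open>Simple complex Lie algebras\<close>

definition complex_lie_algebra ::
  "(complex \<Rightarrow> 'g::ab_group_add \<Rightarrow> 'g) \<Rightarrow> ('g \<Rightarrow> 'g \<Rightarrow> 'g) \<Rightarrow> bool" where
  "complex_lie_algebra scale br \<longleftrightarrow>
     vector_space scale \<and>
     (\<exists>S. finite S \<and> module.span scale S = UNIV) \<and>
     (\<forall>x y z. br (x + y) z = br x z + br y z \<and> br x (y + z) = br x y + br x z) \<and>
     (\<forall>a x y. br (scale a x) y = scale a (br x y) \<and> br x (scale a y) = scale a (br x y)) \<and>
     (\<forall>x. br x x = 0) \<and>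
     (\<forall>x y z. br x (br y z) + br y (br z x) + br z (br x y) = 0)"

definition simple_lie_algebra ::
  "(complex \<Rightarrow> 'g::ab_group_add \<Rightarrow> 'g) \<Rightarrow> ('g \<Rightarrow> 'g \<Rightarrow> 'g) \<Rightarrow> bool" where
  "simple_lie_algebra scale br \<longleftrightarrow>
     complex_lie_algebra scale br \<and> (\<exists>x y. br x y \<noteq> 0) \<and>
     (\<forall>I. module.subspace scale I \<and> (\<forall>x. \<forall>y\<in>I. br x y \<in> I) \<longrightarrow> I = {0} \<or> I = UNIV)"

definition ad_semisimple ::
  "(complex \<Rightarrow> 'g::ab_group_add \<Rightarrow> 'g) \<Rightarrow> ('g \<Rightarrow> 'g \<Rightarrow> 'g) \<Rightarrow> 'g \<Rightarrow> bool" where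
  "ad_semisimple scale br x \<longleftrightarrow> module.span scale {y. \<exists>a. br x y = scale a y} = UNIV"

definition toral ::
  "(complex \<Rightarrow> 'g::ab_group_add \<Rightarrow> 'g) \<Rightarrow> ('g \<Rightarrow> 'g \<Rightarrow> 'g) \<Rightarrow> 'g set \<Rightarrow> bool" where
  "toral scale br H \<longleftrightarrow>
     module.subspace scale H \<and> (\<forall>x\<in>H. \<forall>y\<in>H. br x y \<in> H) \<and> (\<forall>x\<in>H. ad_semisimple scale br x)"

text \<open>For a semisimple algebra the Cartan subalgebras are the maximal toral subalgebras.\<close>

definition cartan_subalgebra ::
  "(complex \<Rightarrow> 'g::ab_group_add \<Rightarrow> 'g) \<Rightarrow> ('g \<Rightarrow> 'g \<Rightarrow> 'g) \<Rightarrow> 'g set \<Rightarrow> bool" where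
  "cartan_subalgebra scale br H \<longleftrightarrow>
     toral scale br H \<and> (\<forall>H'. toral scale br H' \<and> H \<subseteq> H' \<longrightarrow> H' = H)"

text \<open>Linear functionals on the Cartan subalgebra \<open>H\<close> are represented by functions on the
  whole algebra of which only the values on \<open>H\<close> matter.\<close>

definition root_space ::
  "(complex \<Rightarrow> 'g::ab_group_add \<Rightarrow> 'g) \<Rightarrow> ('g \<Rightarrow> 'g \<Rightarrow> 'g) \<Rightarrow> 'g set \<Rightarrow> ('g \<Rightarrow> complex) \<Rightarrow> 'g set" where
  "root_space scale br H \<beta> = {y. \<forall>h\<in>H. br h y = scale (\<beta> h) y}"

definition is_root ::
  "(complex \<Rightarrow> 'g::ab_group_add \<Rightarrow> 'g) \<Rightarrow> ('g \<Rightarrow> 'g \<Rightarrow> 'g) \<Rightarrow> 'g set \<Rightarrow> ('g \<Rightarrow> complex) \<Rightarrow> bool" where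
  "is_root scale br H \<beta> \<longleftrightarrow> (\<exists>h\<in>H. \<beta> h \<noteq> 0) \<and> (\<exists>y\<in>root_space scale br H \<beta>. y \<noteq> 0)"

definition simple_roots ::
  "(complex \<Rightarrow> 'g::ab_group_add \<Rightarrow> 'g) \<Rightarrow> ('g \<Rightarrow> 'g \<Rightarrow> 'g) \<Rightarrow> 'g set \<Rightarrow> ('i::finite \<Rightarrow> 'g \<Rightarrow> complex) \<Rightarrow> bool" where
  "simple_roots scale br H \<alpha> \<longleftrightarrow>
     (\<forall>i. is_root scale br H (\<alpha> i)) \<and>
     (\<forall>c. (\<forall>h\<in>H. (\<Sum>i\<in>UNIV. c i * \<alpha> i h) = 0) \<longrightarrow> (\<forall>i. c i = 0)) \<and>
     (\<forall>\<beta>. is_root scale br H \<beta> \<longrightarrow>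
        (\<exists>m :: 'i \<Rightarrow> int. ((\<forall>i. m i \<ge> 0) \<or> (\<forall>i. m i \<le> 0)) \<and>
           (\<forall>h\<in>H. \<beta> h = (\<Sum>i\<in>UNIV. of_int (m i) * \<alpha> i h))))"

definition simple_coroots ::
  "(complex \<Rightarrow> 'g::ab_group_add \<Rightarrow> 'g) \<Rightarrow> ('g \<Rightarrow> 'g \<Rightarrow> 'g) \<Rightarrow> 'g set \<Rightarrow> ('i::finite \<Rightarrow> 'g \<Rightarrow> complex) \<Rightarrow>
     ('i \<Rightarrow> 'g) \<Rightarrow> bool" where
  "simple_coroots scale br H \<alpha> \<alpha>c \<longleftrightarrow>
     (\<forall>i. (\<exists>x\<in>root_space scale br H (\<alpha> i). \<exists>y\<in>root_space scale br H (\<lambda>h. - \<alpha> i h). \<alpha>c i = br x y) \<and>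
          \<alpha>c i \<in> H \<and> \<alpha> i (\<alpha>c i) = 2)"

text \<open>The entry \<open>(i, j)\<close> is the integer \<open>\<langle>\<alpha>\<^sub>j, \<alpha>\<^sub>i\<^sup>\<or>\<rangle>\<close>.\<close>

definition cartan_matrix :: "('i \<Rightarrow> 'g \<Rightarrow> complex) \<Rightarrow> ('i \<Rightarrow> 'g) \<Rightarrow> 'i \<Rightarrow> 'i \<Rightarrow> int" where
  "cartan_matrix \<alpha> \<alpha>c i j = \<lfloor>Re (\<alpha> j (\<alpha>c i))\<rfloor>"


section \<open>Crystals\<close>

text \<open>The simple coroots form a basis of the Cartan subalgebra, so a weight \<open>\<lambda>\<close> in \<open>\<Lambda>\<close> is
  represented by its integer coordinates \<open>\<lambda> i = \<langle>\<lambda>, \<alpha>\<^sub>i\<^sup>\<or>\<rangle>\<close> in the basis of fundamental weights.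
  The index type \<open>'i\<close> plays the role of \<open>{1..n}\<close>; its linear order is the one used
  to write \<open>B\<^sub>1, \<dots>, B\<^sub>n\<close> in a row.\<close>

type_synonym 'i weight = "'i \<Rightarrow> int"

definition root_weight :: "('i \<Rightarrow> 'i \<Rightarrow> int) \<Rightarrow> 'i \<Rightarrow> 'i weight" where
  "root_weight A j = (\<lambda>i. A i j)"

definition dominant :: "'i weight \<Rightarrow> bool" where
  "dominant lam \<longleftrightarrow> (\<forall>i. lam i \<ge> 0)"

definition fund_weight :: "'i \<Rightarrow> 'i weight" where
  "fund_weight i = (\<lambda>j. if j = i then 1 else 0)"

text \<open>The element \<open>0\<close> added to a crystal is \<open>None\<close>.\<close>

record ('i, 'b) crystal =
  elts :: "'b set"
  wt :: "'b \<Rightarrow> 'i weight"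
  eop :: "'i \<Rightarrow> 'b \<Rightarrow> 'b option"
  fop :: "'i \<Rightarrow> 'b \<Rightarrow> 'b option"

definition iterate_op :: "('b \<Rightarrow> 'b option) \<Rightarrow> nat \<Rightarrow> 'b \<Rightarrow> 'b option" where
  "iterate_op g m b = ((\<lambda>x. Option.bind x g) ^^ m) (Some b)"

definition eps :: "('i, 'b) crystal \<Rightarrow> 'i \<Rightarrow> 'b \<Rightarrow> nat" where
  "eps B i b = Max {m. iterate_op (eop B i) m b \<noteq> None}"

definition phi :: "('i, 'b) crystal \<Rightarrow> 'i \<Rightarrow> 'b \<Rightarrow> nat" where
  "phi B i b = Max {m. iterate_op (fop B i) m b \<noteq> None}"

definition is_crystal :: "('i \<Rightarrow> 'i \<Rightarrow> int) \<Rightarrow> ('i, 'b) crystal \<Rightarrow> bool" where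
  "is_crystal A B \<longleftrightarrow>
     finite (elts B) \<and>
     (\<forall>b\<in>elts B. \<forall>i.
        (\<forall>b'. eop B i b = Some b' \<longrightarrow> b' \<in> elts B \<and> wt B b' = wt B b + root_weight A i) \<and>
        (\<forall>b'. fop B i b = Some b' \<longrightarrow> b' \<in> elts B \<and> wt B b' = wt B b - root_weight A i) \<and>
        int (phi B i b) - int (eps B i b) = wt B b i) \<and>
     (\<forall>b\<in>elts B. \<forall>b'\<in>elts B. \<forall>i. eop B i b = Some b' \<longleftrightarrow> fop B i b' = Some b)"

definition crystal_edges :: "('i, 'b) crystal \<Rightarrow> ('b \<times> 'b) set" where
  "crystal_edges B =
     {(b, b'). b \<in> elts B \<and> (\<exists>i. eop B i b = Some b' \<or> fop B i b = Some b')}"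

definition component :: "('i, 'b) crystal \<Rightarrow> 'b \<Rightarrow> 'b set" where
  "component B b = (crystal_edges B)\<^sup>* `` {b}"

definition components :: "('i, 'b) crystal \<Rightarrow> 'b set set" where
  "components B = component B ` elts B"

definition connected_crystal :: "('i, 'b) crystal \<Rightarrow> bool" where
  "connected_crystal B \<longleftrightarrow> components B = {elts B}"

definition highest_weight_elt :: "('i, 'b) crystal \<Rightarrow> 'b \<Rightarrow> bool" where
  "highest_weight_elt B b \<longleftrightarrow> b \<in> elts B \<and> (\<forall>i. eop B i b = None)"

definition tensor_crystal :: "('i, 'b) crystal \<Rightarrow> ('i, 'c) crystal \<Rightarrow> ('i, 'b \<times> 'c) crystal" where
  "tensor_crystal B C =
     \<lparr> elts = elts B \<times> elts C,
       wt = (\<lambda>(b, c). wt B b + wt C c),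
       eop = (\<lambda>i (b, c). if phi B i b \<ge> eps C i c then map_option (\<lambda>b'. (b', c)) (eop B i b)
                         else map_option (\<lambda>c'. (b, c')) (eop C i c)),
       fop = (\<lambda>i (b, c). if phi B i b > eps C i c then map_option (\<lambda>b'. (b', c)) (fop B i b)
                         else map_option (\<lambda>c'. (b, c')) (fop C i c)) \<rparr>"

text \<open>Crystal morphisms \<open>B \<squnion> {0} \<rightarrow> C \<squnion> {0}\<close> as partial maps; composition is \<^const>\<open>map_comp\<close>.\<close>

definition crys_hom :: "('i, 'b) crystal \<Rightarrow> ('i, 'c) crystal \<Rightarrow> ('b \<Rightarrow> 'c option) set" where
  "crys_hom B C = {\<psi>. dom \<psi> \<subseteq> elts B \<and> ran \<psi> \<subseteq> elts C \<and>
     (\<forall>b c. \<psi> b = Some c \<longrightarrow> wt C c = wt B b) \<and>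
     (\<forall>b\<in>elts B. \<forall>i. Option.bind (eop B i b) \<psi> = Option.bind (\<psi> b) (eop C i) \<and>
                      Option.bind (fop B i b) \<psi> = Option.bind (\<psi> b) (fop C i))}"

definition crys_iso :: "('i, 'b) crystal \<Rightarrow> ('i, 'c) crystal \<Rightarrow> ('b \<Rightarrow> 'c option) \<Rightarrow> bool" where
  "crys_iso B C \<psi> \<longleftrightarrow>
     \<psi> \<in> crys_hom B C \<and> dom \<psi> = elts B \<and> ran \<psi> = elts C \<and> inj_on \<psi> (elts B)"

definition isomorphic_crystals :: "('i, 'b) crystal \<Rightarrow> ('i, 'c) crystal \<Rightarrow> bool" where
  "isomorphic_crystals B C \<longleftrightarrow> (\<exists>\<psi>. crys_iso B C \<psi>)"


section \<open>The crystal of a simple module\<close>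

text \<open>Kashiwara's construction over \<open>\<rat>(q)\<close>. A finite-dimensional module is taken to live on the
  first \<open>N\<close> coordinates of \<open>\<nat> \<Rightarrow> \<rat>(q)\<close>.\<close>

type_synonym ratfun = "rat poly fract"
type_synonym qvec = "nat \<Rightarrow> ratfun"

definition qvar :: ratfun where
  "qvar = Fract [:0, 1:] 1"

definition qpow :: "('i \<Rightarrow> nat) \<Rightarrow> 'i \<Rightarrow> ratfun" where
  "qpow d i = qvar ^ d i"

definition qint :: "ratfun \<Rightarrow> nat \<Rightarrow> ratfun" where
  "qint x n = (x ^ n - inverse x ^ n) / (x - inverse x)"

definition qfact :: "ratfun \<Rightarrow> nat \<Rightarrow> ratfun" where
  "qfact x n = (\<Prod>k=1..n. qint x k)"

definition qbinom :: "ratfun \<Rightarrow> nat \<Rightarrow> nat \<Rightarrow> ratfun" where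
  "qbinom x n k = qfact x n / (qfact x k * qfact x (n - k))"

definition qscale :: "ratfun \<Rightarrow> qvec \<Rightarrow> qvec" where
  "qscale a v = (\<lambda>n. a * v n)"

definition qspace :: "nat \<Rightarrow> qvec set" where
  "qspace N = {v. \<forall>n\<ge>N. v n = 0}"

definition qlinear :: "nat \<Rightarrow> (qvec \<Rightarrow> qvec) \<Rightarrow> bool" where
  "qlinear N T \<longleftrightarrow>
     (\<forall>v\<in>qspace N. T v \<in> qspace N \<and> (\<forall>w\<in>qspace N. T (v + w) = T v + T w) \<and>
                    (\<forall>a. T (qscale a v) = qscale a (T v)))"

text \<open>The integers \<open>d i = (\<alpha>\<^sub>i, \<alpha>\<^sub>i) / 2\<close>, normalised to be coprime (short roots have \<open>d i = 1\<close>).\<close>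

definition symmetrizer :: "('i \<Rightarrow> 'i \<Rightarrow> int) \<Rightarrow> ('i \<Rightarrow> nat) \<Rightarrow> bool" where
  "symmetrizer A d \<longleftrightarrow>
     (\<forall>i. d i > 0) \<and> (\<forall>i j. int (d i) * A i j = int (d j) * A j i) \<and> Gcd (range d) = 1"

text \<open>Modules over \<open>U\<^sub>q(\<gg>)\<close>, given by the action of the Chevalley generators; \<open>K' i\<close> is the
  inverse of \<open>K i\<close>.\<close>

definition uq_module ::
  "('i \<Rightarrow> 'i \<Rightarrow> int) \<Rightarrow> ('i \<Rightarrow> nat) \<Rightarrow> nat \<Rightarrow> ('i \<Rightarrow> qvec \<Rightarrow> qvec) \<Rightarrow> ('i \<Rightarrow> qvec \<Rightarrow> qvec) \<Rightarrow>
     ('i \<Rightarrow> qvec \<Rightarrow> qvec) \<Rightarrow> ('i \<Rightarrow> qvec \<Rightarrow> qvec) \<Rightarrow> bool" where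
  "uq_module A d N E F K K' \<longleftrightarrow>
     (\<forall>i. qlinear N (E i) \<and> qlinear N (F i) \<and> qlinear N (K i) \<and> qlinear N (K' i)) \<and>
     (\<forall>v\<in>qspace N. \<forall>i j.
        K i (K' i v) = v \<and> K' i (K i v) = v \<and> K i (K j v) = K j (K i v) \<and>
        K i (E j v) = qscale (qpow d i powi A i j) (E j (K i v)) \<and>
        K i (F j v) = qscale (qpow d i powi (- A i j)) (F j (K i v)) \<and>
        E i (F j v) - F j (E i v) =
          (if i = j then qscale (inverse (qpow d i - inverse (qpow d i))) (K i v - K' i v) else 0) \<and>
        (i \<noteq> j \<longrightarrow>
          (let m = nat (1 - A i j) in
             (\<Sum>k\<le>m. qscale ((- 1) ^ k * qbinom (qpow d i) m k) ((E i ^^ (m - k)) (E j ((E i ^^ k) v)))) = 0 \<and>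
             (\<Sum>k\<le>m. qscale ((- 1) ^ k * qbinom (qpow d i) m k) ((F i ^^ (m - k)) (F j ((F i ^^ k) v)))) = 0)))"

definition qweight_space ::
  "('i \<Rightarrow> nat) \<Rightarrow> nat \<Rightarrow> ('i \<Rightarrow> qvec \<Rightarrow> qvec) \<Rightarrow> 'i weight \<Rightarrow> qvec set" where
  "qweight_space d N K \<mu> = {v\<in>qspace N. \<forall>i. K i v = qscale (qpow d i powi \<mu> i) v}"

definition simple_uq_module ::
  "('i \<Rightarrow> 'i \<Rightarrow> int) \<Rightarrow> ('i \<Rightarrow> nat) \<Rightarrow> nat \<Rightarrow> ('i \<Rightarrow> qvec \<Rightarrow> qvec) \<Rightarrow> ('i \<Rightarrow> qvec \<Rightarrow> qvec) \<Rightarrow>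
     ('i \<Rightarrow> qvec \<Rightarrow> qvec) \<Rightarrow> ('i \<Rightarrow> qvec \<Rightarrow> qvec) \<Rightarrow> bool" where
  "simple_uq_module A d N E F K K' \<longleftrightarrow>
     uq_module A d N E F K K' \<and> N > 0 \<and>
     (\<forall>S. module.subspace qscale S \<and> S \<subseteq> qspace N \<and>
          (\<forall>v\<in>S. \<forall>i. E i v \<in> S \<and> F i v \<in> S \<and> K i v \<in> S \<and> K' i v \<in> S) \<longrightarrow>
          S = {0} \<or> S = qspace N)"

definition highest_weight_vector ::
  "('i \<Rightarrow> nat) \<Rightarrow> nat \<Rightarrow> ('i \<Rightarrow> qvec \<Rightarrow> qvec) \<Rightarrow> ('i \<Rightarrow> qvec \<Rightarrow> qvec) \<Rightarrow> 'i weight \<Rightarrow> qvec \<Rightarrow> bool" where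
  "highest_weight_vector d N E K lam u \<longleftrightarrow>
     u \<in> qweight_space d N K lam \<and> u \<noteq> 0 \<and> (\<forall>i. E i u = 0)"

definition divided_power ::
  "('i \<Rightarrow> nat) \<Rightarrow> ('i \<Rightarrow> qvec \<Rightarrow> qvec) \<Rightarrow> 'i \<Rightarrow> nat \<Rightarrow> qvec \<Rightarrow> qvec" where
  "divided_power d F i n v = qscale (inverse (qfact (qpow d i) n)) ((F i ^^ n) v)"

text \<open>The vectors \<open>F\<^sub>i\<^bsup>(n)\<^esup> v\<close> with \<open>v\<close> of weight \<open>\<mu>\<close>, \<open>E\<^sub>i v = 0\<close> and \<open>n \<le> \<mu> i\<close> span the module,
  so the following determines the Kashiwara operators \<open>et i\<close>, \<open>ft i\<close> on it.\<close>

definition kashiwara_ops ::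
  "('i \<Rightarrow> nat) \<Rightarrow> nat \<Rightarrow> ('i \<Rightarrow> qvec \<Rightarrow> qvec) \<Rightarrow> ('i \<Rightarrow> qvec \<Rightarrow> qvec) \<Rightarrow> ('i \<Rightarrow> qvec \<Rightarrow> qvec) \<Rightarrow>
     ('i \<Rightarrow> qvec \<Rightarrow> qvec) \<Rightarrow> ('i \<Rightarrow> qvec \<Rightarrow> qvec) \<Rightarrow> bool" where
  "kashiwara_ops d N E F K et ft \<longleftrightarrow>
     (\<forall>i. qlinear N (et i) \<and> qlinear N (ft i) \<and>
        (\<forall>\<mu>. \<forall>v\<in>qweight_space d N K \<mu>. E i v = 0 \<longrightarrow>
           (\<forall>n. int n \<le> \<mu> i \<longrightarrow>
              et i (divided_power d F i n v) = (if n = 0 then 0 else divided_power d F i (n - 1) v) \<and>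
              ft i (divided_power d F i n v) = divided_power d F i (n + 1) v)))"

definition regular_at_0 :: "ratfun set" where
  "regular_at_0 = {Fract a b | a b. poly b 0 \<noteq> 0}"

definition is_lattice_module :: "qvec set \<Rightarrow> bool" where
  "is_lattice_module M \<longleftrightarrow>
     0 \<in> M \<and> (\<forall>v\<in>M. \<forall>w\<in>M. v + w \<in> M) \<and> (\<forall>a\<in>regular_at_0. \<forall>v\<in>M. qscale a v \<in> M)"

inductive_set kashiwara_monomials :: "('i \<Rightarrow> qvec \<Rightarrow> qvec) \<Rightarrow> qvec \<Rightarrow> qvec set"
  for ft u where
  start: "u \<in> kashiwara_monomials ft u"
| step: "v \<in> kashiwara_monomials ft u \<Longrightarrow> ft i v \<in> kashiwara_monomials ft u"

definition crystal_lattice :: "('i \<Rightarrow> qvec \<Rightarrow> qvec) \<Rightarrow> qvec \<Rightarrow> qvec set" where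
  "crystal_lattice ft u = is_lattice_module hull kashiwara_monomials ft u"

definition q_lattice :: "('i \<Rightarrow> qvec \<Rightarrow> qvec) \<Rightarrow> qvec \<Rightarrow> qvec set" where
  "q_lattice ft u = qscale qvar ` crystal_lattice ft u"

text \<open>The action on \<open>L / qL\<close> of an operator \<open>t\<close> on \<open>L\<close>, where \<open>Q = qL\<close>, elements of \<open>L / qL\<close> are
  cosets, and the zero coset becomes \<open>None\<close>.\<close>

definition coset_op :: "qvec set \<Rightarrow> (qvec \<Rightarrow> qvec) \<Rightarrow> qvec set \<Rightarrow> qvec set option" where
  "coset_op Q t X = (let Y = {w. \<exists>v\<in>X. w - t v \<in> Q} in if 0 \<in> Y then None else Some Y)"

text \<open>\<open>B(\<lambda>) = {f\<^sub>i\<^sub>1 \<cdots> f\<^sub>i\<^sub>l u mod qL} - {0}\<close> with its crystal structure.\<close>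

definition kashiwara_crystal ::
  "('i \<Rightarrow> nat) \<Rightarrow> nat \<Rightarrow> ('i \<Rightarrow> qvec \<Rightarrow> qvec) \<Rightarrow> ('i \<Rightarrow> qvec \<Rightarrow> qvec) \<Rightarrow> ('i \<Rightarrow> qvec \<Rightarrow> qvec) \<Rightarrow> qvec \<Rightarrow>
     ('i, qvec set) crystal" where
  "kashiwara_crystal d N K et ft u =
     \<lparr> elts = {{w. w - v \<in> q_lattice ft u} | v. v \<in> kashiwara_monomials ft u \<and> v \<notin> q_lattice ft u},
       wt = (\<lambda>X. THE \<mu>. X \<inter> qweight_space d N K \<mu> \<noteq> {}),
       eop = (\<lambda>i. coset_op (q_lattice ft u) (et i)),
       fop = (\<lambda>i. coset_op (q_lattice ft u) (ft i)) \<rparr>"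

text \<open>The last condition determines the crystal \<open>B\<close> up to isomorphism. That it is connected with a
  highest weight element of weight \<open>\<lambda>\<close> is a theorem of Kashiwara.\<close>

definition crystal_of_simple_module ::
  "('i \<Rightarrow> 'i \<Rightarrow> int) \<Rightarrow> 'i weight \<Rightarrow> ('i, 'b) crystal \<Rightarrow> bool" where
  "crystal_of_simple_module A lam B \<longleftrightarrow>
     is_crystal A B \<and> connected_crystal B \<and>
     (\<exists>b. highest_weight_elt B b \<and> wt B b = lam) \<and>
     (\<exists>d N E F K K' u et ft.
        symmetrizer A d \<and> simple_uq_module A d N E F K K' \<and> highest_weight_vector d N E K lam u \<and>
        kashiwara_ops d N E F K et ft \<and>
        isomorphic_crystals B (kashiwara_crystal d N K et ft u))"


section \<open>The category of crystals\<close>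

text \<open>Objects: crystals all of whose connected components are isomorphic to some \<open>B(\<lambda>)\<close>, that
  is, finite disjoint unions of crystals \<open>B(\<lambda>)\<close>. \<open>BB\<close> is the family \<open>\<lambda> \<mapsto> B(\<lambda>)\<close>.\<close>

definition gcrys_object ::
  "('i \<Rightarrow> 'i \<Rightarrow> int) \<Rightarrow> ('i weight \<Rightarrow> ('i, 'b) crystal) \<Rightarrow> ('i, 'c) crystal \<Rightarrow> bool" where
  "gcrys_object A BB C \<longleftrightarrow>
     is_crystal A C \<and>
     (\<forall>X\<in>components C. \<exists>lam. dominant lam \<and> isomorphic_crystals (C\<lparr>elts := X\<rparr>) (BB lam))"

text \<open>A linear map from the span of \<open>B\<close> to the span of \<open>C\<close> is given by its matrix \<open>M\<close>, where \<open>M c b\<close>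
  is the coefficient of \<open>c\<close> in the image of \<open>b\<close>.\<close>

type_synonym ('b, 'c, 'k) lin = "'c \<Rightarrow> 'b \<Rightarrow> 'k"

definition lin_of :: "('b \<Rightarrow> 'c option) \<Rightarrow> ('b, 'c, 'k::field) lin" where
  "lin_of \<psi> = (\<lambda>c b. if \<psi> b = Some c then 1 else 0)"

definition lin_scale :: "'k::field \<Rightarrow> ('b, 'c, 'k) lin \<Rightarrow> ('b, 'c, 'k) lin" where
  "lin_scale a M = (\<lambda>c b. a * M c b)"

definition lin_comp ::
  "('i, 'c) crystal \<Rightarrow> ('c, 'd, 'k::field) lin \<Rightarrow> ('b, 'c, 'k) lin \<Rightarrow> ('b, 'd, 'k) lin" where
  "lin_comp C N M = (\<lambda>d b. \<Sum>c\<in>elts C. N d c * M c b)"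

definition gcrys_hom :: "('i, 'b) crystal \<Rightarrow> ('i, 'c) crystal \<Rightarrow> ('b, 'c, 'k::field) lin set" where
  "gcrys_hom B C = module.span lin_scale (lin_of ` crys_hom B C)"

definition is_basis_of :: "('b, 'c, 'k::field) lin set \<Rightarrow> ('b, 'c, 'k) lin set \<Rightarrow> bool" where
  "is_basis_of S V \<longleftrightarrow> \<not> module.dependent lin_scale S \<and> module.span lin_scale S = V"

definition basic_morphism :: "('i, 'b) crystal \<Rightarrow> ('b, 'c, 'k::field) lin \<Rightarrow> bool" where
  "basic_morphism B M \<longleftrightarrow> (\<exists>X\<in>components B. \<forall>b\<in>elts B - X. \<forall>c. M c b = 0)"


section \<open>Tensor words\<close>

text \<open>Elements \<open>b\<^sub>1 \<otimes> \<cdots> \<otimes> b\<^sub>m\<close> of a tensor word are lists, which makes the tensor product of words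
  strictly associative and unital.\<close>

definition unit_crystal :: "('i, 'b list) crystal" where
  "unit_crystal = \<lparr> elts = {[]}, wt = (\<lambda>_. 0), eop = (\<lambda>_ _. None), fop = (\<lambda>_ _. None) \<rparr>"

definition cons_crystal :: "('i, 'b \<times> 'b list) crystal \<Rightarrow> ('i, 'b list) crystal" where
  "cons_crystal T =
     \<lparr> elts = (\<lambda>(b, bs). b # bs) ` elts T,
       wt = (\<lambda>x. wt T (hd x, tl x)),
       eop = (\<lambda>i x. map_option (\<lambda>(b, bs). b # bs) (eop T i (hd x, tl x))),
       fop = (\<lambda>i x. map_option (\<lambda>(b, bs). b # bs) (fop T i (hd x, tl x))) \<rparr>"

primrec word_crystal :: "('i \<Rightarrow> ('i, 'b) crystal) \<Rightarrow> 'i list \<Rightarrow> ('i, 'b list) crystal" where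
  "word_crystal B [] = unit_crystal"
| "word_crystal B (i # w) = cons_crystal (tensor_crystal (B i) (word_crystal B w))"

definition word_weight :: "'i list \<Rightarrow> 'i weight" where
  "word_weight w = sum_list (map fund_weight w)"

definition word_highest :: "('i \<Rightarrow> ('i, 'b) crystal) \<Rightarrow> 'i list \<Rightarrow> 'b list" where
  "word_highest B w =
     (THE x. highest_weight_elt (word_crystal B w) x \<and> wt (word_crystal B w) x = word_weight w)"

definition top_component :: "('i \<Rightarrow> ('i, 'b) crystal) \<Rightarrow> 'i list \<Rightarrow> 'b list set" where
  "top_component B w = component (word_crystal B w) (word_highest B w)"

type_synonym 'b wmap = "'b list \<Rightarrow> 'b list option"

definition id_map :: "('i \<Rightarrow> ('i, 'b) crystal) \<Rightarrow> 'i list \<Rightarrow> 'b wmap" where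
  "id_map B w = (\<lambda>x. if x \<in> elts (word_crystal B w) then Some x else None)"

text \<open>\<open>\<psi> \<otimes> \<chi>\<close>, where the domain of \<open>\<psi>\<close> is a tensor word of length \<open>m\<close>.\<close>

definition tensor_map :: "nat \<Rightarrow> 'b wmap \<Rightarrow> 'b wmap \<Rightarrow> 'b wmap" where
  "tensor_map m \<psi> \<chi> = (\<lambda>x. case (\<psi> (take m x), \<chi> (drop m x)) of
                              (Some y, Some z) \<Rightarrow> Some (y @ z) | _ \<Rightarrow> None)"

definition flip_map :: "('b \<Rightarrow> 'c option) \<Rightarrow> 'c \<Rightarrow> 'b option" where
  "flip_map \<psi> = (\<lambda>y. if y \<in> ran \<psi> then Some (THE x. \<psi> x = Some y) else None)"

definition jones_wenzl :: "('i \<Rightarrow> ('i, 'b) crystal) \<Rightarrow> 'i list \<Rightarrow> 'b wmap" where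
  "jones_wenzl B w = (\<lambda>x. if x \<in> top_component B w then Some x else None)"


section \<open>Atoms\<close>

definition eps_word :: "('i::{finite,linorder} \<Rightarrow> ('i, 'b) crystal) \<Rightarrow> 'i \<Rightarrow> 'b \<Rightarrow> 'i list" where
  "eps_word B k b = concat (map (\<lambda>i. replicate (eps (B k) i b) i) (sorted_list_of_set UNIV))"

definition phi_word :: "('i::{finite,linorder} \<Rightarrow> ('i, 'b) crystal) \<Rightarrow> 'i \<Rightarrow> 'b \<Rightarrow> 'i list" where
  "phi_word B k b = concat (map (\<lambda>i. replicate (phi (B k) i b) i) (sorted_list_of_set UNIV))"

definition atom :: "('i::{finite,linorder} \<Rightarrow> ('i, 'b) crystal) \<Rightarrow> 'i \<Rightarrow> 'b \<Rightarrow> 'b wmap" where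
  "atom B k b =
     (let W = word_crystal B (eps_word B k b @ [k]) in
      THE \<psi>. \<psi> \<in> crys_hom W (word_crystal B (phi_word B k b)) \<and>
             dom \<psi> = component W (word_highest B (eps_word B k b) @ [b]) \<and>
             ran \<psi> = top_component B (phi_word B k b))"


section \<open>Crossings and permutations\<close>

text \<open>\<open>cr i j\<close> is the crossing \<open>\<beta>\<^sub>i\<^sub>,\<^sub>j\<close> for \<open>i \<noteq> j\<close>. A composite of crossings is described by the
  list \<open>ps\<close> of positions at which, in order, neighbouring factors are crossed.\<close>

definition swap_at :: "'a list \<Rightarrow> nat \<Rightarrow> 'a list" where
  "swap_at xs p = xs[p := xs ! Suc p, Suc p := xs ! p]"

definition swap_all :: "'a list \<Rightarrow> nat list \<Rightarrow> 'a list" where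
  "swap_all xs ps = foldl swap_at xs ps"

definition crossing_at ::
  "('i \<Rightarrow> ('i, 'b) crystal) \<Rightarrow> ('i \<Rightarrow> 'i \<Rightarrow> 'b wmap) \<Rightarrow> 'i list \<Rightarrow> nat \<Rightarrow> 'b wmap" where
  "crossing_at B cr w p =
     tensor_map p (id_map B (take p w))
       (tensor_map 2 (cr (w ! p) (w ! Suc p)) (id_map B (drop (p + 2) w)))"

primrec crossings_map ::
  "('i \<Rightarrow> ('i, 'b) crystal) \<Rightarrow> ('i \<Rightarrow> 'i \<Rightarrow> 'b wmap) \<Rightarrow> nat list \<Rightarrow> 'i list \<Rightarrow> 'b wmap" where
  "crossings_map B cr [] w = id_map B w"
| "crossings_map B cr (p # ps) w = crossings_map B cr ps (swap_at w p) \<circ>\<^sub>m crossing_at B cr w p"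

text \<open>The pairs of strands crossed, in order, starting from the strands \<open>s\<close> from left to right; the
  left strand of each crossing comes first in the pair.\<close>

primrec crossed_pairs :: "nat list \<Rightarrow> nat list \<Rightarrow> (nat \<times> nat) list" where
  "crossed_pairs [] s = []"
| "crossed_pairs (p # ps) s = (s ! p, s ! Suc p) # crossed_pairs ps (swap_at s p)"

text \<open>Strands of equal label do not cross, two strands cross at most once, and three strands
  \<open>x < y < z\<close> that are completely reversed cross in the order \<open>xy, xz, yz\<close>, as in
  \<open>(\<beta>\<^sub>j\<^sub>,\<^sub>k \<otimes> id)(id \<otimes> \<beta>\<^sub>i\<^sub>,\<^sub>k)(\<beta>\<^sub>i\<^sub>,\<^sub>j \<otimes> id)\<close>.\<close>

definition admissible_crossings :: "'i list \<Rightarrow> nat list \<Rightarrow> bool" where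
  "admissible_crossings w ps \<longleftrightarrow>
     (\<forall>p\<in>set ps. Suc p < length w) \<and>
     (let cs = crossed_pairs ps [0..<length w] in
        (\<forall>(x, y)\<in>set cs. w ! x \<noteq> w ! y) \<and>
        (\<forall>a b. a < b \<and> b < length cs \<longrightarrow> {fst (cs ! a), snd (cs ! a)} \<noteq> {fst (cs ! b), snd (cs ! b)}) \<and>
        (\<forall>x y z. x < y \<and> y < z \<and> {(x, y), (x, z), (y, z)} \<subseteq> set cs \<longrightarrow>
           (\<exists>a b c. a < b \<and> b < c \<and> c < length cs \<and>
              cs ! a = (x, y) \<and> cs ! b = (x, z) \<and> cs ! c = (y, z))))"

definition is_permutation ::
  "('i \<Rightarrow> ('i, 'b) crystal) \<Rightarrow> ('i \<Rightarrow> 'i \<Rightarrow> 'b wmap) \<Rightarrow> 'i list \<Rightarrow> 'i list \<Rightarrow> 'b wmap \<Rightarrow> bool" where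
  "is_permutation B cr w w' P \<longleftrightarrow>
     (\<exists>ps. admissible_crossings w ps \<and> swap_all w ps = w' \<and> P = crossings_map B cr ps w)"

text \<open>A permutation of \<open>w\<close> with fewest crossings whose codomain ends in the word \<open>v\<close>.\<close>

definition minimal_crossings :: "'i list \<Rightarrow> 'i list \<Rightarrow> nat list" where
  "minimal_crossings w v =
     (ARG_MIN length ps. admissible_crossings w ps \<and> (\<exists>w'. swap_all w ps = w' @ v))"


section \<open>Distinguished bottom diagrams\<close>

text \<open>\<open>bottom B cr w bs \<delta> D\<close>: the diagram \<open>D\<close> with codomain \<open>B\<^sub>\<delta>\<close> is attached to the component of
  \<open>B\<^sub>w\<close> with highest weight element \<open>bs\<close>.\<close>

inductive bottom ::
  "('i::{finite,linorder} \<Rightarrow> ('i, 'b) crystal) \<Rightarrow> ('i \<Rightarrow> 'i \<Rightarrow> 'b wmap) \<Rightarrow>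
     'i list \<Rightarrow> 'b list \<Rightarrow> 'i list \<Rightarrow> 'b wmap \<Rightarrow> bool"
  for B cr where
  empty: "bottom B cr [] [] [] (id_map B [])"
| snoc: "bottom B cr (w @ [k]) (bs @ [b]) (\<delta>' @ phi_word B k b)
           (tensor_map (length \<delta>') (id_map B \<delta>') (atom B k b) \<circ>\<^sub>m
            tensor_map (length w) (crossings_map B cr ps \<delta> \<circ>\<^sub>m D) (id_map B [k]))"
  if "bottom B cr w bs \<delta> D"
     and "highest_weight_elt (word_crystal B (w @ [k])) (bs @ [b])"
     and "ps = minimal_crossings \<delta> (eps_word B k b)"
     and "swap_all \<delta> ps = \<delta>' @ eps_word B k b"

record ('i, 'b) diagram =
  dom_word :: "'i list"
  cod_word :: "'i list"
  dmap :: "'b wmap"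

definition bottom_diagrams ::
  "('i::{finite,linorder} \<Rightarrow> ('i, 'b) crystal) \<Rightarrow> ('i \<Rightarrow> 'i \<Rightarrow> 'b wmap) \<Rightarrow> 'i list \<Rightarrow> 'i weight \<Rightarrow>
     ('i, 'b) diagram set" where
  "bottom_diagrams B cr w lam =
     {\<lparr> dom_word = w, cod_word = \<delta>, dmap = D \<rparr> | bs \<delta> D. bottom B cr w bs \<delta> D \<and> word_weight \<delta> = lam}"

text \<open>The morphism obtained from \<open>flip f \<circ> P \<circ> g\<close> by inserting the Jones--Wenzl projector of the
  codomain of \<open>P\<close>.\<close>

definition hat ::
  "('i \<Rightarrow> ('i, 'b) crystal) \<Rightarrow> ('i, 'b) diagram \<Rightarrow> 'b wmap \<Rightarrow> ('i, 'b) diagram \<Rightarrow>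
     ('b list, 'b list, 'k::field) lin" where
  "hat B f P g = lin_of (flip_map (dmap f) \<circ>\<^sub>m jones_wenzl B (cod_word f) \<circ>\<^sub>m P \<circ>\<^sub>m dmap g)"

definition hat_basis ::
  "('i::{finite,linorder} \<Rightarrow> ('i, 'b) crystal) \<Rightarrow> ('i \<Rightarrow> 'i \<Rightarrow> 'b wmap) \<Rightarrow>
     (('i, 'b) diagram \<Rightarrow> ('i, 'b) diagram \<Rightarrow> 'b wmap) \<Rightarrow> 'i list \<Rightarrow> 'i list \<Rightarrow>
     ('b list, 'b list, 'k::field) lin set" where
  "hat_basis B cr P w w' =
     {hat B f (P f g) g | f g lam.
        dominant lam \<and> f \<in> bottom_diagrams B cr w' lam \<and> g \<in> bottom_diagrams B cr w lam}"

end

(*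
  Each component of a tensor word is isomorphic to some B(\<lambda>), hence contains exactly one highest
  weight element and is generated by it. Therefore a strict morphism supported on the component of
  x is determined by the image y of x, which is a highest weight element of the same weight, and
  every such pair (x, y) occurs: these maps are matrix units, and the pairs (x, y) index a basis of
  Hom, which is seen to be independent by reading off the matrix entry at (y, x). A bottom diagram
  is a morphism, injective outside its kernel, that sends the highest weight element attached to it
  to the highest element of its codomain; permutations preserve the highest elements. So the
  Jones-Wenzl projector cuts the composite belonging to (f, g) down to the matrix unit for the pair
  of highest weight elements attached to g and f.

  The highest element of a word is unique because the simple roots are linearly independent. No Lie
  theory is needed for this: weights add up to zero over a finite crystal, so a linear relation
  between the rows of the Cartan matrix, whose coefficient vector pairs to a constant with all
  weights of B(\<omega>\<^sub>i), would vanish on \<omega>\<^sub>i.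
*)

theory Submission
  imports Defs "HOL-Library.Sublist" "HOL-Library.Multiset"
begin

section \<open>Strings\<close>

text \<open>Three points shape the work. \<open>eps\<close> and \<open>phi\<close> are maxima of
  sets of exponents, meaningless until every string is known to end; the diagonal entry 2 of the
  Cartan matrix forces this, and the lengths then decide on which tensor factor an arrow acts. Words
  are nested to the right while bottom diagrams grow at the right end, so tensoring has to be
  associative before a last letter can be split off. Highest elements, atoms and minimal
  permutations are given by \<open>THE\<close> or \<open>ARG_MIN\<close>, so each must be shown to
  denote what it should: by linear independence of the simple roots, by a map through a common
  B(lambda), and by insertion sort. All diagrams are handled as strict morphisms that are injective
  outside their kernel, a class closed under composition, tensor products and flips. That B(lambda)
  has only one highest weight element comes from Kashiwara's construction: the monomials that define
  the crystal reach every element from the class of the highest weight vector.\<close>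

definition string_length :: "('b \<Rightarrow> 'b option) \<Rightarrow> 'b \<Rightarrow> nat \<Rightarrow> bool" where
  "string_length g x n \<longleftrightarrow> (\<forall>m. iterate_op g m x \<noteq> None \<longleftrightarrow> m \<le> n)"

lemma iterate_op_0 [simp]: "iterate_op g 0 x = Some x"
  by (simp add: iterate_op_def)

lemma iterate_op_Suc: "iterate_op g (Suc m) x = Option.bind (g x) (iterate_op g m)"
proof -
  have "((\<lambda>x. Option.bind x g) ^^ m) None = None"
    by (induction m) auto
  then show ?thesis
    by (cases "g x") (simp_all add: iterate_op_def funpow_Suc_right del: funpow.simps)
qed

lemma string_length_None: "g x = None \<Longrightarrow> string_length g x 0"
  unfolding string_length_def
proof
  fix m assume "g x = None"
  then show "iterate_op g m x \<noteq> None \<longleftrightarrow> m \<le> 0"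
    by (cases m) (auto simp: iterate_op_Suc)
qed

lemma string_length_Suc:
  assumes "g x = Some y" "string_length g y n"
  shows "string_length g x (Suc n)"
  unfolding string_length_def
proof
  fix m show "iterate_op g m x \<noteq> None \<longleftrightarrow> m \<le> Suc n"
    using assms by (cases m) (auto simp: iterate_op_Suc string_length_def)
qed

text \<open>\<open>Max\<close> of an infinite set is unspecified, so \<open>eps\<close> and
  \<open>phi\<close> carry information only once the exponents are known to form an initial segment
  \<open>{..n}\<close>.\<close>

lemma string_length_Max:
  assumes "string_length g x n"
  shows "Max {m. iterate_op g m x \<noteq> None} = n"
proof -
  have "{m. iterate_op g m x \<noteq> None} = {..n}"
    using assms by (auto simp: string_length_def)
  then show ?thesis by (simp add: Max_eq_iff)
qed

text \<open>A strictly increasing integer potential takes only finitely many values on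
  \<open>S\<close>; the induction is on its distance from the maximum.\<close>

lemma string_length_exists:
  fixes \<mu> :: "'b \<Rightarrow> int"
  assumes "finite S" and "\<And>x y. x \<in> S \<Longrightarrow> g x = Some y \<Longrightarrow> y \<in> S \<and> \<mu> x < \<mu> y" and "x \<in> S"
  shows "\<exists>n. string_length g x n"
  using assms(3)
proof (induction "nat (Max (\<mu> ` S) - \<mu> x)" arbitrary: x rule: less_induct)
  case less
  show ?case
  proof (cases "g x")
    case None
    then show ?thesis using string_length_None by metis
  next
    case (Some y)
    then have y: "y \<in> S" "\<mu> x < \<mu> y" using assms(2) less.prems by auto
    then have "\<mu> y \<le> Max (\<mu> ` S)" using assms(1) by simp
    then have "nat (Max (\<mu> ` S) - \<mu> y) < nat (Max (\<mu> ` S) - \<mu> x)" using y by linarith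
    then obtain n where "string_length g y n" using less.hyps y by blast
    then show ?thesis using string_length_Suc Some by metis
  qed
qed


section \<open>Crystals\<close>

text \<open>The flag makes the operators \<open>e\<^sub>i\<close> and \<open>f\<^sub>i\<close>, and likewise \<open>\<epsilon>\<^sub>i\<close> and \<open>\<phi>\<^sub>i\<close>, accessible to
  uniform arguments; reversing an arrow negates it.\<close>

definition arrow :: "('i, 'b) crystal \<Rightarrow> bool \<Rightarrow> 'i \<Rightarrow> 'b \<Rightarrow> 'b option" where
  "arrow C s i = (if s then eop C i else fop C i)"

definition len :: "('i, 'b) crystal \<Rightarrow> bool \<Rightarrow> 'i \<Rightarrow> 'b \<Rightarrow> nat" where
  "len C s i b = (if s then eps C i b else phi C i b)"

lemma len_Max: "len C s i b = Max {m. iterate_op (arrow C s i) m b \<noteq> None}"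
  by (simp add: len_def arrow_def eps_def phi_def)

lemma string_length_len: "string_length (arrow C s i) b n \<Longrightarrow> len C s i b = n"
  unfolding len_Max by (rule string_length_Max)

lemma crystal_edges_arrow:
  "(b, b') \<in> crystal_edges C \<longleftrightarrow> b \<in> elts C \<and> (\<exists>s i. arrow C s i b = Some b')"
  unfolding crystal_edges_def arrow_def by auto

lemma is_crystalD:
  assumes "is_crystal A C"
  shows "finite (elts C)"
    and "b \<in> elts C \<Longrightarrow> eop C i b = Some b' \<Longrightarrow> b' \<in> elts C"
    and "b \<in> elts C \<Longrightarrow> eop C i b = Some b' \<Longrightarrow> wt C b' = wt C b + root_weight A i"
    and "b \<in> elts C \<Longrightarrow> fop C i b = Some b' \<Longrightarrow> b' \<in> elts C"
    and "b \<in> elts C \<Longrightarrow> fop C i b = Some b' \<Longrightarrow> wt C b' = wt C b - root_weight A i"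
    and "b \<in> elts C \<Longrightarrow> wt C b i = int (phi C i b) - int (eps C i b)"
    and "b \<in> elts C \<Longrightarrow> b' \<in> elts C \<Longrightarrow> eop C i b = Some b' \<longleftrightarrow> fop C i b' = Some b"
proof -
  note a = assms[unfolded is_crystal_def]
  note ops = a[THEN conjunct2, THEN conjunct1, THEN bspec, THEN spec]
  note e = ops[THEN conjunct1, THEN spec, THEN mp]
  note f = ops[THEN conjunct2, THEN conjunct1, THEN spec, THEN mp]
  show "finite (elts C)" using a by (rule conjunct1)
  show "b' \<in> elts C" if "b \<in> elts C" "eop C i b = Some b'" using e[OF that] by (rule conjunct1)
  show "wt C b' = wt C b + root_weight A i" if "b \<in> elts C" "eop C i b = Some b'"
    using e[OF that] by (rule conjunct2)
  show "b' \<in> elts C" if "b \<in> elts C" "fop C i b = Some b'" using f[OF that] by (rule conjunct1)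
  show "wt C b' = wt C b - root_weight A i" if "b \<in> elts C" "fop C i b = Some b'"
    using f[OF that] by (rule conjunct2)
  show "wt C b i = int (phi C i b) - int (eps C i b)" if "b \<in> elts C"
    using ops[OF that, THEN conjunct2, THEN conjunct2] by (rule sym)
  show "eop C i b = Some b' \<longleftrightarrow> fop C i b' = Some b" if "b \<in> elts C" "b' \<in> elts C"
    using a[THEN conjunct2, THEN conjunct2, THEN bspec, THEN bspec, THEN spec] that .
qed

lemma crystal_arrow_elts:
  "is_crystal A C \<Longrightarrow> b \<in> elts C \<Longrightarrow> arrow C s i b = Some b' \<Longrightarrow> b' \<in> elts C"
  using is_crystalD(2,4)[of A C b i b'] by (cases s) (simp_all add: arrow_def)

lemma crystal_arrow_wt:
  "is_crystal A C \<Longrightarrow> b \<in> elts C \<Longrightarrow> arrow C s i b = Some b' \<Longrightarrow>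
     wt C b' = (if s then wt C b + root_weight A i else wt C b - root_weight A i)"
  using is_crystalD(3,5)[of A C b i b'] by (cases s) (simp_all add: arrow_def)

lemma crystal_arrow_reverse:
  assumes "is_crystal A C" "b \<in> elts C" "arrow C s i b = Some b'"
  shows "arrow C (\<not> s) i b' = Some b"
proof -
  have "b' \<in> elts C" using crystal_arrow_elts assms by metis
  then show ?thesis
    using assms(2,3) is_crystalD(7)[OF assms(1), of b b' i] is_crystalD(7)[OF assms(1), of b' b i]
    by (cases s) (simp_all add: arrow_def)
qed

lemma crystal_wt:
  "is_crystal A C \<Longrightarrow> b \<in> elts C \<Longrightarrow> wt C b i = int (len C False i b) - int (len C True i b)"
  unfolding len_def using is_crystalD(6) by metis

text \<open>Reversing arrows turns the weight rule for \<open>e\<close> into the one for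
  \<open>f\<close>, so only the former is asked for.\<close>

lemma is_crystalI:
  assumes "finite (elts C)"
    and "\<And>b b' s i. b \<in> elts C \<Longrightarrow> arrow C s i b = Some b' \<Longrightarrow>
           b' \<in> elts C \<and> arrow C (\<not> s) i b' = Some b"
    and "\<And>b b' i. b \<in> elts C \<Longrightarrow> arrow C True i b = Some b' \<Longrightarrow> wt C b' = wt C b + root_weight A i"
    and "\<And>b i. b \<in> elts C \<Longrightarrow> wt C b i = int (len C False i b) - int (len C True i b)"
  shows "is_crystal A C"
proof -
  have e: "b' \<in> elts C \<and> fop C i b' = Some b \<and> wt C b' = wt C b + root_weight A i"
    if "b \<in> elts C" "eop C i b = Some b'" for b b' i
    using that assms(2)[of b True i b'] assms(3)[of b i b'] by (simp add: arrow_def)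
  have f: "b' \<in> elts C \<and> eop C i b' = Some b" if "b \<in> elts C" "fop C i b = Some b'" for b b' i
    using that assms(2)[of b False i b'] by (simp add: arrow_def)
  have "wt C b' = wt C b - root_weight A i" if "b \<in> elts C" "fop C i b = Some b'" for b b' i
    using f[OF that] e[of b' i b] by simp
  then show ?thesis
    unfolding is_crystal_def
  proof (intro conjI ballI allI impI)
    fix b i assume "b \<in> elts C"
    then show "int (phi C i b) - int (eps C i b) = wt C b i" using assms(4) by (simp add: len_def)
  qed (use e f assms(1) in blast)+
qed

locale cartan_diagonal =
  fixes A :: "'i \<Rightarrow> 'i \<Rightarrow> int"
  assumes diagonal: "A i i = 2"
begin

text \<open>The potential is the \<open>i\<close>-th weight coordinate, with a sign for the
  direction: since \<open>A i i = 2\<close>, it rises by 2 with each step.\<close>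

lemma crystal_string:
  assumes C: "is_crystal A C" and b: "b \<in> elts C"
  shows "string_length (arrow C s i) b (len C s i b)"
proof -
  have "y \<in> elts C \<and> (if s then wt C x i else - wt C x i) < (if s then wt C y i else - wt C y i)"
    if "x \<in> elts C" "arrow C s i x = Some y" for x y
    using crystal_arrow_elts[OF C that] crystal_arrow_wt[OF C that] diagonal[of i]
    by (simp add: root_weight_def)
  moreover have "finite (elts C)" using is_crystalD(1)[OF C] .
  ultimately obtain n where "string_length (arrow C s i) b n"
    using string_length_exists[of "elts C" "arrow C s i" "\<lambda>x. if s then wt C x i else - wt C x i"] b
    by meson
  then show ?thesis using string_length_len by metis
qed

lemma len_None: "arrow C s i b = None \<Longrightarrow> len C s i b = 0"
  by (rule string_length_len, rule string_length_None)

lemma len_Some: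
  assumes "is_crystal A C" "b \<in> elts C" "arrow C s i b = Some b'"
  shows "len C s i b = Suc (len C s i b')" "len C (\<not> s) i b' = Suc (len C (\<not> s) i b)"
proof -
  have b': "b' \<in> elts C" using crystal_arrow_elts assms by metis
  show "len C s i b = Suc (len C s i b')"
    using assms(3) crystal_string[OF assms(1) b'] by (intro string_length_len string_length_Suc)
  show "len C (\<not> s) i b' = Suc (len C (\<not> s) i b)"
    using crystal_arrow_reverse[OF assms] crystal_string[OF assms(1,2)]
    by (intro string_length_len string_length_Suc)
qed

lemma len_eq_0_iff: "is_crystal A C \<Longrightarrow> b \<in> elts C \<Longrightarrow> len C s i b = 0 \<longleftrightarrow> arrow C s i b = None"
  using len_None[of C s i b] len_Some(1)[of C b s i] by (cases "arrow C s i b") auto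

end

section \<open>Strings and crystal axioms for the tensor product of two crystals\<close>

lemma tensor_simps:
  "elts (tensor_crystal C D) = elts C \<times> elts D"
  "wt (tensor_crystal C D) (b, c) = wt C b + wt D c"
  "arrow (tensor_crystal C D) s i (b, c) =
     (if (if s then len C False i b \<ge> len D True i c else len C False i b > len D True i c)
      then map_option (\<lambda>b'. (b', c)) (arrow C s i b)
      else map_option (\<lambda>c'. (b, c')) (arrow D s i c))"
  by (auto simp: tensor_crystal_def arrow_def len_def)

context cartan_diagonal begin

text \<open>While \<open>phi b < eps c\<close> the operator \<open>e\<close> acts on
  \<open>c\<close>, which happens \<open>eps c - phi b\<close> times (truncated). After that it acts
  on \<open>b\<close> for good, because each such step raises \<open>phi b\<close>.\<close>

lemma tensor_string_True:
  assumes C: "is_crystal A C" and D: "is_crystal A D" and "b \<in> elts C" "c \<in> elts D"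
  shows "string_length (arrow (tensor_crystal C D) True i) (b, c)
     (len C True i b + (len D True i c - len C False i b))"
  using assms(3,4)
proof (induction "len C True i b + len D True i c" arbitrary: b c rule: less_induct)
  case less
  show ?case
  proof (cases "len C False i b \<ge> len D True i c")
    case True
    show ?thesis
    proof (cases "arrow C True i b")
      case None
      then show ?thesis using True len_None[OF None]
        by (auto intro!: string_length_None simp: tensor_simps)
    next
      case (Some b')
      note l = len_Some[OF C less.prems(1) Some]
      have "b' \<in> elts C" using crystal_arrow_elts[OF C less.prems(1) Some] .
      then have "string_length (arrow (tensor_crystal C D) True i) (b', c)
         (len C True i b' + (len D True i c - len C False i b'))"
        by (intro less.hyps) (use less.prems l in auto)
      moreover have "arrow (tensor_crystal C D) True i (b, c) = Some (b', c)"
        using True Some by (simp add: tensor_simps)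
      ultimately have "string_length (arrow (tensor_crystal C D) True i) (b, c)
         (Suc (len C True i b' + (len D True i c - len C False i b')))"
        by (intro string_length_Suc)
      then show ?thesis using l True by simp
    qed
  next
    case False
    then obtain c' where c': "arrow D True i c = Some c'"
      using len_None[of D True i c] by (cases "arrow D True i c") auto
    note l = len_Some[OF D less.prems(2) c']
    have "c' \<in> elts D" using crystal_arrow_elts[OF D less.prems(2) c'] .
    then have "string_length (arrow (tensor_crystal C D) True i) (b, c')
       (len C True i b + (len D True i c' - len C False i b))"
      by (intro less.hyps) (use less.prems l in auto)
    moreover have "arrow (tensor_crystal C D) True i (b, c) = Some (b, c')"
      using False c' by (simp add: tensor_simps)
    ultimately have "string_length (arrow (tensor_crystal C D) True i) (b, c)
       (Suc (len C True i b + (len D True i c' - len C False i b)))"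
      by (intro string_length_Suc)
    then show ?thesis using l False by (simp add: Suc_diff_le)
  qed
qed

text \<open>Here \<open>f\<close> acts on \<open>b\<close> as long as \<open>phi b > eps c\<close>,
  and then only on \<open>c\<close>, because each step on \<open>c\<close> raises
  \<open>eps c\<close>.\<close>

lemma tensor_string_False:
  assumes C: "is_crystal A C" and D: "is_crystal A D" and "b \<in> elts C" "c \<in> elts D"
  shows "string_length (arrow (tensor_crystal C D) False i) (b, c)
     (len D False i c + (len C False i b - len D True i c))"
  using assms(3,4)
proof (induction "len C False i b + len D False i c" arbitrary: b c rule: less_induct)
  case less
  show ?case
  proof (cases "len C False i b > len D True i c")
    case False
    show ?thesis
    proof (cases "arrow D False i c")
      case None
      then show ?thesis using False len_None[OF None]
        by (auto intro!: string_length_None simp: tensor_simps)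
    next
      case (Some c')
      note l = len_Some[OF D less.prems(2) Some]
      have "c' \<in> elts D" using crystal_arrow_elts[OF D less.prems(2) Some] .
      then have "string_length (arrow (tensor_crystal C D) False i) (b, c')
         (len D False i c' + (len C False i b - len D True i c'))"
        by (intro less.hyps) (use less.prems l in auto)
      moreover have "arrow (tensor_crystal C D) False i (b, c) = Some (b, c')"
        using False Some by (simp add: tensor_simps)
      ultimately have "string_length (arrow (tensor_crystal C D) False i) (b, c)
         (Suc (len D False i c' + (len C False i b - len D True i c')))"
        by (intro string_length_Suc)
      then show ?thesis using l False by simp
    qed
  next
    case True
    then obtain b' where b': "arrow C False i b = Some b'"
      using len_None[of C False i b] by (cases "arrow C False i b") auto
    note l = len_Some[OF C less.prems(1) b']
    have "b' \<in> elts C" using crystal_arrow_elts[OF C less.prems(1) b'] .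
    then have "string_length (arrow (tensor_crystal C D) False i) (b', c)
       (len D False i c + (len C False i b' - len D True i c))"
      by (intro less.hyps) (use less.prems l in auto)
    moreover have "arrow (tensor_crystal C D) False i (b, c) = Some (b', c)"
      using True b' by (simp add: tensor_simps)
    ultimately have "string_length (arrow (tensor_crystal C D) False i) (b, c)
       (Suc (len D False i c + (len C False i b' - len D True i c)))"
      by (intro string_length_Suc)
    then show ?thesis using l True by (simp add: Suc_diff_le)
  qed
qed

lemma tensor_len:
  assumes "is_crystal A C" "is_crystal A D" "b \<in> elts C" "c \<in> elts D"
  shows "len (tensor_crystal C D) True i (b, c) = len C True i b + (len D True i c - len C False i b)"
    and "len (tensor_crystal C D) False i (b, c) = len D False i c + (len C False i b - len D True i c)"
  using tensor_string_True[OF assms] tensor_string_False[OF assms] string_length_len by metis+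

lemma is_crystal_tensor:
  assumes C: "is_crystal A C" and D: "is_crystal A D"
  shows "is_crystal A (tensor_crystal C D)"
proof (rule is_crystalI)
  show "finite (elts (tensor_crystal C D))"
    using is_crystalD(1)[OF C] is_crystalD(1)[OF D] by (simp add: tensor_simps)
next
  fix x y s i
  assume "x \<in> elts (tensor_crystal C D)" and xy: "arrow (tensor_crystal C D) s i x = Some y"
  then obtain b c where x: "x = (b, c)" and b: "b \<in> elts C" and c: "c \<in> elts D"
    by (auto simp: tensor_simps)
  show "y \<in> elts (tensor_crystal C D) \<and> arrow (tensor_crystal C D) (\<not> s) i y = Some x"
  \<comment> \<open>The asymmetry between \<open>\<ge>\<close> for \<open>e\<close> and
    \<open>>\<close> for \<open>f\<close> is what makes each undo the other in the same factor: a
    step changes one of the two compared lengths by exactly 1, just across the threshold of the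
    opposite operator.\<close>
  proof (cases "if s then len C False i b \<ge> len D True i c else len C False i b > len D True i c")
    case True
    then obtain b' where b': "arrow C s i b = Some b'" "y = (b', c)"
      using xy x unfolding x tensor_simps if_P[OF True] by auto
    then show ?thesis
      using True len_Some[OF C b b'(1)] crystal_arrow_elts[OF C b b'(1)] c x
        crystal_arrow_reverse[OF C b b'(1)]
      by (cases s) (auto simp: tensor_simps)
  next
    case False
    then obtain c' where c': "arrow D s i c = Some c'" "y = (b, c')"
      using xy x unfolding x tensor_simps if_not_P[OF False] by auto
    then show ?thesis
      using False len_Some[OF D c c'(1)] crystal_arrow_elts[OF D c c'(1)] b x
        crystal_arrow_reverse[OF D c c'(1)]
      by (cases s) (auto simp: tensor_simps)
  qed
next
  fix x y i
  assume "x \<in> elts (tensor_crystal C D)" "arrow (tensor_crystal C D) True i x = Some y"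
  then show "wt (tensor_crystal C D) y = wt (tensor_crystal C D) x + root_weight A i"
    using crystal_arrow_wt[OF C, of _ True] crystal_arrow_wt[OF D, of _ True]
    by (auto simp: tensor_simps algebra_simps split: if_splits)
next
  fix x i assume "x \<in> elts (tensor_crystal C D)"
  then obtain b c where "x = (b, c)" "b \<in> elts C" "c \<in> elts D" by (auto simp: tensor_simps)
  then show "wt (tensor_crystal C D) x i =
      int (len (tensor_crystal C D) False i x) - int (len (tensor_crystal C D) True i x)"
    by (simp add: tensor_simps tensor_len[OF C D] crystal_wt[OF C] crystal_wt[OF D])
qed

end


section \<open>Strict morphisms\<close>

lemma crys_homI:
  assumes "\<And>b c. \<psi> b = Some c \<Longrightarrow> b \<in> elts C \<and> c \<in> elts D \<and> wt D c = wt C b"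
    and "\<And>b s i. b \<in> elts C \<Longrightarrow> Option.bind (arrow C s i b) \<psi> = Option.bind (\<psi> b) (arrow D s i)"
  shows "\<psi> \<in> crys_hom C D"
proof -
  have "Option.bind (eop C i b) \<psi> = Option.bind (\<psi> b) (eop D i)"
       "Option.bind (fop C i b) \<psi> = Option.bind (\<psi> b) (fop D i)" if "b \<in> elts C" for b i
    using assms(2)[OF that, of True i] assms(2)[OF that, of False i] by (simp_all add: arrow_def)
  moreover have "dom \<psi> \<subseteq> elts C" "ran \<psi> \<subseteq> elts D" "\<forall>b c. \<psi> b = Some c \<longrightarrow> wt D c = wt C b"
    using assms(1) by (auto simp: ran_def)
  ultimately show ?thesis unfolding crys_hom_def by blast
qed

lemma crys_homD:
  assumes "\<psi> \<in> crys_hom C D"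
  shows "\<psi> b = Some c \<Longrightarrow> b \<in> elts C" "\<psi> b = Some c \<Longrightarrow> c \<in> elts D"
    and "\<psi> b = Some c \<Longrightarrow> wt D c = wt C b"
    and "b \<in> elts C \<Longrightarrow> Option.bind (arrow C s i b) \<psi> = Option.bind (\<psi> b) (arrow D s i)"
  using assms by (auto simp: crys_hom_def ran_def arrow_def)

lemma hom_arrow_lift:
  assumes "\<psi> \<in> crys_hom C D" "\<psi> b = Some c" "arrow D s i c = Some c'"
  shows "\<exists>b'. arrow C s i b = Some b' \<and> \<psi> b' = Some c'"
  using crys_homD(4)[OF assms(1) crys_homD(1)[OF assms(1,2)], of s i] assms
  by (cases "arrow C s i b") auto

text \<open>Strictness at \<open>b\<close> alone would allow \<open>b'\<close> to be killed.
  Strictness at \<open>b'\<close> along the reversed arrow excludes this, since it would then kill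
  \<open>b\<close> too.\<close>

lemma hom_arrow:
  assumes C: "is_crystal A C" and \<psi>: "\<psi> \<in> crys_hom C D" and b: "\<psi> b = Some c"
    and b': "arrow C s i b = Some b'"
  shows "\<exists>c'. arrow D s i c = Some c' \<and> \<psi> b' = Some c'"
proof -
  have bC: "b \<in> elts C" using crys_homD(1)[OF \<psi> b] .
  have "b' \<in> elts C" using crystal_arrow_elts[OF C bC b'] .
  then have "Option.bind (\<psi> b') (arrow D (\<not> s) i) = Some c"
    using crys_homD(4)[OF \<psi>, of b' "\<not> s" i] crystal_arrow_reverse[OF C bC b'] b by simp
  then obtain c' where "\<psi> b' = Some c'" by (cases "\<psi> b'") auto
  then show ?thesis using crys_homD(4)[OF \<psi> bC, of s i] b b' by (intro exI[of _ c']) simp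
qed

text \<open>Arrows at a surviving element are carried over by \<open>hom_arrow\<close> and come back
  by \<open>hom_arrow_lift\<close>, so the strings through it and through its image have the same
  length.\<close>

lemma (in cartan_diagonal) hom_len:
  assumes C: "is_crystal A C" and \<psi>: "\<psi> \<in> crys_hom C D" and b: "\<psi> b = Some c"
  shows "len D s i c = len C s i b"
proof -
  have "string_length (arrow D s i) c (len C s i b)"
    using b
  proof (induction "len C s i b" arbitrary: b c)
    case 0
    then have "arrow C s i b = None"
      using len_eq_0_iff[OF C crys_homD(1)[OF \<psi>]] by metis
    then have "arrow D s i c = None"
      using hom_arrow_lift[OF \<psi> 0(2), of s i] by (cases "arrow D s i c") auto
    then show ?case using 0 string_length_None by metis
  next
    case (Suc n)
    have bC: "b \<in> elts C" using crys_homD(1)[OF \<psi> Suc.prems] .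
    obtain b' where b': "arrow C s i b = Some b'"
      using len_eq_0_iff[OF C bC] Suc(2) by (metis nat.distinct(1) not_None_eq)
    obtain c' where c': "arrow D s i c = Some c'" "\<psi> b' = Some c'"
      using hom_arrow[OF C \<psi> Suc.prems b'] by blast
    show ?case
      using len_Some(1)[OF C bC b'] Suc(1)[OF _ c'(2)] Suc(2) c'(1) string_length_Suc by fastforce
  qed
  then show ?thesis by (rule string_length_len)
qed

text \<open>An isomorphism from a union of components of \<open>C\<close> onto a union of components
  of \<open>D\<close>, extended by zero. Atoms, crossings, projectors and flips are all of this
  kind.\<close>

definition crys_emb :: "('i, 'b) crystal \<Rightarrow> ('i, 'c) crystal \<Rightarrow> ('b \<Rightarrow> 'c option) \<Rightarrow> bool" where
  "crys_emb C D \<psi> \<longleftrightarrow> \<psi> \<in> crys_hom C D \<and> inj_on \<psi> (dom \<psi>)"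

lemma crys_emb_hom: "crys_emb C D \<psi> \<Longrightarrow> \<psi> \<in> crys_hom C D"
  by (simp add: crys_emb_def)

lemma crys_emb_inj: "crys_emb C D \<psi> \<Longrightarrow> \<psi> b = Some d \<Longrightarrow> \<psi> b' = Some d \<Longrightarrow> b = b'"
  by (simp add: crys_emb_def inj_on_def dom_def)

lemma crys_embI:
  "\<psi> \<in> crys_hom C D \<Longrightarrow> (\<And>b b' d. \<psi> b = Some d \<Longrightarrow> \<psi> b' = Some d \<Longrightarrow> b = b') \<Longrightarrow> crys_emb C D \<psi>"
  unfolding crys_emb_def inj_on_def dom_def by auto

lemma crys_hom_comp:
  assumes \<psi>: "\<psi> \<in> crys_hom C D" and \<chi>: "\<chi> \<in> crys_hom D E"
  shows "\<chi> \<circ>\<^sub>m \<psi> \<in> crys_hom C E"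
proof (rule crys_homI)
  fix b e assume "(\<chi> \<circ>\<^sub>m \<psi>) b = Some e"
  then obtain d where "\<psi> b = Some d" "\<chi> d = Some e"
    by (auto simp: map_comp_Some_iff)
  then show "b \<in> elts C \<and> e \<in> elts E \<and> wt E e = wt C b"
    using crys_homD[OF \<psi>] crys_homD[OF \<chi>] by metis
next
  fix b s i assume b: "b \<in> elts C"
  have "Option.bind (arrow C s i b) (\<chi> \<circ>\<^sub>m \<psi>) = Option.bind (Option.bind (arrow C s i b) \<psi>) \<chi>"
    by (cases "arrow C s i b") (auto simp: map_comp_def split: option.split)
  also have "\<dots> = Option.bind (Option.bind (\<psi> b) (arrow D s i)) \<chi>"
    using crys_homD(4)[OF \<psi> b] by simp
  also have "\<dots> = Option.bind ((\<chi> \<circ>\<^sub>m \<psi>) b) (arrow E s i)"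
    using crys_homD(2)[OF \<psi>] crys_homD(4)[OF \<chi>] by (cases "\<psi> b") (auto simp: map_comp_def)
  finally show "Option.bind (arrow C s i b) (\<chi> \<circ>\<^sub>m \<psi>) = Option.bind ((\<chi> \<circ>\<^sub>m \<psi>) b) (arrow E s i)" .
qed

lemma crys_emb_comp:
  assumes "crys_emb C D \<psi>" and "crys_emb D E \<chi>"
  shows "crys_emb C E (\<chi> \<circ>\<^sub>m \<psi>)"
  using crys_hom_comp[OF crys_emb_hom crys_emb_hom, OF assms] crys_emb_inj[OF assms(1)]
    crys_emb_inj[OF assms(2)]
  by (intro crys_embI) (assumption, unfold map_comp_Some_iff, metis)

lemma flip_map_eq_Some_iff:
  assumes "inj_on \<psi> (dom \<psi>)"
  shows "flip_map \<psi> d = Some b \<longleftrightarrow> \<psi> b = Some d"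
proof -
  have "(THE x. \<psi> x = Some d) = b" if "\<psi> b = Some d" for b
    using that assms by (intro the_equality) (auto simp: inj_on_def dom_def)
  then show ?thesis by (auto simp: flip_map_def ran_def)
qed

lemma crys_emb_flip:
  assumes C: "is_crystal A C" and D: "is_crystal A D" and \<psi>: "crys_emb C D \<psi>"
  shows "crys_emb D C (flip_map \<psi>)"
proof -
  have flip: "flip_map \<psi> d = Some b \<longleftrightarrow> \<psi> b = Some d" for b d
    using flip_map_eq_Some_iff \<psi> by (metis crys_emb_def)
  note h = crys_emb_hom[OF \<psi>]
  show ?thesis
  proof (intro crys_embI crys_homI)
    fix d s i assume d: "d \<in> elts D"
    show "Option.bind (arrow D s i d) (flip_map \<psi>) = Option.bind (flip_map \<psi> d) (arrow C s i)"
    proof (cases "flip_map \<psi> d")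
      case None
      have "flip_map \<psi> d' = None" if d': "arrow D s i d = Some d'" for d'
      \<comment> \<open>The image is closed under arrows: if \<open>d'\<close> were in it, lifting
        the reversed arrow would put \<open>d\<close> into it as well.\<close>
      proof (rule ccontr)
        assume "flip_map \<psi> d' \<noteq> None"
        then obtain b' where "\<psi> b' = Some d'" using flip by auto
        then obtain b where "\<psi> b = Some d"
          using hom_arrow_lift[OF h] crystal_arrow_reverse[OF D d d'] by blast
        then show False using flip None by (metis option.distinct(1))
      qed
      then show ?thesis using None by (cases "arrow D s i d") auto
    next
      case (Some b)
      then have b: "\<psi> b = Some d" using flip by simp
      show ?thesis
      proof (cases "arrow D s i d")
        case None
        then show ?thesis using hom_arrow[OF C h b, of s i] Some by (cases "arrow C s i b") auto
      next
        case (Some d')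
        obtain b' where "arrow C s i b = Some b'" "flip_map \<psi> d' = Some b'"
          using hom_arrow_lift[OF h b Some] flip by blast
        then show ?thesis using Some \<open>flip_map \<psi> d = Some b\<close> by simp
      qed
    qed
  qed (use flip crys_homD[OF h] in auto)
qed

lemma highest_arrow: "highest_weight_elt C b \<longleftrightarrow> b \<in> elts C \<and> (\<forall>i. arrow C True i b = None)"
  by (simp add: highest_weight_elt_def arrow_def)

lemma hom_highest:
  assumes \<psi>: "\<psi> \<in> crys_hom C D" and b: "\<psi> b = Some c" and "highest_weight_elt C b"
  shows "highest_weight_elt D c"
  unfolding highest_arrow
proof (intro conjI allI)
  show "c \<in> elts D" using crys_homD(2)[OF \<psi> b] .
  fix i show "arrow D True i c = None"
    using hom_arrow_lift[OF \<psi> b, of True i] assms(3)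
    by (cases "arrow D True i c") (auto simp: highest_arrow)
qed


section \<open>Connected components\<close>

lemma component_self: "b \<in> component C b"
  by (simp add: component_def)

lemma component_subset:
  assumes "is_crystal A C" "b \<in> elts C"
  shows "component C b \<subseteq> elts C"
proof
  fix x assume "x \<in> component C b"
  then have "(b, x) \<in> (crystal_edges C)\<^sup>*" by (simp add: component_def)
  then show "x \<in> elts C"
    by (induction) (use assms crystal_arrow_elts in \<open>auto simp: crystal_edges_arrow\<close>)
qed

lemma component_sym:
  assumes "is_crystal A C" "c \<in> component C b"
  shows "b \<in> component C c"
proof -
  have "sym (crystal_edges C)"
    by (rule symI)
      (metis assms(1) crystal_arrow_elts crystal_arrow_reverse crystal_edges_arrow)
  then show ?thesis
    using assms(2) sym_rtrancl symD by (fastforce simp: component_def)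
qed

lemma component_trans: "c \<in> component C b \<Longrightarrow> d \<in> component C c \<Longrightarrow> d \<in> component C b"
  by (simp add: component_def)

lemma component_arrow: "c \<in> component C b \<Longrightarrow> c \<in> elts C \<Longrightarrow> arrow C s i c = Some d \<Longrightarrow> d \<in> component C b"
  unfolding component_def using crystal_edges_arrow by (fastforce intro: rtrancl_into_rtrancl)

lemma hom_component:
  assumes C: "is_crystal A C" and \<psi>: "\<psi> \<in> crys_hom C D" and b: "\<psi> b = Some c"
    and z: "z \<in> component C b"
  shows "\<exists>d \<in> component D c. \<psi> z = Some d"
proof -
  have "(b, z) \<in> (crystal_edges C)\<^sup>*" using z by (simp add: component_def)
  then show ?thesis
  proof induction
    case base
    show ?case by (rule bexI, rule b, rule component_self)
  next
    case (step y z)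
    then obtain d s i where d: "d \<in> component D c" "\<psi> y = Some d" "arrow C s i y = Some z"
      by (auto simp: crystal_edges_arrow)
    then obtain d' where "arrow D s i d = Some d'" "\<psi> z = Some d'"
      using hom_arrow[OF C \<psi>] by blast
    then show ?case using d component_arrow crys_homD(2)[OF \<psi>] by metis
  qed
qed

lemma hom_component_lift:
  assumes \<psi>: "\<psi> \<in> crys_hom C D" and b: "\<psi> b = Some c" and d: "d \<in> component D c"
  shows "\<exists>z \<in> component C b. \<psi> z = Some d"
proof -
  have "(c, d) \<in> (crystal_edges D)\<^sup>*" using d by (simp add: component_def)
  then show ?thesis
  proof induction
    case base
    show ?case by (rule bexI, rule b, rule component_self)
  next
    case (step y d)
    then obtain z s i where z: "z \<in> component C b" "\<psi> z = Some y" "arrow D s i y = Some d"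
      by (auto simp: crystal_edges_arrow)
    then obtain z' where "arrow C s i z = Some z'" "\<psi> z' = Some d"
      using hom_arrow_lift[OF \<psi>] by blast
    then show ?case using z component_arrow crys_homD(1)[OF \<psi>] by metis
  qed
qed

text \<open>Strictness computes the value at the end of an edge from the value at its start, and
  this also propagates the value \<open>None\<close>.\<close>

lemma hom_unique_on_component:
  assumes "\<psi> \<in> crys_hom C D" "\<chi> \<in> crys_hom C D" "\<psi> b = \<chi> b" "z \<in> component C b"
  shows "\<psi> z = \<chi> z"
proof -
  have "(b, z) \<in> (crystal_edges C)\<^sup>*" using assms(4) by (simp add: component_def)
  then show ?thesis
  proof induction
    case (step y z)
    then obtain s i where y: "y \<in> elts C" "arrow C s i y = Some z" by (auto simp: crystal_edges_arrow)
    then show ?case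
      using crys_homD(4)[OF assms(1) y(1), of s i] crys_homD(4)[OF assms(2) y(1), of s i] step.IH
      by simp
  qed (rule assms)
qed

text \<open>A component is closed under arrows in both directions, so cutting down to it is strict.
  The Jones-Wenzl projector is the case of the top component.\<close>

lemma crys_emb_restrict_component:
  assumes C: "is_crystal A C" and b: "b \<in> elts C"
  shows "crys_emb C C (\<lambda>x. if x \<in> component C b then Some x else None)"
proof (intro crys_embI crys_homI)
  fix x s i assume x: "x \<in> elts C"
  have "y \<in> component C b \<longleftrightarrow> x \<in> component C b" if "arrow C s i x = Some y" for y
    using that component_arrow x crystal_arrow_reverse[OF C x that] crystal_arrow_elts[OF C x that]
    by metis
  then show "Option.bind (arrow C s i x) (\<lambda>x. if x \<in> component C b then Some x else None) =
    Option.bind (if x \<in> component C b then Some x else None) (arrow C s i)"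
    by (cases "arrow C s i x") auto
qed (use component_subset[OF assms] in \<open>auto split: if_splits\<close>)


section \<open>Tensor words\<close>

definition pair_map :: "('a \<Rightarrow> 'b option) \<Rightarrow> ('c \<Rightarrow> 'd option) \<Rightarrow> 'a \<times> 'c \<Rightarrow> ('b \<times> 'd) option" where
  "pair_map \<psi> \<chi> = (\<lambda>(a, c). case (\<psi> a, \<chi> c) of (Some b, Some d) \<Rightarrow> Some (b, d) | _ \<Rightarrow> None)"

lemma pair_map_eq_Some_iff: "pair_map \<psi> \<chi> (a, c) = Some (b, d) \<longleftrightarrow> \<psi> a = Some b \<and> \<chi> c = Some d"
  by (auto simp: pair_map_def split: option.splits)

text \<open>The tensor rule looks only at \<open>phi\<close> of the first and \<open>eps\<close> of
  the second factor. Both survive by \<open>hom_len\<close>, so the operators choose the same factor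
  before and after the map.\<close>

lemma (in cartan_diagonal) crys_emb_pair_map:
  assumes C: "is_crystal A C" and D: "is_crystal A D"
    and \<psi>: "crys_emb C C' \<psi>" and \<chi>: "crys_emb D D' \<chi>"
  shows "crys_emb (tensor_crystal C D) (tensor_crystal C' D') (pair_map \<psi> \<chi>)"
proof (intro crys_embI crys_homI)
  note h = crys_emb_hom[OF \<psi>] and k = crys_emb_hom[OF \<chi>]
  {
    fix x y assume "pair_map \<psi> \<chi> x = Some y"
    then show "x \<in> elts (tensor_crystal C D) \<and> y \<in> elts (tensor_crystal C' D') \<and>
      wt (tensor_crystal C' D') y = wt (tensor_crystal C D) x"
      using crys_homD(1-3)[OF h] crys_homD(1-3)[OF k]
      by (cases x; cases y) (auto simp: pair_map_eq_Some_iff tensor_simps)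
  next
    fix x x' y assume "pair_map \<psi> \<chi> x = Some y" "pair_map \<psi> \<chi> x' = Some y"
    then show "x = x'"
      using crys_emb_inj[OF \<psi>] crys_emb_inj[OF \<chi>]
      by (cases x; cases x'; cases y) (auto simp: pair_map_eq_Some_iff)
  next
    fix x s i assume "x \<in> elts (tensor_crystal C D)"
    then obtain b c where x: "x = (b, c)" and b: "b \<in> elts C" and c: "c \<in> elts D"
      by (auto simp: tensor_simps)
    note hb = crys_homD(4)[OF h b, of s i] and kc = crys_homD(4)[OF k c, of s i]
    show "Option.bind (arrow (tensor_crystal C D) s i x) (pair_map \<psi> \<chi>) =
      Option.bind (pair_map \<psi> \<chi> x) (arrow (tensor_crystal C' D') s i)"
    \<comment> \<open>A killed factor stays killed whether the arrow acts on it or on the other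
      factor.\<close>
    proof (cases "\<psi> b = None \<or> \<chi> c = None")
      case True
      then have "pair_map \<psi> \<chi> x = None" by (auto simp: pair_map_def x split: option.splits)
      moreover have "pair_map \<psi> \<chi> y = None" if "arrow (tensor_crystal C D) s i x = Some y" for y
        using that True hb kc
        by (auto simp: x tensor_simps pair_map_def split: if_splits option.splits)
      ultimately show ?thesis by (cases "arrow (tensor_crystal C D) s i x") auto
    next
      case False
      then obtain b' c' where b': "\<psi> b = Some b'" and c': "\<chi> c = Some c'" by auto
      note l = hom_len[OF C h b'] hom_len[OF D k c']
      show ?thesis
        using hb kc unfolding x tensor_simps pair_map_def b' c' l
        by (cases "arrow C s i b"; cases "arrow D s i c"; cases "arrow C' s i b'"; cases "arrow D' s i c'")
          (auto simp: tensor_simps b' c' l)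
    qed
  }
qed

section \<open>From pairs to lists\<close>

lemma cons_simps:
  "elts (cons_crystal T) = (\<lambda>(b, x). b # x) ` elts T"
  "wt (cons_crystal T) (b # x) = wt T (b, x)"
  "arrow (cons_crystal T) s i (b # x) = map_option (\<lambda>(b, x). b # x) (arrow T s i (b, x))"
  by (simp_all add: cons_crystal_def arrow_def)

lemma iterate_op_conjugate:
  assumes "\<And>x. g' (h x) = map_option h (g x)"
  shows "iterate_op g' m (h x) = map_option h (iterate_op g m x)"
proof (induction m arbitrary: x)
  case (Suc m)
  then show ?case by (cases "g x") (simp_all add: iterate_op_Suc assms)
qed simp

lemma len_cons: "len (cons_crystal T) s i (b # x) = len T s i (b, x)"
proof -
  have "iterate_op (arrow (cons_crystal T) s i) m ((\<lambda>(b, x). b # x) y) =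
      map_option (\<lambda>(b, x). b # x) (iterate_op (arrow T s i) m y)" for m y
    by (rule iterate_op_conjugate) (auto simp: cons_simps)
  from this[of _ "(b, x)"] show ?thesis by (simp add: len_Max)
qed

lemma is_crystal_cons:
  assumes T: "is_crystal A T"
  shows "is_crystal A (cons_crystal T)"
proof (rule is_crystalI)
  show "finite (elts (cons_crystal T))" using is_crystalD(1)[OF T] by (simp add: cons_simps)
next
  fix x y s i assume "x \<in> elts (cons_crystal T)" and xy: "arrow (cons_crystal T) s i x = Some y"
  then obtain b x' where x: "x = b # x'" "(b, x') \<in> elts T" by (auto simp: cons_simps)
  then obtain c y' where y: "arrow T s i (b, x') = Some (c, y')" "y = c # y'"
    using xy by (auto simp: cons_simps)
  show "y \<in> elts (cons_crystal T) \<and> arrow (cons_crystal T) (\<not> s) i y = Some x"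
    using crystal_arrow_elts[OF T x(2) y(1)] crystal_arrow_reverse[OF T x(2) y(1)]
    by (force simp: cons_simps x y)
next
  fix x y i assume "x \<in> elts (cons_crystal T)" and xy: "arrow (cons_crystal T) True i x = Some y"
  then obtain b x' where x: "x = b # x'" "(b, x') \<in> elts T" by (auto simp: cons_simps)
  then obtain c y' where y: "arrow T True i (b, x') = Some (c, y')" "y = c # y'"
    using xy by (auto simp: cons_simps)
  show "wt (cons_crystal T) y = wt (cons_crystal T) x + root_weight A i"
    using crystal_arrow_wt[OF T x(2) y(1)] by (simp add: cons_simps x y)
next
  fix x i assume "x \<in> elts (cons_crystal T)"
  then obtain b x' where x: "x = b # x'" "(b, x') \<in> elts T" by (auto simp: cons_simps)
  then show "wt (cons_crystal T) x i =
      int (len (cons_crystal T) False i x) - int (len (cons_crystal T) True i x)"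
    using crystal_wt[OF T x(2)] by (simp add: cons_simps len_cons)
qed

lemma crys_emb_total:
  assumes C: "is_crystal A C" and "inj_on h (elts C)"
    and "\<And>x. x \<in> elts C \<Longrightarrow> h x \<in> elts D \<and> wt D (h x) = wt C x"
    and "\<And>x s i. x \<in> elts C \<Longrightarrow> arrow D s i (h x) = map_option h (arrow C s i x)"
  shows "crys_emb C D (\<lambda>x. if x \<in> elts C then Some (h x) else None)"
proof (intro crys_embI crys_homI)
  fix x s i assume "x \<in> elts C"
  then show "Option.bind (arrow C s i x) (\<lambda>x. if x \<in> elts C then Some (h x) else None) =
      Option.bind (if x \<in> elts C then Some (h x) else None) (arrow D s i)"
    using assms(4) crystal_arrow_elts[OF C] by (cases "arrow C s i x") auto
qed (use assms(2,3) in \<open>auto split: if_splits dest: inj_onD\<close>)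

lemma crys_emb_cons:
  "is_crystal A T \<Longrightarrow>
    crys_emb T (cons_crystal T) (\<lambda>x. if x \<in> elts T then Some ((\<lambda>(b, x). b # x) x) else None)"
  by (rule crys_emb_total) (auto simp: cons_simps inj_on_def)

lemma unit_simps:
  "elts unit_crystal = {[]}" "wt unit_crystal x = 0" "arrow unit_crystal s i x = None"
  "len unit_crystal s i x = 0"
proof -
  show "arrow unit_crystal s i x = None" by (simp add: unit_crystal_def arrow_def)
  then show "len unit_crystal s i x = 0" by (intro string_length_len string_length_None)
qed (simp_all add: unit_crystal_def)

lemma is_crystal_unit: "is_crystal A unit_crystal"
  by (rule is_crystalI) (simp_all add: unit_simps)

lemma elts_word_Cons:
  "elts (word_crystal B (i # w)) = {b # x |b x. b \<in> elts (B i) \<and> x \<in> elts (word_crystal B w)}"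
  by (auto simp: cons_simps tensor_simps)

lemma length_word_elt: "x \<in> elts (word_crystal B w) \<Longrightarrow> length x = length w"
  by (induction w arbitrary: x) (auto simp: elts_word_Cons unit_simps simp del: word_crystal.simps(2))

lemma elts_word_append:
  "elts (word_crystal B (u @ v)) = {x @ y |x y. x \<in> elts (word_crystal B u) \<and> y \<in> elts (word_crystal B v)}"
proof (induction u)
  case (Cons i u)
  show ?case unfolding append_Cons elts_word_Cons Cons
    by (auto, metis append_Cons, metis append_Cons append_assoc)
qed (simp add: unit_simps)

lemma elts_word_appendD:
  assumes "x \<in> elts (word_crystal B (u @ v))"
  shows "take (length u) x \<in> elts (word_crystal B u)" "drop (length u) x \<in> elts (word_crystal B v)"
  using assms length_word_elt by (fastforce simp: elts_word_append)+

locale crystal_letters = cartan_diagonal A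
  for A :: "'i \<Rightarrow> 'i \<Rightarrow> int" +
  fixes B :: "'i \<Rightarrow> ('i, 'b) crystal"
  assumes letter_crystal: "is_crystal A (B i)"
begin

abbreviation "W \<equiv> word_crystal B"

lemma is_crystal_word: "is_crystal A (W w)"
  by (induction w) (simp_all add: is_crystal_unit is_crystal_cons is_crystal_tensor letter_crystal)

abbreviation "append_pair \<equiv> \<lambda>(x, y). x @ y"

text \<open>The arrow formula is a premise so that the induction for \<open>word_append\<close> can
  feed in its own hypothesis and read off the string lengths of a concatenation through
  \<open>hom_len\<close>.\<close>

lemma crys_emb_append_if_arrow:
  assumes "\<And>x y s i. x \<in> elts (W u) \<Longrightarrow> y \<in> elts (W v) \<Longrightarrow>
    wt (W (u @ v)) (x @ y) = wt (W u) x + wt (W v) y \<and>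
    arrow (W (u @ v)) s i (x @ y) = map_option append_pair (arrow (tensor_crystal (W u) (W v)) s i (x, y))"
  shows "crys_emb (tensor_crystal (W u) (W v)) (W (u @ v))
     (\<lambda>x. if x \<in> elts (tensor_crystal (W u) (W v)) then Some (append_pair x) else None)"
proof (rule crys_emb_total)
  show "is_crystal A (tensor_crystal (W u) (W v))"
    by (intro is_crystal_tensor is_crystal_word)
  show "inj_on append_pair (elts (tensor_crystal (W u) (W v)))"
    by (auto simp: inj_on_def tensor_simps dest!: length_word_elt)
qed (use assms in \<open>auto simp: tensor_simps(1,2) elts_word_append\<close>)

text \<open>Associativity of the tensor product in list form: a word nested to the right may be cut
  anywhere. By \<open>tensor_len\<close> the comparisons made by the two bracketings select the same
  letter.\<close>

lemma word_append:
  assumes "x \<in> elts (W u)" and "y \<in> elts (W v)"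
  shows "wt (W (u @ v)) (x @ y) = wt (W u) x + wt (W v) y \<and>
    arrow (W (u @ v)) s i (x @ y) = map_option append_pair (arrow (tensor_crystal (W u) (W v)) s i (x, y))"
  using assms
proof (induction u arbitrary: x y s i)
  case Nil
  then show ?case
    \<comment> \<open>For \<open>e\<close> the rule selects the empty word when \<open>eps\<close>
      of \<open>y\<close> is 0, and then \<open>e\<close> kills \<open>y\<close> as well, so both
      sides are \<open>None\<close>.\<close>
    using len_eq_0_iff[OF is_crystal_word, of y v True i]
    by (auto simp: tensor_simps unit_simps option.map_comp comp_def option.map_ident)
next
  case (Cons k u)
  then obtain b x' where x: "x = b # x'" and b: "b \<in> elts (B k)" and x': "x' \<in> elts (W u)"
    by (auto simp: elts_word_Cons simp del: word_crystal.simps)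
  have l: "len (W (u @ v)) s i (x' @ y) = len (tensor_crystal (W u) (W v)) s i (x', y)" for s i
    by (rule hom_len[OF _ crys_emb_hom[OF crys_emb_append_if_arrow[OF Cons.IH]]])
      (use x' Cons.prems in \<open>auto intro!: is_crystal_tensor is_crystal_word simp: tensor_simps\<close>)
  note t = tensor_len[OF is_crystal_word is_crystal_word x' Cons.prems(2)]
    tensor_len[OF letter_crystal is_crystal_word b x']
  have "wt (W ((k # u) @ v)) (x @ y) = wt (W (k # u)) x + wt (W v) y"
    using Cons.IH[OF x' Cons.prems(2)]
    unfolding x append_Cons word_crystal.simps cons_simps tensor_simps by (simp only: add.assoc)
  moreover have "arrow (W ((k # u) @ v)) s i (x @ y) =
      map_option append_pair (arrow (tensor_crystal (W (k # u)) (W v)) s i (x, y))"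
    using Cons.IH[OF x' Cons.prems(2), of s i]
    by (cases s)
      (auto simp: x cons_simps tensor_simps l t len_cons option.map_comp comp_def)
  ultimately show ?case ..
qed

lemma crys_emb_append:
  "crys_emb (tensor_crystal (W u) (W v)) (W (u @ v))
     (\<lambda>x. if x \<in> elts (tensor_crystal (W u) (W v)) then Some (append_pair x) else None)"
  by (rule crys_emb_append_if_arrow) (rule word_append)

text \<open>The map on lists is \<open>pair_map\<close> conjugated by concatenation: the flip of
  concatenation cuts a list after \<open>length u\<close> letters.\<close>

lemma crys_emb_tensor_map:
  assumes \<psi>: "crys_emb (W u) (W u') \<psi>" and \<chi>: "crys_emb (W v) (W v') \<chi>"
  shows "crys_emb (W (u @ v)) (W (u' @ v')) (tensor_map (length u) \<psi> \<chi>)"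
proof -
  define a where "a u v = (\<lambda>x. if x \<in> elts (tensor_crystal (W u) (W v)) then Some (append_pair x) else None)"
    for u v
  have a: "crys_emb (tensor_crystal (W u) (W v)) (W (u @ v)) (a u v)" for u v
    unfolding a_def by (rule crys_emb_append)
  have T: "is_crystal A (tensor_crystal (W u) (W v))" for u v
    by (intro is_crystal_tensor is_crystal_word)
  note h = crys_homD[OF crys_emb_hom[OF \<psi>]] and k = crys_homD[OF crys_emb_hom[OF \<chi>]]
  have flip: "flip_map (a u v) z = Some (x, y) \<longleftrightarrow>
      x \<in> elts (W u) \<and> y \<in> elts (W v) \<and> x @ y = z" for x y z
    using flip_map_eq_Some_iff[of "a u v" z "(x, y)"] a[of u v]
    by (auto simp: crys_emb_def a_def tensor_simps)
  have "tensor_map (length u) \<psi> \<chi> = a u' v' \<circ>\<^sub>m pair_map \<psi> \<chi> \<circ>\<^sub>m flip_map (a u v)"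
  proof
    fix z
    have "tensor_map (length u) \<psi> \<chi> z = Some z' \<longleftrightarrow>
        (a u' v' \<circ>\<^sub>m pair_map \<psi> \<chi> \<circ>\<^sub>m flip_map (a u v)) z = Some z'" for z'
    proof
      assume "tensor_map (length u) \<psi> \<chi> z = Some z'"
      then obtain x' y' where xy: "\<psi> (take (length u) z) = Some x'" "\<chi> (drop (length u) z) = Some y'" "z' = x' @ y'"
        by (auto simp: tensor_map_def split: option.splits)
      then have "flip_map (a u v) z = Some (take (length u) z, drop (length u) z)"
        using flip h(1) k(1) by simp
      moreover have "a u' v' (x', y') = Some z'"
        using h(2) k(2) xy by (simp add: a_def tensor_simps)
      ultimately show "(a u' v' \<circ>\<^sub>m pair_map \<psi> \<chi> \<circ>\<^sub>m flip_map (a u v)) z = Some z'"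
        using xy by (simp add: map_comp_Some_iff pair_map_eq_Some_iff del: not_None_eq)
    next
      assume "(a u' v' \<circ>\<^sub>m pair_map \<psi> \<chi> \<circ>\<^sub>m flip_map (a u v)) z = Some z'"
      then obtain x y x' y' where "flip_map (a u v) z = Some (x, y)"
        "pair_map \<psi> \<chi> (x, y) = Some (x', y')" "a u' v' (x', y') = Some z'"
        by (auto simp: map_comp_Some_iff)
      moreover from this have "z = x @ y" "length x = length u"
        using flip length_word_elt by auto
      ultimately show "tensor_map (length u) \<psi> \<chi> z = Some z'"
        by (auto simp: pair_map_eq_Some_iff a_def tensor_map_def split: if_splits)
    qed
    then show "tensor_map (length u) \<psi> \<chi> z = (a u' v' \<circ>\<^sub>m pair_map \<psi> \<chi> \<circ>\<^sub>m flip_map (a u v)) z"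
      by (metis not_Some_eq)
  qed
  moreover have "crys_emb (W (u @ v)) (W (u' @ v')) (a u' v' \<circ>\<^sub>m pair_map \<psi> \<chi> \<circ>\<^sub>m flip_map (a u v))"
    by (rule crys_emb_comp[OF crys_emb_flip[OF T is_crystal_word a]
          crys_emb_comp[OF crys_emb_pair_map[OF is_crystal_word is_crystal_word \<psi> \<chi>] a]])
  ultimately show ?thesis by simp
qed

lemma tensor_map_append:
  "x \<in> elts (W u) \<Longrightarrow> tensor_map (length u) \<psi> \<chi> (x @ y) =
     (case (\<psi> x, \<chi> y) of (Some x, Some y) \<Rightarrow> Some (x @ y) | _ \<Rightarrow> None)"
  using length_word_elt[of x B u] by (simp add: tensor_map_def split: option.splits)

lemma crys_emb_id_map: "crys_emb (W w) (W w) (id_map B w)"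
  unfolding id_map_def using crys_emb_total[OF is_crystal_word, of "\<lambda>x. x" w "W w"]
  by (simp add: option.map_ident)

end


section \<open>The crystal of a simple module\<close>

definition lowering :: "('i, 'b) crystal \<Rightarrow> ('b \<times> 'b) set" where
  "lowering C = {(b, b'). b \<in> elts C \<and> (\<exists>i. fop C i b = Some b')}"

definition generated_by :: "('i, 'b) crystal \<Rightarrow> 'b \<Rightarrow> bool" where
  "generated_by C b \<longleftrightarrow> highest_weight_elt C b \<and> (\<forall>x \<in> elts C. (b, x) \<in> (lowering C)\<^sup>*)"

lemma is_lattice_module_hull: "is_lattice_module (is_lattice_module hull S)"
  by (rule hull_in) (auto simp: is_lattice_module_def)

text \<open>Lattices are only required to be closed under sums and regular scalars; this scalar
  supplies negatives.\<close>

lemma neg_one_regular: "- 1 \<in> regular_at_0"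
proof -
  have "- 1 = Fract (- 1 :: rat poly) 1" by (simp add: One_fract_def)
  then show ?thesis unfolding regular_at_0_def by (intro CollectI exI[of _ "-1"] exI[of _ 1]) simp
qed

text \<open>The elements are classes of monomials in the \<open>ft i\<close> applied to
  \<open>u\<close>. As \<open>ft i\<close> preserves \<open>qL\<close>, a monomial outside
  \<open>qL\<close> has all its intermediate monomials outside \<open>qL\<close>, so its path from
  \<open>u\<close> never passes through zero.\<close>

lemma kashiwara_crystal_generated:
  assumes u: "u \<in> qspace N" and ft: "\<And>i. qlinear N (ft i)" and et: "\<And>i. et i u = 0"
    and ne: "elts (kashiwara_crystal d N K et ft u) \<noteq> {}"
  shows "generated_by (kashiwara_crystal d N K et ft u) {w. w - u \<in> q_lattice ft u}"
proof -
  define M where "M = kashiwara_monomials ft u"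
  define L where "L = crystal_lattice ft u"
  define Q where "Q = q_lattice ft u"
  define coset where "coset v = {w. w - v \<in> Q}" for v
  note ft' = ft[unfolded qlinear_def, rule_format]
  have scale_add: "qscale a (v + w) = qscale a v + qscale a w" for a v w
    by (simp add: qscale_def fun_eq_iff algebra_simps)
  have scale_scale: "qscale a (qscale b v) = qscale (a * b) v" for a b v
    by (simp add: qscale_def fun_eq_iff algebra_simps)
  have qspace: "0 \<in> qspace N" "\<And>v w. v \<in> qspace N \<Longrightarrow> w \<in> qspace N \<Longrightarrow> v + w \<in> qspace N"
      "\<And>a v. v \<in> qspace N \<Longrightarrow> qscale a v \<in> qspace N"
    by (auto simp: qspace_def qscale_def)
  have L: "is_lattice_module L"
    unfolding L_def crystal_lattice_def by (rule is_lattice_module_hull)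
  have M_sub_L: "M \<subseteq> L"
    unfolding L_def M_def crystal_lattice_def by (rule hull_subset)
  have M_qspace: "v \<in> qspace N" if "v \<in> M" for v
    using that unfolding M_def by induction (use u ft' in auto)
  have "ft i 0 = 0" for i
    using ft'[of 0 i] qspace(1) by (metis add_cancel_right_right)
  \<comment> \<open>This set is a lattice module containing all monomials, so minimality of the hull
    shows that \<open>ft i\<close> preserves \<open>L\<close>.\<close>
  then have "is_lattice_module {v \<in> qspace N. \<forall>i. ft i v \<in> L}"
    using L ft' qspace unfolding is_lattice_module_def by simp
  moreover have "M \<subseteq> {v \<in> qspace N. \<forall>i. ft i v \<in> L}"
    using M_qspace M_sub_L kashiwara_monomials.step unfolding M_def by fastforce
  ultimately have "L \<subseteq> {v \<in> qspace N. \<forall>i. ft i v \<in> L}"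
    unfolding L_def crystal_lattice_def M_def by (intro hull_minimal)
  then have L_qspace: "v \<in> qspace N" and ft_L: "ft i v \<in> L" if "v \<in> L" for v i
    using that by auto
  have Q_iff: "v \<in> Q \<longleftrightarrow> (\<exists>x \<in> L. v = qscale qvar x)" for v
    by (auto simp: Q_def q_lattice_def L_def)
  have Q0: "0 \<in> Q"
    unfolding Q_iff using L by (intro bexI[of _ 0]) (auto simp: is_lattice_module_def qscale_def)
  have Q_add: "v + w \<in> Q" if "v \<in> Q" "w \<in> Q" for v w
    using that L unfolding Q_iff is_lattice_module_def by (metis scale_add)
  have Q_neg: "- v \<in> Q" if v: "v \<in> Q" for v
  proof -
    obtain x where x: "x \<in> L" "v = qscale qvar x" using v Q_iff by blast
    have "qscale (- 1) x \<in> L" using L neg_one_regular x(1) by (simp add: is_lattice_module_def)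
    moreover have "- v = qscale qvar (qscale (- 1) x)"
      by (simp add: x qscale_def fun_eq_iff)
    ultimately show ?thesis using Q_iff by blast
  qed
  have Q_diff: "v - w \<in> Q" if "v \<in> Q" "w \<in> Q" for v w
    using Q_add[OF that(1) Q_neg[OF that(2)]] by simp
  have Q_qspace: "v \<in> qspace N" if "v \<in> Q" for v
    using that L_qspace qspace(3) unfolding Q_iff by blast
  have ft_Q: "ft i v \<in> Q" if "v \<in> Q" for v i
    using that ft_L ft' L_qspace unfolding Q_iff by blast
  have K: "elts (kashiwara_crystal d N K et ft u) = {coset v |v. v \<in> M \<and> v \<notin> Q}"
      "fop (kashiwara_crystal d N K et ft u) i = coset_op Q (ft i)"
      "eop (kashiwara_crystal d N K et ft u) i = coset_op Q (et i)" for i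
    by (simp_all add: kashiwara_crystal_def coset_def Q_def M_def)
  \<comment> \<open>\<open>coset_op\<close> ranges over all representatives; additivity of
    \<open>ft i\<close> and \<open>ft_Q\<close> make the outcome a single coset.\<close>
  have ft_coset: "coset_op Q (ft i) (coset v) = (if ft i v \<in> Q then None else Some (coset (ft i v)))"
    if v: "v \<in> qspace N" for i v
  proof -
    have "{w. \<exists>v'\<in>coset v. w - ft i v' \<in> Q} = coset (ft i v)"
    proof (intro set_eqI iffI)
      fix w assume "w \<in> {w. \<exists>v'\<in>coset v. w - ft i v' \<in> Q}"
      then obtain v' where v': "v' - v \<in> Q" "w - ft i v' \<in> Q" by (auto simp: coset_def)
      have "ft i (v + (v' - v)) = ft i v + ft i (v' - v)"
        using ft' v Q_qspace[OF v'(1)] by blast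
      then have "w - ft i v = (w - ft i v') + ft i (v' - v)" by simp
      then show "w \<in> coset (ft i v)" unfolding coset_def mem_Collect_eq using Q_add[OF v'(2) ft_Q[OF v'(1)]] by metis
    next
      fix w assume "w \<in> coset (ft i v)"
      then show "w \<in> {w. \<exists>v'\<in>coset v. w - ft i v' \<in> Q}"
        using Q0 by (auto simp: coset_def intro!: exI[of _ v])
    qed
    moreover have "0 \<in> coset (ft i v) \<longleftrightarrow> ft i v \<in> Q"
      unfolding coset_def using Q_neg[of "ft i v"] Q_neg[of "- ft i v"] by auto
    ultimately show ?thesis by (simp add: coset_op_def Let_def)
  qed
  have reach: "v \<notin> Q \<longrightarrow> (coset u, coset v) \<in> (lowering (kashiwara_crystal d N K et ft u))\<^sup>*" if "v \<in> M" for v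
    using that unfolding M_def
  proof induction
    case (step v i)
    show ?case
    proof
      assume fv: "ft i v \<notin> Q"
      then have "v \<notin> Q" using ft_Q by blast
      moreover have "v \<in> M" using step M_def by simp
      ultimately have "(coset v, coset (ft i v)) \<in> lowering (kashiwara_crystal d N K et ft u)"
        unfolding lowering_def K using ft_coset[OF M_qspace[of v]] fv by auto
      then show "(coset u, coset (ft i v)) \<in> (lowering (kashiwara_crystal d N K et ft u))\<^sup>*"
        using step.IH \<open>v \<notin> Q\<close> by (meson rtrancl_into_rtrancl)
    qed
  qed simp
  \<comment> \<open>Otherwise every monomial would lie in \<open>qL\<close> and the crystal would be
    empty.\<close>
  have "u \<notin> Q"
  proof
    assume uQ: "u \<in> Q"
    have "v \<in> Q" if "v \<in> M" for v
      using that unfolding M_def by induction (use uQ ft_Q in auto)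
    then show False using ne K by auto
  qed
  then have "coset u \<in> elts (kashiwara_crystal d N K et ft u)"
    unfolding K M_def using kashiwara_monomials.start by auto
  \<comment> \<open>One representative sent into \<open>Q\<close> suffices for \<open>None\<close>,
    and \<open>u\<close> itself is one.\<close>
  moreover have "coset_op Q (et i) (coset u) = None" for i
    using Q0 et by (auto simp: coset_op_def coset_def Let_def intro!: exI[of _ u])
  ultimately have "generated_by (kashiwara_crystal d N K et ft u) (coset u)"
    unfolding generated_by_def highest_weight_elt_def using reach K by auto
  then show ?thesis by (simp add: coset_def Q_def)
qed

lemma lowering_arrow: "(b, b') \<in> lowering C \<longleftrightarrow> b \<in> elts C \<and> (\<exists>i. arrow C False i b = Some b')"
  by (simp add: lowering_def arrow_def)

text \<open>An element other than \<open>b\<close> is the end of an \<open>f\<close>-arrow, and the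
  reversed arrow shows that it is not highest.\<close>

lemma generated_by_unique:
  assumes C: "is_crystal A C" and g: "generated_by C b" and h: "highest_weight_elt C c"
  shows "c = b"
proof -
  have "(b, c) \<in> (lowering C)\<^sup>*" using g h by (simp add: generated_by_def highest_weight_elt_def)
  then show ?thesis
  proof (cases rule: rtranclE)
    case (step a)
    then obtain i where "a \<in> elts C" "arrow C False i a = Some c" by (auto simp: lowering_arrow)
    then have "arrow C True i c = Some a" using crystal_arrow_reverse[OF C, of a False] by auto
    then show ?thesis using h by (simp add: highest_arrow)
  qed simp
qed

text \<open>The crystal axioms are assumed for \<open>C\<close> only, so the lowering paths of
  \<open>D\<close> are lifted to \<open>C\<close>.\<close>

lemma generated_by_iso:
  assumes C: "is_crystal A C" and iso: "crys_iso C D \<psi>" and g: "generated_by D d"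
  shows "\<exists>c. generated_by C c"
proof -
  have \<psi>: "crys_emb C D \<psi>" "dom \<psi> = elts C" "ran \<psi> = elts D"
    using iso by (auto simp: crys_iso_def crys_emb_def)
  note h = crys_emb_hom[OF \<psi>(1)]
  have "d \<in> elts D" using g by (simp add: generated_by_def highest_weight_elt_def)
  then obtain c where c: "\<psi> c = Some d" using \<psi>(3) by (auto simp: ran_def)
  have "\<exists>z. (c, z) \<in> (lowering C)\<^sup>* \<and> \<psi> z = Some y" if "(d, y) \<in> (lowering D)\<^sup>*" for y
    using that
  proof induction
    case (step y y')
    then obtain z i where z: "(c, z) \<in> (lowering C)\<^sup>*" "\<psi> z = Some y" "arrow D False i y = Some y'"
      by (auto simp: lowering_arrow)
    then obtain z' where "arrow C False i z = Some z'" "\<psi> z' = Some y'"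
      using hom_arrow_lift[OF h] by blast
    then show ?case using z crys_homD(1)[OF h]
      by (meson lowering_arrow rtrancl_into_rtrancl)
  qed (use c in blast)
  moreover have "\<exists>y. \<psi> x = Some y \<and> (d, y) \<in> (lowering D)\<^sup>*" if "x \<in> elts C" for x
    using that \<psi>(2) crys_homD(2)[OF h] g by (fastforce simp: generated_by_def)
  ultimately have reach: "(c, x) \<in> (lowering C)\<^sup>*" if "x \<in> elts C" for x
    using that crys_emb_inj[OF \<psi>(1)] by metis
  have "arrow C True i c = None" for i
  proof (rule ccontr)
    assume "arrow C True i c \<noteq> None"
    then obtain c' where "arrow C True i c = Some c'" by auto
    then show False using hom_arrow[OF C h c, of True i] g by (auto simp: generated_by_def highest_arrow)
  qed
  then show ?thesis using reach crys_homD(1)[OF h c] by (auto simp: generated_by_def highest_arrow)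
qed

lemma crystal_of_simple_module_generated:
  assumes B: "crystal_of_simple_module A lam C" and lam: "dominant lam"
  shows "\<exists>b. generated_by C b \<and> wt C b = lam"
proof -
  obtain d N E F K K' u et ft b where
    u: "highest_weight_vector d N E K lam u" and ops: "kashiwara_ops d N E F K et ft"
    and iso: "isomorphic_crystals C (kashiwara_crystal d N K et ft u)"
    and b: "highest_weight_elt C b" "wt C b = lam" and C: "is_crystal A C"
    using B unfolding crystal_of_simple_module_def by blast
  have u': "u \<in> qweight_space d N K lam" "\<And>i. E i u = 0"
    using u by (auto simp: highest_weight_vector_def)
  have "et i u = 0" for i
  proof -
    \<comment> \<open>The vector \<open>u\<close> is its own divided power with exponent 0, which is
      within the range \<open>n \<le> lam i\<close> by dominance; the defining equation of
      \<open>et i\<close> then gives 0.\<close>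
    have "divided_power d F i 0 u = u"
      by (simp add: divided_power_def qfact_def qscale_def)
    moreover have "et i (divided_power d F i n u) = (if n = 0 then 0 else divided_power d F i (n - 1) u)"
      if "int n \<le> lam i" for n
      using ops u' that unfolding kashiwara_ops_def by blast
    ultimately show ?thesis using lam[unfolded dominant_def, rule_format, of i] by (metis of_nat_0)
  qed
  moreover obtain \<psi> where \<psi>: "crys_iso C (kashiwara_crystal d N K et ft u) \<psi>"
    using iso isomorphic_crystals_def by blast
  moreover from this have "elts (kashiwara_crystal d N K et ft u) \<noteq> {}"
    using b(1) by (auto simp: crys_iso_def highest_weight_elt_def ran_def)
  moreover have "u \<in> qspace N" using u' by (simp add: qweight_space_def)
  moreover have "qlinear N (ft i)" for i using ops by (simp add: kashiwara_ops_def)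
  ultimately have "generated_by (kashiwara_crystal d N K et ft u) {w. w - u \<in> q_lattice ft u}"
    by (intro kashiwara_crystal_generated)
  then obtain c where "generated_by C c"
    using generated_by_iso[OF C \<psi>] by blast
  then show ?thesis using generated_by_unique[OF C] b by metis
qed

locale crystal_family = cartan_diagonal A
  for A :: "'i::finite \<Rightarrow> 'i \<Rightarrow> int" +
  fixes BB :: "'i weight \<Rightarrow> ('i, 'b) crystal"
  assumes simple_crystals: "dominant lam \<Longrightarrow> crystal_of_simple_module A lam (BB lam)"
    and monoidal: "dominant lam \<Longrightarrow> dominant \<mu> \<Longrightarrow> gcrys_object A BB (tensor_crystal (BB lam) (BB \<mu>))"
begin

lemma BB_crystal: "dominant lam \<Longrightarrow> is_crystal A (BB lam)"
  using simple_crystals by (simp add: crystal_of_simple_module_def)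

lemma BB_component:
  assumes "dominant lam" and "b \<in> elts (BB lam)"
  shows "component (BB lam) b = elts (BB lam)"
proof -
  have "components (BB lam) = {elts (BB lam)}"
    using simple_crystals[OF assms(1)] by (simp add: crystal_of_simple_module_def connected_crystal_def)
  then show ?thesis using assms(2) by (auto simp: components_def)
qed

definition top_elt :: "'i weight \<Rightarrow> 'b" where
  "top_elt lam = (SOME b. generated_by (BB lam) b \<and> wt (BB lam) b = lam)"

lemma top_elt:
  assumes "dominant lam"
  shows "generated_by (BB lam) (top_elt lam)" "wt (BB lam) (top_elt lam) = lam"
    and "highest_weight_elt (BB lam) (top_elt lam)" "top_elt lam \<in> elts (BB lam)"
    and "highest_weight_elt (BB lam) b \<Longrightarrow> b = top_elt lam"
proof -
  have "generated_by (BB lam) (top_elt lam) \<and> wt (BB lam) (top_elt lam) = lam"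
    unfolding top_elt_def
    by (rule someI_ex, rule crystal_of_simple_module_generated[OF simple_crystals[OF assms] assms])
  then show g: "generated_by (BB lam) (top_elt lam)" "wt (BB lam) (top_elt lam) = lam" by auto
  then show "highest_weight_elt (BB lam) (top_elt lam)" "top_elt lam \<in> elts (BB lam)"
    by (auto simp: generated_by_def highest_weight_elt_def)
  show "highest_weight_elt (BB lam) b \<Longrightarrow> b = top_elt lam"
    using generated_by_unique[OF BB_crystal[OF assms] g(1)] .
qed


section \<open>Crystals with components of the form \<open>B(\<lambda>)\<close>\<close>

text \<open>The same content as splitting into components B(lambda), but phrased with partial maps
  on all of \<open>C\<close>; in this form it pulls back along embeddings without changing the
  carrier.\<close>

definition decomposable :: "('i, 'c) crystal \<Rightarrow> bool" where
  "decomposable C \<longleftrightarrow> is_crystal A C \<and>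
     (\<forall>x \<in> elts C. \<exists>lam \<psi>. dominant lam \<and> crys_emb C (BB lam) \<psi> \<and> x \<in> dom \<psi>)"

lemma decomposable_crystal: "decomposable C \<Longrightarrow> is_crystal A C"
  by (simp add: decomposable_def)

text \<open>The isomorphism on the component of \<open>x\<close> is extended by zero. It stays
  strict because no arrow enters or leaves a component.\<close>

lemma gcrys_object_decomposable:
  assumes C: "gcrys_object A BB C"
  shows "decomposable C"
  unfolding decomposable_def
proof (intro conjI ballI)
  show cC: "is_crystal A C" using C by (simp add: gcrys_object_def)
  fix x assume x: "x \<in> elts C"
  let ?X = "component C x"
  obtain lam \<psi> where lam: "dominant lam" and \<psi>: "crys_iso (C\<lparr>elts := ?X\<rparr>) (BB lam) \<psi>"
    using C x unfolding gcrys_object_def components_def isomorphic_crystals_def by blast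
  have hom: "\<psi> \<in> crys_hom (C\<lparr>elts := ?X\<rparr>) (BB lam)" and dom: "dom \<psi> = ?X" and inj: "inj_on \<psi> (dom \<psi>)"
    using \<psi> by (auto simp: crys_iso_def)
  have arrow: "arrow (C\<lparr>elts := ?X\<rparr>) s i b = arrow C s i b" for s i b by (simp add: arrow_def)
  have "\<psi> \<in> crys_hom C (BB lam)"
  proof (rule crys_homI)
    fix b s i assume b: "b \<in> elts C"
    show "Option.bind (arrow C s i b) \<psi> = Option.bind (\<psi> b) (arrow (BB lam) s i)"
    proof (cases "b \<in> ?X")
      case True
      then show ?thesis using crys_homD(4)[OF hom, of b s i] by (simp add: arrow)
    next
      case False
      have "b' \<notin> ?X" if b': "arrow C s i b = Some b'" for b'
        using False component_arrow crystal_arrow_reverse[OF cC b b'] crystal_arrow_elts[OF cC b b']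
        by metis
      then have "\<psi> b' = None" if "arrow C s i b = Some b'" for b' using dom that by blast
      moreover have "\<psi> b = None" using False dom by blast
      ultimately show ?thesis by (cases "arrow C s i b") auto
    qed
  next
    fix b c assume "\<psi> b = Some c"
    then show "b \<in> elts C \<and> c \<in> elts (BB lam) \<and> wt (BB lam) c = wt C b"
      using crys_homD(1-3)[OF hom] component_subset[OF cC x] by auto
  qed
  then have "crys_emb C (BB lam) \<psi>" using inj by (simp add: crys_emb_def)
  then show "\<exists>lam \<psi>. dominant lam \<and> crys_emb C (BB lam) \<psi> \<and> x \<in> dom \<psi>"
    using lam dom component_self[of x C] by (intro exI[of _ lam] exI[of _ \<psi>]) simp
qed

lemma decomposable_at:
  assumes D: "decomposable D" and \<psi>: "crys_emb C D \<psi>" and x: "\<psi> x = Some y"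
  shows "\<exists>lam \<chi>. dominant lam \<and> crys_emb C (BB lam) \<chi> \<and> x \<in> dom \<chi>"
proof -
  have "y \<in> elts D" using crys_homD(2)[OF crys_emb_hom[OF \<psi>] x] .
  then obtain lam \<chi> where "dominant lam" "crys_emb D (BB lam) \<chi>" "y \<in> dom \<chi>"
    using D unfolding decomposable_def by blast
  then show ?thesis using crys_emb_comp[OF \<psi>] x
    by (intro exI[of _ lam] exI[of _ "\<chi> \<circ>\<^sub>m \<psi>"]) (auto simp: map_comp_def)
qed

text \<open>Locally the second factor may be replaced by some B(mu), and a product of two B's is
  decomposable by \<open>monoidal\<close>.\<close>

lemma decomposable_tensor:
  assumes lam: "dominant lam" and D: "decomposable D"
  shows "decomposable (tensor_crystal (BB lam) D)"
  unfolding decomposable_def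
proof (intro conjI ballI)
  note cD = decomposable_crystal[OF D]
  show "is_crystal A (tensor_crystal (BB lam) D)" using BB_crystal[OF lam] cD by (rule is_crystal_tensor)
  fix x assume "x \<in> elts (tensor_crystal (BB lam) D)"
  then obtain b c where x: "x = (b, c)" "b \<in> elts (BB lam)" "c \<in> elts D"
    by (auto simp: tensor_simps)
  then obtain \<mu> \<psi> c' where \<mu>: "dominant \<mu>" "crys_emb D (BB \<mu>) \<psi>" "\<psi> c = Some c'"
    using D by (auto simp: decomposable_def)
  let ?id = "\<lambda>x. if x \<in> elts (BB lam) then Some x else None"
  have "crys_emb (BB lam) (BB lam) ?id"
    using crys_emb_total[OF BB_crystal[OF lam], of "\<lambda>x. x"] by (simp add: option.map_ident)
  then have "crys_emb (tensor_crystal (BB lam) D) (tensor_crystal (BB lam) (BB \<mu>)) (pair_map ?id \<psi>)"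
    using crys_emb_pair_map[OF BB_crystal[OF lam] cD _ \<mu>(2)] by blast
  moreover have "pair_map ?id \<psi> x = Some (b, c')"
    using x \<mu>(3) by (simp add: pair_map_eq_Some_iff)
  ultimately show "\<exists>lam' \<psi>. dominant lam' \<and> crys_emb (tensor_crystal (BB lam) D) (BB lam') \<psi> \<and> x \<in> dom \<psi>"
    by (rule decomposable_at[OF gcrys_object_decomposable[OF monoidal[OF lam \<mu>(1)]]])
qed

lemma decomposable_cons:
  assumes T: "decomposable T"
  shows "decomposable (cons_crystal T)"
  unfolding decomposable_def
proof (intro conjI ballI)
  note cT = decomposable_crystal[OF T]
  show cc: "is_crystal A (cons_crystal T)" using is_crystal_cons[OF cT] .
  fix x assume x: "x \<in> elts (cons_crystal T)"
  then obtain b y where y: "x = b # y" "(b, y) \<in> elts T" by (auto simp: cons_simps)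
  note e = crys_emb_cons[OF cT]
  have "flip_map (\<lambda>x. if x \<in> elts T then Some ((\<lambda>(b, x). b # x) x) else None) x = Some (b, y)"
    using e y by (subst flip_map_eq_Some_iff) (auto simp: crys_emb_def)
  then show "\<exists>lam \<psi>. dominant lam \<and> crys_emb (cons_crystal T) (BB lam) \<psi> \<and> x \<in> dom \<psi>"
    by (rule decomposable_at[OF T crys_emb_flip[OF cT cc e]])
qed

lemma decomposable_unit: "decomposable unit_crystal"
  unfolding decomposable_def
proof (intro conjI ballI)
  show "is_crystal A unit_crystal" by (rule is_crystal_unit)
  fix x :: "'c list" assume x: "x \<in> elts unit_crystal"
  have d: "dominant (0 :: 'i weight)" by (simp add: dominant_def)
  note t = top_elt[OF d]
  \<comment> \<open>Weight 0 means \<open>phi = eps\<close>, and \<open>eps\<close> vanishes at a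
    highest element. So no arrow leaves the top of B(0), and sending the empty word there commutes
    with all operators.\<close>
  have "arrow (BB 0) False i (top_elt 0) = None" for i
  proof -
    have "len (BB 0) True i (top_elt 0) = 0"
      using t(3) by (intro len_None) (simp add: highest_arrow)
    then have "len (BB 0) False i (top_elt 0) = 0"
      using crystal_wt[OF BB_crystal[OF d] t(4), of i] t(2) by simp
    then show ?thesis using len_eq_0_iff[OF BB_crystal[OF d] t(4)] by simp
  qed
  moreover have "arrow (BB 0) True i (top_elt 0) = None" for i using t(3) by (simp add: highest_arrow)
  ultimately have a: "arrow (BB 0) s i (top_elt 0) = None" for s i by (cases s) auto
  have "crys_emb unit_crystal (BB 0)
      (\<lambda>x :: 'c list. if x \<in> elts (unit_crystal :: ('i, 'c list) crystal) then Some (top_elt 0) else None)"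
    by (rule crys_emb_total[OF is_crystal_unit, where h = "\<lambda>_. top_elt 0"])
      (use t(2,4) a in \<open>auto simp: unit_simps\<close>)
  then show "\<exists>lam \<psi>. dominant lam \<and> crys_emb unit_crystal (BB lam) \<psi> \<and> x \<in> dom \<psi>"
    using d x by (intro exI conjI) (auto simp: unit_simps)
qed

text \<open>In the connected crystal B(lambda) the image of \<open>x\<close> is joined to the top
  element; lifting that path back leads to \<open>h\<close>.\<close>

lemma decomposable_emb_top:
  assumes C: "decomposable C" and x: "x \<in> elts C"
  shows "\<exists>lam \<psi> h. dominant lam \<and> crys_emb C (BB lam) \<psi> \<and> \<psi> h = Some (top_elt lam) \<and>
           highest_weight_elt C h \<and> x \<in> component C h"
proof -
  note cC = decomposable_crystal[OF C]
  obtain lam \<psi> b where lam: "dominant lam" and \<psi>: "crys_emb C (BB lam) \<psi>" "\<psi> x = Some b"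
    using C x by (auto simp: decomposable_def)
  note hom = crys_emb_hom[OF \<psi>(1)]
  have "top_elt lam \<in> component (BB lam) b"
    using BB_component[OF lam crys_homD(2)[OF hom \<psi>(2)]] top_elt(4)[OF lam] by simp
  then obtain h where h: "h \<in> component C x" "\<psi> h = Some (top_elt lam)"
    using hom_component_lift[OF hom \<psi>(2)] by blast
  have "arrow C True i h = None" for i
    using hom_arrow[OF cC hom h(2), of True i] top_elt(3)[OF lam]
    by (cases "arrow C True i h") (auto simp: highest_arrow)
  then have "highest_weight_elt C h" using crys_homD(1)[OF hom h(2)] by (simp add: highest_arrow)
  then show ?thesis using lam \<psi>(1) h component_sym[OF cC] by blast
qed

text \<open>An embedding into B(lambda) is defined on the whole component, sends both elements to
  the only highest element there, and is injective.\<close>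

lemma decomposable_highest_unique:
  assumes C: "decomposable C" and h: "highest_weight_elt C h" and h': "highest_weight_elt C h'"
    and "h' \<in> component C h"
  shows "h' = h"
proof -
  note cC = decomposable_crystal[OF C]
  have "h \<in> elts C" using h by (simp add: highest_arrow)
  then obtain lam \<psi> b where lam: "dominant lam" and \<psi>: "crys_emb C (BB lam) \<psi>" "\<psi> h = Some b"
    using C by (auto simp: decomposable_def)
  note hom = crys_emb_hom[OF \<psi>(1)]
  obtain b' where b': "\<psi> h' = Some b'" using hom_component[OF cC hom \<psi>(2) assms(4)] by blast
  have "b = b'"
    using top_elt(5)[OF lam hom_highest[OF hom \<psi>(2) h]] top_elt(5)[OF lam hom_highest[OF hom b' h']]
    by simp
  then show ?thesis using crys_emb_inj[OF \<psi>(1)] \<psi>(2) b' by metis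
qed

lemma decomposable_highest_emb:
  assumes C: "decomposable C" and x: "highest_weight_elt C x"
  shows "\<exists>\<psi>. dominant (wt C x) \<and> crys_emb C (BB (wt C x)) \<psi> \<and> \<psi> x = Some (top_elt (wt C x))"
proof -
  have "x \<in> elts C" using x by (simp add: highest_arrow)
  then obtain lam \<psi> h where l: "dominant lam" "crys_emb C (BB lam) \<psi>" "\<psi> h = Some (top_elt lam)"
      "highest_weight_elt C h" "x \<in> component C h"
    using decomposable_emb_top[OF C] by blast
  have "x = h" using decomposable_highest_unique[OF C l(4) x l(5)] .
  moreover have "wt C h = lam"
    using crys_homD(3)[OF crys_emb_hom[OF l(2)] l(3)] top_elt(2)[OF l(1)] by simp
  ultimately show ?thesis using l(1-3) by auto
qed

text \<open>B(lambda) is connected, so an embedding that does not kill \<open>x\<close> already hits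
  everything from the component of \<open>x\<close>; injectivity leaves nothing for other
  components.\<close>

lemma emb_top_dom:
  assumes cC: "is_crystal A C" and lam: "dominant lam" and \<psi>: "crys_emb C (BB lam) \<psi>" and x: "\<psi> x = Some b"
  shows "dom \<psi> = component C x" and "ran \<psi> = elts (BB lam)"
proof -
  note hom = crys_emb_hom[OF \<psi>]
  have comp: "component (BB lam) b = elts (BB lam)" using BB_component[OF lam crys_homD(2)[OF hom x]] .
  show "dom \<psi> = component C x"
  proof
    show "component C x \<subseteq> dom \<psi>" using hom_component[OF cC hom x] by blast
    show "dom \<psi> \<subseteq> component C x"
    proof
      fix z assume "z \<in> dom \<psi>"
      then obtain d where d: "\<psi> z = Some d" by blast
      then obtain z' where "z' \<in> component C x" "\<psi> z' = Some d"
        using hom_component_lift[OF hom x] comp crys_homD(2)[OF hom d] by blast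
      then show "z \<in> component C x" using crys_emb_inj[OF \<psi> d] by metis
    qed
  qed
  show "ran \<psi> = elts (BB lam)"
    using hom_component_lift[OF hom x] crys_homD(2)[OF hom] unfolding comp ran_def by blast
qed


section \<open>Basic morphisms\<close>

text \<open>For highest weight elements \<open>x\<close> and \<open>y\<close> this is the matrix
  unit of the pair.\<close>

definition basic_map :: "('i, 'c) crystal \<Rightarrow> ('i, 'd) crystal \<Rightarrow> 'c \<Rightarrow> 'd \<Rightarrow> ('c \<Rightarrow> 'd option) \<Rightarrow> bool" where
  "basic_map C D x y \<psi> \<longleftrightarrow> \<psi> \<in> crys_hom C D \<and> dom \<psi> \<subseteq> component C x \<and> \<psi> x = Some y"

lemma basic_map_unique:
  assumes "basic_map C D x y \<psi>" and "basic_map C D x y \<chi>"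
  shows "\<psi> = \<chi>"
proof
  fix z
  show "\<psi> z = \<chi> z"
  proof (cases "z \<in> component C x")
    case True
    then show ?thesis using assms hom_unique_on_component unfolding basic_map_def by metis
  next
    case False
    then have "\<psi> z = None" "\<chi> z = None" using assms by (auto simp: basic_map_def)
    then show ?thesis by simp
  qed
qed

text \<open>By the equality of weights both components are isomorphic to the same B(lambda); one
  isomorphism is followed by the flip of the other.\<close>

lemma basic_map_exists:
  assumes C: "decomposable C" and D: "decomposable D"
    and x: "highest_weight_elt C x" and y: "highest_weight_elt D y" and wt: "wt C x = wt D y"
  shows "\<exists>\<psi>. basic_map C D x y \<psi> \<and> inj_on \<psi> (dom \<psi>) \<and> dom \<psi> = component C x \<and> ran \<psi> = component D y"
proof -
  note cC = decomposable_crystal[OF C] and cD = decomposable_crystal[OF D]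
  obtain \<psi> where \<psi>: "dominant (wt C x)" "crys_emb C (BB (wt C x)) \<psi>" "\<psi> x = Some (top_elt (wt C x))"
    using decomposable_highest_emb[OF C x] by blast
  obtain \<chi> where \<chi>: "crys_emb D (BB (wt C x)) \<chi>" "\<chi> y = Some (top_elt (wt C x))"
    using decomposable_highest_emb[OF D y] unfolding wt by blast
  have flip: "flip_map \<chi> d = Some b \<longleftrightarrow> \<chi> b = Some d" for b d
    using flip_map_eq_Some_iff \<chi>(1) by (metis crys_emb_def)
  note dp = emb_top_dom[OF cC \<psi>(1-3)] and dc = emb_top_dom[OF cD \<psi>(1) \<chi>]
  have e: "crys_emb C D (flip_map \<chi> \<circ>\<^sub>m \<psi>)"
    using crys_emb_comp[OF \<psi>(2) crys_emb_flip[OF cD BB_crystal[OF \<psi>(1)] \<chi>(1)]] .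
  have "dom (flip_map \<chi> \<circ>\<^sub>m \<psi>) = component C x"
  proof -
    have "(\<exists>d. (flip_map \<chi> \<circ>\<^sub>m \<psi>) z = Some d) \<longleftrightarrow> (\<exists>b. \<psi> z = Some b)" for z
    proof
      assume "\<exists>b. \<psi> z = Some b"
      then obtain b where b: "\<psi> z = Some b" by blast
      then have "b \<in> ran \<chi>" using crys_homD(2)[OF crys_emb_hom[OF \<psi>(2)]] dc(2) by blast
      then obtain d where "\<chi> d = Some b" by (auto simp: ran_def)
      then show "\<exists>d. (flip_map \<chi> \<circ>\<^sub>m \<psi>) z = Some d" using b flip by (auto simp: map_comp_Some_iff)
    qed (auto simp: map_comp_Some_iff)
    then show ?thesis unfolding dp(1)[symmetric] dom_def by simp
  qed
  moreover have "ran (flip_map \<chi> \<circ>\<^sub>m \<psi>) = component D y"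
  proof -
    have "(\<exists>z. (flip_map \<chi> \<circ>\<^sub>m \<psi>) z = Some d) \<longleftrightarrow> (\<exists>b. \<chi> d = Some b)" for d
    proof
      assume "\<exists>b. \<chi> d = Some b"
      then obtain b where b: "\<chi> d = Some b" by blast
      then have "b \<in> ran \<psi>" using crys_homD(2)[OF crys_emb_hom[OF \<chi>(1)]] dp(2) by blast
      then obtain z where "\<psi> z = Some b" by (auto simp: ran_def)
      then show "\<exists>z. (flip_map \<chi> \<circ>\<^sub>m \<psi>) z = Some d" using b flip by (auto simp: map_comp_Some_iff)
    qed (auto simp: map_comp_Some_iff flip)
    then show ?thesis unfolding dc(1)[symmetric] dom_def ran_def by simp
  qed
  moreover have "(flip_map \<chi> \<circ>\<^sub>m \<psi>) x = Some y" using \<psi>(3) \<chi>(2) flip by (simp add: map_comp_Some_iff)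
  ultimately show ?thesis using e unfolding basic_map_def crys_emb_def by blast
qed

end


section \<open>Linear independence of the simple roots\<close>

text \<open>With \<open>g = (\<epsilon>\<^sub>i + 1) \<phi>\<^sub>i\<close>, the operator \<open>f\<^sub>i\<close> carries \<open>g\<close> to \<open>\<epsilon>\<^sub>i (\<phi>\<^sub>i + 1)\<close>, so both functions
  have the same sum.\<close>

lemma (in cartan_diagonal) sum_wt:
  assumes C: "is_crystal A C"
  shows "(\<Sum>b\<in>elts C. wt C b i) = 0"
proof -
  note fin = is_crystalD(1)[OF C]
  define e where "e b = int (len C True i b)" for b
  define f where "f b = int (len C False i b)" for b
  have "(\<Sum>b\<in>elts C. (e b + 1) * f b) = (\<Sum>b\<in>{b \<in> elts C. arrow C False i b \<noteq> None}. (e b + 1) * f b)"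
    using fin len_None[of C False i] by (intro sum.mono_neutral_right) (auto simp: f_def)
  also have "\<dots> = (\<Sum>b\<in>{b \<in> elts C. arrow C True i b \<noteq> None}. e b * (f b + 1))"
  proof (rule sum.reindex_bij_witness[where i = "\<lambda>b. the (arrow C True i b)" and j = "\<lambda>b. the (arrow C False i b)"])
    fix b assume "b \<in> {b \<in> elts C. arrow C False i b \<noteq> None}"
    then obtain b' where b: "b \<in> elts C" "arrow C False i b = Some b'" by auto
    note b' = crystal_arrow_elts[OF C b] crystal_arrow_reverse[OF C b] len_Some[OF C b]
    show "the (arrow C True i (the (arrow C False i b))) = b"
      and "the (arrow C False i b) \<in> {b \<in> elts C. arrow C True i b \<noteq> None}"
      and "e (the (arrow C False i b)) * (f (the (arrow C False i b)) + 1) = (e b + 1) * f b"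
      using b b' by (simp_all add: e_def f_def algebra_simps)
  next
    fix b assume "b \<in> {b \<in> elts C. arrow C True i b \<noteq> None}"
    then obtain b' where b: "b \<in> elts C" "arrow C True i b = Some b'" by auto
    note b' = crystal_arrow_elts[OF C b] crystal_arrow_reverse[OF C b]
    show "the (arrow C False i (the (arrow C True i b))) = b"
      and "the (arrow C True i b) \<in> {b \<in> elts C. arrow C False i b \<noteq> None}"
      using b b' by simp_all
  qed
  also have "\<dots> = (\<Sum>b\<in>elts C. e b * (f b + 1))"
    using fin len_None[of C True i] by (intro sum.mono_neutral_left) (auto simp: e_def)
  finally have "(\<Sum>b\<in>elts C. f b - e b) = 0"
    by (simp add: algebra_simps sum.distrib sum_subtractf)
  then show ?thesis using crystal_wt[OF C] by (simp add: e_def f_def)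
qed

context crystal_family begin

lemma dominant_fund_weight: "dominant (fund_weight i)"
  by (simp add: dominant_def fund_weight_def)

lemma BB_induct [consumes 2, case_names top lower]:
  assumes lam: "dominant lam" and "b \<in> elts (BB lam)" and "P (top_elt lam)"
    and "\<And>b b' i. b \<in> elts (BB lam) \<Longrightarrow> P b \<Longrightarrow> wt (BB lam) b' = wt (BB lam) b - root_weight A i \<Longrightarrow> P b'"
  shows "P b"
proof -
  have "(top_elt lam, b) \<in> (lowering (BB lam))\<^sup>*"
    using top_elt(1)[OF lam] assms(2) by (simp add: generated_by_def)
  then show ?thesis
  proof induction
    case (step y z)
    then obtain i where y: "y \<in> elts (BB lam)" "arrow (BB lam) False i y = Some z"
      by (auto simp: lowering_arrow)
    then show ?case using assms(4)[OF y(1) step.IH] crystal_arrow_wt[OF BB_crystal[OF lam] y] by simp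
  qed (rule assms)
qed

lemma rows_independent:
  fixes c :: "'i \<Rightarrow> int"
  assumes c: "\<And>j. (\<Sum>i\<in>UNIV. c i * A i j) = 0"
  shows "c i = 0"
proof -
  let ?C = "BB (fund_weight i)"
  note d = dominant_fund_weight[of i]
  have "(\<Sum>k\<in>UNIV. c k * wt ?C b k) = c i" if "b \<in> elts ?C" for b
    using d that
  proof (induction rule: BB_induct)
    case top
    then show ?case unfolding top_elt(2)[OF d] by (simp add: fund_weight_def if_distrib cong: if_cong)
  next
    case (lower b b' j)
    then have "wt ?C b' k = wt ?C b k - A k j" for k by (simp add: root_weight_def)
    then show ?case using lower.IH c[of j] by (simp add: right_diff_distrib sum_subtractf)
  qed
  then have "int (card (elts ?C)) * c i = (\<Sum>b\<in>elts ?C. \<Sum>k\<in>UNIV. c k * wt ?C b k)" by simp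
  also have "\<dots> = (\<Sum>k\<in>UNIV. c k * (\<Sum>b\<in>elts ?C. wt ?C b k))"
    by (subst sum.swap) (simp add: sum_distrib_left)
  also have "\<dots> = 0" using sum_wt[OF BB_crystal[OF d]] by simp
  finally show ?thesis using top_elt(4)[OF d] is_crystalD(1)[OF BB_crystal[OF d]] by auto
qed

text \<open>The simple roots are the columns of \<open>A\<close>. A symmetrizer \<open>d\<close>
  turns a relation \<open>n\<close> between columns into the relation \<open>d j * n j\<close>
  between rows.\<close>

lemma columns_independent:
  fixes n :: "'i \<Rightarrow> int"
  assumes n: "\<And>i. (\<Sum>j\<in>UNIV. n j * A i j) = 0"
  shows "n j = 0"
proof -
  obtain d where "symmetrizer A d"
    using simple_crystals[OF dominant_fund_weight] unfolding crystal_of_simple_module_def by blast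
  then have d: "d i > 0" "int (d i) * A i j = int (d j) * A j i" for i j
    unfolding symmetrizer_def by blast+
  have "(int (d j) * n j) * A j i = int (d i) * (n j * A i j)" for i j
  proof -
    have "(int (d j) * n j) * A j i = n j * (int (d j) * A j i)" by simp
    also have "\<dots> = int (d i) * (n j * A i j)" unfolding d(2)[of j i] by simp
    finally show ?thesis .
  qed
  then have "(\<Sum>j\<in>UNIV. (int (d j) * n j) * A j i) = int (d i) * (\<Sum>j\<in>UNIV. n j * A i j)" for i
    by (simp only: sum_distrib_left)
  then have "int (d j) * n j = 0" using n rows_independent[of "\<lambda>j. int (d j) * n j" j] by simp
  then show ?thesis using d(1)[of j] by simp
qed

text \<open>\<open>n j\<close> counts the uses of \<open>f\<close> with index \<open>j\<close> along
  a path from the top; the last clause covers the empty path.\<close>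

lemma BB_wt:
  assumes "dominant lam" and "b \<in> elts (BB lam)"
  shows "\<exists>n. (\<forall>i. wt (BB lam) b i = lam i - (\<Sum>j\<in>UNIV. int (n j) * A i j)) \<and>
             ((\<forall>j. n j = 0) \<longrightarrow> b = top_elt lam)"
  using assms
proof (induction rule: BB_induct)
  case top
  then show ?case using top_elt(2)[OF assms(1)] by (intro exI[of _ "\<lambda>_. 0"]) simp
next
  case (lower b b' k)
  then obtain n where n: "\<And>i. wt (BB lam) b i = lam i - (\<Sum>j\<in>UNIV. int (n j) * A i j)" by blast
  have "(\<Sum>j\<in>UNIV. int (if j = k then Suc (n j) else n j) * A i j) =
      (\<Sum>j\<in>UNIV. int (n j) * A i j + (if j = k then A i k else 0))" for i
    by (intro sum.cong) (auto simp: algebra_simps)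
  then have "(\<Sum>j\<in>UNIV. int (if j = k then Suc (n j) else n j) * A i j) =
      (\<Sum>j\<in>UNIV. int (n j) * A i j) + A i k" for i
    by (simp add: sum.distrib)
  moreover have "wt (BB lam) b' i = wt (BB lam) b i - A i k" for i
    using lower.hyps by (simp add: root_weight_def)
  ultimately show ?case
    by (intro exI[of _ "\<lambda>j. if j = k then Suc (n j) else n j"] conjI allI) (simp add: n, auto)
qed

end


section \<open>Highest elements of tensor words\<close>

lemma word_weight_Cons: "word_weight (k # w) = fund_weight k + word_weight w"
  by (simp add: word_weight_def)

lemma word_weight_count: "word_weight w i = int (count_list w i)"
  by (induction w) (auto simp: word_weight_def fund_weight_def)

lemma count_list_replicates:
  "distinct xs \<Longrightarrow> count_list (concat (map (\<lambda>i. replicate (n i) i) xs)) j = (if j \<in> set xs then n j else 0)"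
proof (induction xs)
  case (Cons x xs)
  have "count_list (replicate m x) j = (if x = j then m else 0)" for m by (induction m) auto
  then show ?case using Cons by auto
qed simp

lemma word_weight_eps_word: "word_weight (eps_word B k b) i = int (len (B k) True i b)"
  by (simp add: word_weight_count eps_word_def count_list_replicates len_def)

lemma word_weight_phi_word: "word_weight (phi_word B k b) i = int (len (B k) False i b)"
  by (simp add: word_weight_count phi_word_def count_list_replicates len_def)

locale fundamental_words = crystal_family A BB
  for A :: "'i::{finite,linorder} \<Rightarrow> 'i \<Rightarrow> int" and BB :: "'i weight \<Rightarrow> ('i, 'b) crystal" +
  fixes B :: "'i \<Rightarrow> ('i, 'b) crystal"
  assumes fundamental: "B i = BB (fund_weight i)"
begin

sublocale crystal_letters A B
  by unfold_locales (simp add: fundamental BB_crystal dominant_fund_weight)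

lemma decomposable_word: "decomposable (W w)"
  by (induction w)
    (simp_all add: decomposable_unit decomposable_cons decomposable_tensor fundamental dominant_fund_weight)

definition word_top :: "'i list \<Rightarrow> 'b list" where
  "word_top w = map (\<lambda>k. top_elt (fund_weight k)) w"

lemma word_top_elts: "word_top w \<in> elts (W w)"
  using top_elt(4)[OF dominant_fund_weight]
  by (induction w) (auto simp: word_top_def elts_word_Cons unit_simps fundamental simp del: word_crystal.simps(2))

lemma wt_word_top: "wt (W w) (word_top w) = word_weight w"
  by (induction w)
    (simp_all add: word_top_def unit_simps cons_simps tensor_simps word_weight_Cons fundamental
      top_elt(2)[OF dominant_fund_weight], simp add: word_weight_def)

text \<open>If the rule selected \<open>y\<close>, then \<open>eps\<close> of \<open>y\<close> would
  exceed \<open>phi\<close> of \<open>x\<close>, hence be positive, and \<open>e\<close> would not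
  vanish. So it always selects \<open>x\<close>.\<close>

lemma highest_append_iff:
  assumes x: "x \<in> elts (W u)" and y: "y \<in> elts (W v)"
  shows "highest_weight_elt (W (u @ v)) (x @ y) \<longleftrightarrow>
    highest_weight_elt (W u) x \<and> (\<forall>i. len (W v) True i y \<le> len (W u) False i x)"
proof -
  have "arrow (W (u @ v)) True i (x @ y) = None \<longleftrightarrow>
      arrow (W u) True i x = None \<and> len (W v) True i y \<le> len (W u) False i x" for i
    using word_append[OF x y, of True i] len_eq_0_iff[OF is_crystal_word y, of True i]
    by (auto simp: tensor_simps)
  then show ?thesis using x y by (auto simp: highest_arrow elts_word_append)
qed

lemma letter_word:
  assumes "b \<in> elts (B k)"
  shows "[b] \<in> elts (W [k])" "len (W [k]) s i [b] = len (B k) s i b" "wt (W [k]) [b] = wt (B k) b"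
proof -
  show "[b] \<in> elts (W [k])" using assms by (auto simp: cons_simps tensor_simps unit_simps)
  have "len (tensor_crystal (B k) unit_crystal) s i (b, []) = len (B k) s i b"
    using tensor_len[OF letter_crystal is_crystal_unit assms, of "[]" i]
    by (cases s) (simp_all add: unit_simps)
  then show "len (W [k]) s i [b] = len (B k) s i b" by (simp add: len_cons)
  show "wt (W [k]) [b] = wt (B k) b" by (simp add: cons_simps tensor_simps unit_simps)
qed

lemma word_snocD:
  assumes "z \<in> elts (W (w @ [k]))"
  obtains x b where "z = x @ [b]" "x \<in> elts (W w)" "b \<in> elts (B k)"
  using assms by (auto simp: elts_word_append cons_simps tensor_simps unit_simps)

lemma word_top_highest: "highest_weight_elt (W w) (word_top w)"
proof (induction w rule: rev_induct)
  case Nil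
  then show ?case by (simp add: word_top_def highest_arrow unit_simps)
next
  case (snoc k w)
  let ?b = "top_elt (fund_weight k)"
  have b: "highest_weight_elt (B k) ?b" "?b \<in> elts (B k)"
    using top_elt[OF dominant_fund_weight] by (simp_all add: fundamental)
  then have "len (B k) True i ?b = 0" for i by (intro len_None) (simp add: highest_arrow)
  then show ?case
    using snoc highest_append_iff[OF word_top_elts letter_word(1)[OF b(2)]] letter_word(2)[OF b(2)]
    by (simp add: word_top_def)
qed

lemma word_wt:
  assumes "x \<in> elts (W w)"
  shows "\<exists>n. (\<forall>i. wt (W w) x i = word_weight w i - (\<Sum>j\<in>UNIV. int (n j) * A i j)) \<and>
             ((\<forall>j. n j = 0) \<longrightarrow> x = word_top w)"
  using assms
proof (induction w arbitrary: x)
  case Nil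
  then show ?case by (intro exI[of _ "\<lambda>_. 0"]) (simp add: word_weight_def unit_simps word_top_def)
next
  case (Cons k w)
  then obtain b y where x: "x = b # y" "b \<in> elts (B k)" "y \<in> elts (W w)"
    by (auto simp: elts_word_Cons simp del: word_crystal.simps)
  obtain m where m: "\<And>i. wt (B k) b i = fund_weight k i - (\<Sum>j\<in>UNIV. int (m j) * A i j)"
      "(\<forall>j. m j = 0) \<longrightarrow> b = top_elt (fund_weight k)"
    using BB_wt[OF dominant_fund_weight] x(2) unfolding fundamental by blast
  obtain n where n: "\<And>i. wt (W w) y i = word_weight w i - (\<Sum>j\<in>UNIV. int (n j) * A i j)"
      "(\<forall>j. n j = 0) \<longrightarrow> y = word_top w"
    using Cons.IH[OF x(3)] by blast
  show ?case
    using m n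
    by (intro exI[of _ "\<lambda>j. m j + n j"])
      (simp add: x(1) cons_simps tensor_simps word_weight_Cons algebra_simps sum.distrib word_top_def)
qed

text \<open>By linear independence the weight determines the counts \<open>n\<close>, here all 0.
  The conclusion covers every element of this weight, highest or not.\<close>

lemma word_top_unique:
  assumes x: "x \<in> elts (W w)" and "wt (W w) x = word_weight w"
  shows "x = word_top w"
proof -
  obtain n where n: "\<And>i. wt (W w) x i = word_weight w i - (\<Sum>j\<in>UNIV. int (n j) * A i j)"
      "(\<forall>j. n j = 0) \<longrightarrow> x = word_top w"
    using word_wt[OF x] by blast
  have "int (n j) = 0" for j
    by (rule columns_independent) (use n(1) assms(2) in simp)
  then show ?thesis using n(2) by simp
qed

lemma word_highest_eq: "word_highest B w = word_top w"
  unfolding word_highest_def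
  using word_top_highest wt_word_top word_top_unique
  by (intro the_equality) (auto simp: highest_arrow)

lemma word_top_append: "word_top (u @ v) = word_top u @ word_top v"
  by (simp add: word_top_def)


section \<open>Atoms\<close>

lemma wt_append: "x \<in> elts (W u) \<Longrightarrow> y \<in> elts (W v) \<Longrightarrow> wt (W (u @ v)) (x @ y) = wt (W u) x + wt (W v) y"
  using word_append by blast

lemma len_highest:
  assumes "highest_weight_elt (W w) x"
  shows "int (len (W w) False i x) = wt (W w) x i"
proof -
  have "len (W w) True i x = 0" using assms by (intro len_None) (simp add: highest_arrow)
  then show ?thesis using crystal_wt[OF is_crystal_word, of x w i] assms by (simp add: highest_arrow)
qed

lemma highest_snoc_iff:
  assumes "x \<in> elts (W w)" and b: "b \<in> elts (B k)"
  shows "highest_weight_elt (W (w @ [k])) (x @ [b]) \<longleftrightarrow>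
    highest_weight_elt (W w) x \<and> (\<forall>i. int (len (B k) True i b) \<le> wt (W w) x i)"
  using highest_append_iff[OF assms(1) letter_word(1)[OF b]] letter_word(2)[OF b] len_highest
  by (metis nat_int_comparison(3))

text \<open>The map exists by \<open>basic_map_exists\<close>. It is unique because any candidate
  sends the highest element to a highest element of the top component, of which there is only
  one.\<close>

lemma atom_basic_map:
  assumes b: "b \<in> elts (B k)"
  shows "basic_map (W (eps_word B k b @ [k])) (W (phi_word B k b))
           (word_top (eps_word B k b) @ [b]) (word_top (phi_word B k b)) (atom B k b)"
    and "inj_on (atom B k b) (dom (atom B k b))"
proof -
  let ?u = "eps_word B k b" and ?v = "phi_word B k b"
  let ?x = "word_top ?u @ [b]" and ?y = "word_top ?v"
  have x: "highest_weight_elt (W (?u @ [k])) ?x"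
    unfolding highest_snoc_iff[OF word_top_elts b]
    by (simp add: word_top_highest wt_word_top word_weight_eps_word)
  \<comment> \<open>In fundamental coordinates this reads \<open>eps + wt b = phi\<close>, the
    crystal axiom for \<open>b\<close>.\<close>
  have "wt (W (?u @ [k])) ?x = wt (W ?v) ?y"
    unfolding wt_append[OF word_top_elts letter_word(1)[OF b]] letter_word(3)[OF b] wt_word_top
    by (rule ext) (simp add: word_weight_eps_word word_weight_phi_word crystal_wt[OF letter_crystal b])
  then obtain \<psi> where \<psi>: "basic_map (W (?u @ [k])) (W ?v) ?x ?y \<psi>" "inj_on \<psi> (dom \<psi>)"
      "dom \<psi> = component (W (?u @ [k])) ?x" "ran \<psi> = component (W ?v) ?y"
    using basic_map_exists[OF decomposable_word decomposable_word x word_top_highest] by blast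
  have eq: "atom B k b = \<psi>"
    unfolding atom_def Let_def top_component_def word_highest_eq
  proof (rule the_equality)
    fix \<chi> assume "\<chi> \<in> crys_hom (W (?u @ [k])) (W ?v) \<and> dom \<chi> = component (W (?u @ [k])) ?x \<and>
      ran \<chi> = component (W ?v) ?y"
    then have \<chi>: "\<chi> \<in> crys_hom (W (?u @ [k])) (W ?v)" "dom \<chi> = component (W (?u @ [k])) ?x"
      "ran \<chi> = component (W ?v) ?y" by auto
    have "?x \<in> dom \<chi>" unfolding \<chi>(2) by (rule component_self)
    then obtain y where y: "\<chi> ?x = Some y" by blast
    have "y \<in> component (W ?v) ?y" using ranI[of \<chi>, OF y] unfolding \<chi>(3) .
    then have "y = ?y"
      using decomposable_highest_unique[OF decomposable_word word_top_highest hom_highest[OF \<chi>(1) y x]]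
      by simp
    then have "basic_map (W (?u @ [k])) (W ?v) ?x ?y \<chi>"
      unfolding basic_map_def \<open>y = ?y\<close>[symmetric] by (intro conjI \<chi>(1) equalityD1[OF \<chi>(2)] y)
    then show "\<chi> = \<psi>" by (rule basic_map_unique[OF _ \<psi>(1)])
  next
    show "\<psi> \<in> crys_hom (W (?u @ [k])) (W ?v) \<and> dom \<psi> = component (W (?u @ [k])) ?x \<and>
      ran \<psi> = component (W ?v) ?y"
      using \<psi>(1) by (intro conjI \<psi>(3,4)) (simp add: basic_map_def)
  qed
  show "basic_map (W (?u @ [k])) (W ?v) ?x ?y (atom B k b)" "inj_on (atom B k b) (dom (atom B k b))"
    unfolding eq by (rule \<psi>)+
qed

end


section \<open>Admissible crossings\<close>

lemma length_swap_at [simp]: "length (swap_at xs p) = length xs"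
  by (simp add: swap_at_def)

lemma swap_at_append: "Suc p < length xs \<Longrightarrow> swap_at (xs @ ys) p = swap_at xs p @ ys"
  by (simp add: swap_at_def nth_append list_update_append)

lemma map_swap_at: "Suc p < length xs \<Longrightarrow> map f (swap_at xs p) = swap_at (map f xs) p"
  by (simp add: swap_at_def map_update)

lemma mset_swap_at: "Suc p < length xs \<Longrightarrow> mset (swap_at xs p) = mset xs"
  using mset_swap[of "Suc p" xs p] by (simp add: swap_at_def)

lemma swap_at_middle: "swap_at (us @ x # y # vs) (length us) = us @ y # x # vs"
  by (simp add: swap_at_def nth_append list_update_append)

lemma swap_all_simps [simp]:
  "swap_all xs [] = xs" "swap_all xs (p # ps) = swap_all (swap_at xs p) ps"
  "swap_all xs (ps @ qs) = swap_all (swap_all xs ps) qs"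
  by (simp_all add: swap_all_def)

lemma length_swap_all [simp]: "length (swap_all xs ps) = length xs"
  by (induction ps arbitrary: xs) simp_all

lemma mset_swap_all: "\<forall>p\<in>set ps. Suc p < length xs \<Longrightarrow> mset (swap_all xs ps) = mset xs"
  by (induction ps arbitrary: xs) (simp_all add: mset_swap_at)

lemma map_swap_all: "\<forall>p\<in>set ps. Suc p < length xs \<Longrightarrow> map f (swap_all xs ps) = swap_all (map f xs) ps"
  by (induction ps arbitrary: xs) (simp_all add: map_swap_at)

lemma swap_all_append:
  "\<forall>p\<in>set ps. Suc p < length xs \<Longrightarrow> swap_all (xs @ ys) ps = swap_all xs ps @ ys"
  by (induction ps arbitrary: xs) (simp_all add: swap_at_append)

lemma crossed_pairs_append_strands:
  "\<forall>p\<in>set ps. Suc p < length s \<Longrightarrow> crossed_pairs ps (s @ t) = crossed_pairs ps s"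
  by (induction ps arbitrary: s) (simp_all add: swap_at_append nth_append)

lemma crossed_pairs_append:
  "crossed_pairs (ps @ qs) s = crossed_pairs ps s @ crossed_pairs qs (swap_all s ps)"
  by (induction ps arbitrary: s) simp_all

lemma rev_upt_snoc: "rev [m..<m + length (xs @ [x])] = (m + length xs) # rev [m..<m + length xs]"
  by simp

lemma swap_all_move_left:
  "swap_all (us @ xs @ z # vs) (rev [length us..<length us + length xs]) = us @ z # xs @ vs"
proof (induction xs arbitrary: vs rule: rev_induct)
  case (snoc x xs)
  show ?case
    unfolding rev_upt_snoc
    using snoc[of "x # vs"] swap_at_middle[of "us @ xs" x z vs] by simp
qed simp

text \<open>Moving left, \<open>z\<close> meets the strands of \<open>xs\<close> from the nearest to
  the farthest, hence the reversal.\<close>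

lemma crossed_pairs_move_left:
  "crossed_pairs (rev [length us..<length us + length xs]) (us @ xs @ z # vs) = map (\<lambda>x. (x, z)) (rev xs)"
proof (induction xs arbitrary: vs rule: rev_induct)
  case (snoc x xs)
  show ?case
    unfolding rev_upt_snoc
    using snoc[of "x # vs"] swap_at_middle[of "us @ xs" x z vs] by (simp add: nth_append)
qed simp

lemma subseq_set: "subseq xs ys \<Longrightarrow> x \<in> set xs \<Longrightarrow> x \<in> set ys"
  by (auto elim: list_emb_set)

lemma subseq_revI: "subseq xs ys \<Longrightarrow> subseq (rev xs) (rev ys)"
  by (induction rule: list_emb.induct) (auto intro: list_emb_append_mono subseq_rev_drop_many)

lemma subseq_pair_append_right:
  assumes "subseq [y, x] (us @ vs)" and "distinct (us @ vs)" and "y \<in> set vs"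
  shows "subseq [y, x] vs"
proof -
  obtain as bs where ab: "[y, x] = as @ bs" "subseq as us" "subseq bs vs"
    using assms(1) by (rule subseq_appendE)
  show ?thesis
  proof (cases as)
    case (Cons a as')
    then have "y \<in> set us" using ab by (auto dest: subseq_set)
    then show ?thesis using assms by auto
  qed (use ab in simp)
qed

text \<open>Satisfied by insertion sort: a new last strand first crosses the strands nearest to it, in the
  order they have already been given, so a fully reversed triple is crossed in the order
  \<open>xy, xz, yz\<close>.\<close>

definition insertion_crossings :: "'i list \<Rightarrow> nat list \<Rightarrow> bool" where
  "insertion_crossings w ps \<longleftrightarrow>
     (let cs = crossed_pairs ps [0..<length w]; s = swap_all [0..<length w] ps in
       (\<forall>p\<in>set ps. Suc p < length w) \<and> distinct cs \<and>
       (\<forall>(x, y)\<in>set cs. x < y \<and> w ! x \<noteq> w ! y \<and> subseq [y, x] s) \<and>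
       (\<forall>x y z. x < y \<and> y < z \<and> {(x, y), (x, z), (y, z)} \<subseteq> set cs \<longrightarrow>
          subseq [(x, y), (x, z), (y, z)] cs))"

lemma insertion_crossings_exist:
  "mset w = mset w' \<Longrightarrow> \<exists>ps. insertion_crossings w ps \<and> swap_all w ps = w'"
proof (induction w arbitrary: w' rule: rev_induct)
  case Nil
  then show ?case by (intro exI[of _ "[]"]) (simp add: insertion_crossings_def)
next
  case (snoc k w)
  let ?n = "length w"
  have "k \<in> set w'" using snoc.prems by (metis in_set_conv_decomp set_mset_mset)
  \<comment> \<open>The new strand goes to the last occurrence of its label in \<open>w'\<close>, so
    the strands it has to pass all carry other labels.\<close>
  then obtain us vs where w': "w' = us @ k # vs" "k \<notin> set vs" by (meson split_list_last)
  have "mset w = mset (us @ vs)" using snoc.prems w' by simp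
  then obtain ps where ps: "insertion_crossings w ps" "swap_all w ps = us @ vs"
    using snoc.IH by blast
  define cs where "cs = crossed_pairs ps [0..<?n]"
  define s where "s = swap_all [0..<?n] ps"
  have bound: "\<forall>p\<in>set ps. Suc p < ?n" and dist: "distinct cs"
    and pairs: "\<And>x y. (x, y) \<in> set cs \<Longrightarrow> x < y \<and> w ! x \<noteq> w ! y \<and> subseq [y, x] s"
    and triples: "\<And>x y z. x < y \<Longrightarrow> y < z \<Longrightarrow> {(x, y), (x, z), (y, z)} \<subseteq> set cs \<Longrightarrow>
      subseq [(x, y), (x, z), (y, z)] cs"
    using ps(1) unfolding insertion_crossings_def Let_def cs_def s_def by auto
  have ms: "mset s = mset [0..<?n]" unfolding s_def using bound by (intro mset_swap_all) simp
  have s: "distinct s" "set s = {0..<?n}"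
    using mset_eq_imp_distinct_iff[OF ms] mset_eq_setD[OF ms] by auto
  define X where "X = take (length us) s"
  define Y where "Y = drop (length us) s"
  have sXY: "s = X @ Y" by (simp add: X_def Y_def)
  have ls: "length s = length us + length vs"
    using arg_cong[OF ps(2), of length] by (simp add: s_def)
  have lX: "length X = length us" and lY: "length Y = length vs" using ls by (simp_all add: X_def Y_def)
  have "map ((!) w) s = us @ vs"
    unfolding s_def using bound ps(2) by (simp add: map_swap_all map_nth)
  then have "map ((!) w) Y = vs" using lX by (simp add: sXY append_eq_append_conv)
  then have labels: "w ! x \<noteq> k" if "x \<in> set Y" for x using w'(2) that by force
  define qs where "qs = ps @ rev [length us..<length us + length vs]"
  have n: "?n = length us + length vs" using arg_cong[OF ps(2), of length] by simp
  have strands: "[0..<length (w @ [k])] = [0..<?n] @ [?n]" by simp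
  have move: "swap_all (X @ Y @ [?n]) (rev [length us..<length us + length vs]) = X @ ?n # Y"
    "crossed_pairs (rev [length us..<length us + length vs]) (X @ Y @ [?n]) = map (\<lambda>x. (x, ?n)) (rev Y)"
    using swap_all_move_left[of X Y ?n "[]"] crossed_pairs_move_left[of X Y ?n "[]"] lX lY by simp_all
  have s': "swap_all [0..<length (w @ [k])] qs = X @ ?n # Y"
    unfolding strands qs_def using swap_all_append[of ps "[0..<?n]" "[?n]"] bound move(1)
    by (simp flip: s_def) (simp add: sXY)
  have cs': "crossed_pairs qs [0..<length (w @ [k])] = cs @ map (\<lambda>x. (x, ?n)) (rev Y)"
    unfolding strands qs_def crossed_pairs_append
    using swap_all_append[of ps "[0..<?n]" "[?n]"] crossed_pairs_append_strands[of ps "[0..<?n]" "[?n]"]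
      bound move(2)
    by (simp flip: s_def cs_def) (simp add: sXY)
  have small: "x < ?n" "y < ?n" if "(x, y) \<in> set cs" for x y
    using pairs[OF that] s(2) by (auto dest: subseq_set)
  have Yn: "x < ?n" if "x \<in> set Y" for x using that s(2) sXY by auto
  have sub: "subseq s (X @ ?n # Y)" unfolding sXY by (intro list_emb_append_mono) auto
  have "swap_all (w @ [k]) qs = w'"
    using swap_all_append[of ps w "[k]"] bound ps(2) swap_all_move_left[of us vs k "[]"]
    by (simp add: qs_def w')
  moreover have "insertion_crossings (w @ [k]) qs"
    unfolding insertion_crossings_def Let_def s' cs'
  proof (intro conjI ballI allI impI)
    fix p assume "p \<in> set qs"
    then show "Suc p < length (w @ [k])" using bound n by (auto simp: qs_def)
  next
    show "distinct (cs @ map (\<lambda>x. (x, ?n)) (rev Y))"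
      using dist s(1) sXY small by (force simp: distinct_map inj_on_def)
  next
    fix q assume "q \<in> set (cs @ map (\<lambda>x. (x, ?n)) (rev Y))"
    then have "q \<in> set cs \<or> q \<in> (\<lambda>x. (x, ?n)) ` set Y" by auto
    then consider x y where "q = (x, y)" "(x, y) \<in> set cs" | x where "q = (x, ?n)" "x \<in> set Y"
      by (metis imageE surj_pair)
    then show "case q of (x, y) \<Rightarrow> x < y \<and> (w @ [k]) ! x \<noteq> (w @ [k]) ! y \<and> subseq [y, x] (X @ ?n # Y)"
    proof cases
      case (1 x y)
      then show ?thesis
        using pairs[OF 1(2)] small[OF 1(2)] subseq_order.trans[OF _ sub] by (auto simp: nth_append)
    next
      case (2 x)
      have "subseq ([] @ [?n, x]) (X @ ?n # Y)"
        using 2(2) by (intro list_emb_append_mono) (auto simp: subseq_singleton_left)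
      then show ?thesis using 2 Yn labels by (auto simp: nth_append)
    qed
  next
    fix x y z
    assume a: "x < y \<and> y < z \<and> {(x, y), (x, z), (y, z)} \<subseteq> set (cs @ map (\<lambda>x. (x, ?n)) (rev Y))"
    show "subseq [(x, y), (x, z), (y, z)] (cs @ map (\<lambda>x. (x, ?n)) (rev Y))"
    proof (cases "z = ?n")
      case False
      then have "(x, z) \<in> set cs" "(y, z) \<in> set cs" using a by auto
      moreover from this have "y \<noteq> ?n" using small by blast
      ultimately have "{(x, y), (x, z), (y, z)} \<subseteq> set cs" using a by auto
      then show ?thesis using triples a by (auto intro: list_emb_append2)
    next
      case True
      \<comment> \<open>The crossed pair already stands inverted in \<open>Y\<close>, with
        \<open>y\<close> before \<open>x\<close>. The new strand runs through \<open>Y\<close> from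
        right to left, so it meets \<open>x\<close> first, after the crossing of \<open>x\<close>
        and \<open>y\<close>.\<close>
      have xy: "(x, y) \<in> set cs" and Y: "x \<in> set Y" "y \<in> set Y" using a True small Yn by auto
      then have "subseq [y, x] Y" using pairs subseq_pair_append_right s(1) sXY by metis
      then have "subseq (rev [y, x]) (rev Y)" by (rule subseq_revI)
      then have "subseq (map (\<lambda>x. (x, ?n)) [x, y]) (map (\<lambda>x. (x, ?n)) (rev Y))"
        by (intro subseq_map) simp
      moreover have "subseq [(x, y)] cs" using xy by (simp add: subseq_singleton_left)
      ultimately have "subseq ([(x, y)] @ map (\<lambda>x. (x, ?n)) [x, y]) (cs @ map (\<lambda>x. (x, ?n)) (rev Y))"
        by (intro list_emb_append_mono)
      then show ?thesis using True by simp
    qed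
  qed
  ultimately show ?case by blast
qed

text \<open>Every crossed pair has its smaller strand on the left, so distinct ordered pairs are
  distinct as unordered pairs.\<close>

lemma insertion_crossings_admissible:
  assumes "insertion_crossings w ps"
  shows "admissible_crossings w ps"
proof -
  define cs where "cs = crossed_pairs ps [0..<length w]"
  have bound: "\<forall>p\<in>set ps. Suc p < length w" and dist: "distinct cs"
    and pairs: "\<And>x y. (x, y) \<in> set cs \<Longrightarrow> x < y \<and> w ! x \<noteq> w ! y"
    and triples: "\<And>x y z. x < y \<Longrightarrow> y < z \<Longrightarrow> {(x, y), (x, z), (y, z)} \<subseteq> set cs \<Longrightarrow>
      subseq [(x, y), (x, z), (y, z)] cs"
    using assms unfolding insertion_crossings_def Let_def cs_def by auto
  show ?thesis
    unfolding admissible_crossings_def Let_def cs_def[symmetric]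
  proof (intro conjI ballI allI impI)
    fix p assume "p \<in> set ps" then show "Suc p < length w" using bound by blast
  next
    fix q assume "q \<in> set cs" then show "case q of (x, y) \<Rightarrow> w ! x \<noteq> w ! y" using pairs by auto
  next
    fix a b assume ab: "a < b \<and> b < length cs"
    obtain x y x' y' where xy: "cs ! a = (x, y)" "cs ! b = (x', y')" by fastforce
    have "(x, y) \<in> set cs" "(x', y') \<in> set cs" using ab xy by (metis nth_mem order.strict_trans)+
    then have "x < y" "x' < y'" using pairs by auto
    moreover have "(x, y) \<noteq> (x', y')"
      using ab xy dist nth_eq_iff_index_eq[of cs a b] by auto
    ultimately show "{fst (cs ! a), snd (cs ! a)} \<noteq> {fst (cs ! b), snd (cs ! b)}"
      by (auto simp: xy doubleton_eq_iff)
  next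
    fix x y z assume "x < y \<and> y < z \<and> {(x, y), (x, z), (y, z)} \<subseteq> set cs"
    then have "subseq [(x, y), (x, z), (y, z)] cs" using triples by blast
    then obtain l1 l2 l3 l4 where cs: "cs = l1 @ (x, y) # l2 @ (x, z) # l3 @ (y, z) # l4"
      by (auto dest!: list_emb_ConsD)
    show "\<exists>a b c. a < b \<and> b < c \<and> c < length cs \<and> cs ! a = (x, y) \<and> cs ! b = (x, z) \<and> cs ! c = (y, z)"
      by (intro exI[of _ "length l1"] exI[of _ "Suc (length l1 + length l2)"]
          exI[of _ "Suc (Suc (length l1 + length l2 + length l3))"])
        (simp add: cs nth_append)
  qed
qed

text \<open>\<open>ARG_MIN\<close> obeys its predicate only if some list does; sorting
  \<open>w\<close> into a word ending in \<open>v\<close> provides one.\<close>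

lemma minimal_crossings:
  assumes "mset v \<subseteq># mset w"
  shows "admissible_crossings w (minimal_crossings w v)"
    and "\<exists>w'. swap_all w (minimal_crossings w v) = w' @ v"
proof -
  obtain w' where "mset w' = mset w - mset v" using ex_mset by blast
  then have "mset w = mset (w' @ v)" using assms by simp
  then obtain ps where "admissible_crossings w ps" "swap_all w ps = w' @ v"
    using insertion_crossings_exist insertion_crossings_admissible by metis
  then have "admissible_crossings w (minimal_crossings w v) \<and>
      (\<exists>w'. swap_all w (minimal_crossings w v) = w' @ v)"
    unfolding minimal_crossings_def by (intro arg_min_natI) blast
  then show "admissible_crossings w (minimal_crossings w v)"
    "\<exists>w'. swap_all w (minimal_crossings w v) = w' @ v" by auto
qed

lemma word_weight_mset: "mset u = mset v \<Longrightarrow> word_weight u = word_weight v"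
  by (rule ext) (simp add: word_weight_count flip: count_mset)


section \<open>Permutations\<close>

locale crossing_words = fundamental_words A BB B
  for A :: "'i::{finite,linorder} \<Rightarrow> 'i \<Rightarrow> int" and BB :: "'i weight \<Rightarrow> ('i, 'b) crystal"
    and B :: "'i \<Rightarrow> ('i, 'b) crystal" +
  fixes cr :: "'i \<Rightarrow> 'i \<Rightarrow> 'b wmap"
  assumes crossing_iso: "i \<noteq> j \<Longrightarrow> crys_iso (word_crystal B [i, j]) (word_crystal B [j, i]) (cr i j)"
begin

definition total_emb :: "'i list \<Rightarrow> 'i list \<Rightarrow> 'b wmap \<Rightarrow> bool" where
  "total_emb u v \<psi> \<longleftrightarrow> crys_emb (W u) (W v) \<psi> \<and> dom \<psi> = elts (W u)"

lemma total_emb_id: "total_emb w w (id_map B w)"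
  unfolding total_emb_def using crys_emb_id_map[of w] by (auto simp: id_map_def split: if_splits)

lemma total_emb_comp:
  assumes "total_emb u v \<psi>" "total_emb v w \<chi>"
  shows "total_emb u w (\<chi> \<circ>\<^sub>m \<psi>)"
proof -
  have \<psi>: "crys_emb (W u) (W v) \<psi>" "dom \<psi> = elts (W u)" and \<chi>: "crys_emb (W v) (W w) \<chi>" "dom \<chi> = elts (W v)"
    using assms by (auto simp: total_emb_def)
  have "x \<in> dom (\<chi> \<circ>\<^sub>m \<psi>)" if "x \<in> elts (W u)" for x
  proof -
    obtain y where y: "\<psi> x = Some y" using \<open>x \<in> elts (W u)\<close> \<psi>(2) by blast
    then have "y \<in> dom \<chi>" using crys_homD(2)[OF crys_emb_hom[OF \<psi>(1)]] \<chi>(2) by blast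
    then show ?thesis using y by (auto simp: map_comp_def)
  qed
  moreover have e: "crys_emb (W u) (W w) (\<chi> \<circ>\<^sub>m \<psi>)" using crys_emb_comp \<psi>(1) \<chi>(1) by blast
  moreover have "dom (\<chi> \<circ>\<^sub>m \<psi>) \<subseteq> elts (W u)" using crys_homD(1)[OF crys_emb_hom[OF e]] by blast
  ultimately show ?thesis unfolding total_emb_def by blast
qed

lemma total_emb_tensor:
  assumes "total_emb u u' \<psi>" "total_emb v v' \<chi>"
  shows "total_emb (u @ v) (u' @ v') (tensor_map (length u) \<psi> \<chi>)"
proof -
  have e: "crys_emb (W (u @ v)) (W (u' @ v')) (tensor_map (length u) \<psi> \<chi>)"
    using assms crys_emb_tensor_map by (simp add: total_emb_def)
  have d: "dom \<psi> = elts (W u)" "dom \<chi> = elts (W v)" using assms by (auto simp: total_emb_def)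
  have "z \<in> dom (tensor_map (length u) \<psi> \<chi>)" if "z \<in> elts (W (u @ v))" for z
  proof -
    have "take (length u) z \<in> dom \<psi>" "drop (length u) z \<in> dom \<chi>"
      unfolding d using elts_word_appendD[OF that] by auto
    then show ?thesis by (auto simp: tensor_map_def)
  qed
  moreover have "dom (tensor_map (length u) \<psi> \<chi>) \<subseteq> elts (W (u @ v))"
    using crys_homD(1)[OF crys_emb_hom[OF e]] by blast
  ultimately show ?thesis using e unfolding total_emb_def by blast
qed

lemma total_emb_crossing:
  assumes p: "Suc p < length w" and neq: "w ! p \<noteq> w ! Suc p"
  shows "total_emb w (swap_at w p) (crossing_at B cr w p)"
proof -
  let ?u = "take p w" and ?v = "drop (p + 2) w"
  have w: "w = ?u @ [w ! p, w ! Suc p] @ ?v"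
    using p by (metis Cons_nth_drop_Suc Suc_lessD add_2_eq_Suc' append_Cons append_Nil append_take_drop_id)
  have sw: "swap_at w p = ?u @ [w ! Suc p, w ! p] @ ?v"
    using swap_at_middle[of ?u "w ! p" "w ! Suc p" ?v] w p by simp
  have "total_emb [w ! p, w ! Suc p] [w ! Suc p, w ! p] (cr (w ! p) (w ! Suc p))"
    using crossing_iso[OF neq] unfolding crys_iso_def total_emb_def crys_emb_def by metis
  then have "total_emb ([w ! p, w ! Suc p] @ ?v) ([w ! Suc p, w ! p] @ ?v)
      (tensor_map 2 (cr (w ! p) (w ! Suc p)) (id_map B ?v))"
    using total_emb_tensor[OF _ total_emb_id[of ?v]] by (metis length_Cons list.size(3) numeral_2_eq_2)
  then have "total_emb (?u @ [w ! p, w ! Suc p] @ ?v) (?u @ [w ! Suc p, w ! p] @ ?v)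
      (tensor_map (length ?u) (id_map B ?u) (tensor_map 2 (cr (w ! p) (w ! Suc p)) (id_map B ?v)))"
    by (rule total_emb_tensor[OF total_emb_id])
  moreover have "length ?u = p" using p by simp
  ultimately show ?thesis unfolding crossing_at_def sw using w by metis
qed

text \<open>Admissibility speaks of strands, the maps of labels. Keeping the strands
  \<open>s\<close> and the labelling \<open>l\<close> apart lets the induction follow both.\<close>

lemma total_emb_crossings_map:
  assumes "\<forall>p\<in>set ps. Suc p < length s" and "\<forall>(x, y)\<in>set (crossed_pairs ps s). l x \<noteq> l y"
  shows "total_emb (map l s) (swap_all (map l s) ps) (crossings_map B cr ps (map l s))"
  using assms
proof (induction ps arbitrary: s)
  case Nil
  then show ?case by (simp add: total_emb_id)
next
  case (Cons p ps)
  have p: "Suc p < length s" using Cons.prems by simp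
  have "total_emb (map l s) (swap_at (map l s) p) (crossing_at B cr (map l s) p)"
    using Cons.prems p by (intro total_emb_crossing) auto
  moreover have "total_emb (map l (swap_at s p)) (swap_all (map l (swap_at s p)) ps)
      (crossings_map B cr ps (map l (swap_at s p)))"
    using Cons.prems by (intro Cons.IH) auto
  ultimately show ?case using total_emb_comp by (simp add: map_swap_at[OF p])
qed

lemma total_emb_admissible:
  assumes "admissible_crossings w ps"
  shows "total_emb w (swap_all w ps) (crossings_map B cr ps w)"
proof -
  have "total_emb (map ((!) w) [0..<length w]) (swap_all (map ((!) w) [0..<length w]) ps)
      (crossings_map B cr ps (map ((!) w) [0..<length w]))"
    using assms unfolding admissible_crossings_def Let_def
    by (intro total_emb_crossings_map) auto
  then show ?thesis by (simp add: map_nth)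
qed

text \<open>The image has the weight of the word \<open>v\<close>, and only
  \<open>word_top v\<close> has that weight.\<close>

lemma total_emb_top:
  assumes \<psi>: "total_emb u v \<psi>" and "word_weight u = word_weight v"
  shows "\<psi> (word_top u) = Some (word_top v)"
proof -
  have e: "\<psi> \<in> crys_hom (W u) (W v)" and "dom \<psi> = elts (W u)"
    using \<psi> by (auto simp: total_emb_def crys_emb_def)
  then have "word_top u \<in> dom \<psi>" using word_top_elts by blast
  then obtain y where y: "\<psi> (word_top u) = Some y" by blast
  have "y = word_top v"
    by (rule word_top_unique) (use crys_homD(2,3)[OF e y] wt_word_top assms(2) in simp_all)
  then show ?thesis using y by simp
qed

lemma crossings_map_top:
  assumes "admissible_crossings w ps"
  shows "crossings_map B cr ps w (word_top w) = Some (word_top (swap_all w ps))"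
proof -
  have "\<forall>p\<in>set ps. Suc p < length w" using assms by (simp add: admissible_crossings_def Let_def)
  then show ?thesis
    using total_emb_top[OF total_emb_admissible[OF assms]] word_weight_mset mset_swap_all by metis
qed


section \<open>Bottom diagrams\<close>

text \<open>The letter \<open>i\<close> occurs \<open>eps\<close> times in the word of
  \<open>b\<close> and as often in \<open>\<delta>\<close> as the \<open>i\<close>-th coordinate of
  the weight of \<open>x\<close> says: the numbers compared when testing whether
  \<open>x @ [b]\<close> is highest. So enough strands are there for the atom.\<close>

lemma eps_word_subset:
  assumes "highest_weight_elt (W (w @ [k])) (x @ [b])" "x \<in> elts (W w)" "b \<in> elts (B k)"
    and "wt (W w) x = word_weight \<delta>"
  shows "mset (eps_word B k b) \<subseteq># mset \<delta>"
proof (rule mset_subset_eqI)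
  fix i
  have "word_weight (eps_word B k b) i \<le> word_weight \<delta> i"
    using assms highest_snoc_iff[OF assms(2,3)] by (simp add: word_weight_eps_word)
  then show "count (mset (eps_word B k b)) i \<le> count (mset \<delta>) i"
    by (simp add: word_weight_count count_mset)
qed

text \<open>The highest element is followed through one stage: \<open>D\<close> takes
  \<open>x\<close> to the top of \<open>\<delta>\<close>, the permutation to the top of
  \<open>\<delta>' @ eps_word B k b\<close>, and the atom turns the top of \<open>eps_word\<close>
  with \<open>b\<close> into the top of \<open>phi_word\<close>.\<close>

lemma bottom_top:
  assumes "bottom B cr w x \<delta> D"
  shows "highest_weight_elt (W w) x \<and> wt (W w) x = word_weight \<delta> \<and> crys_emb (W w) (W \<delta>) D \<and>
    D x = Some (word_top \<delta>)"
  using assms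
proof induction
  case empty
  then show ?case using crys_emb_id_map[of "[]"]
    by (simp add: highest_arrow unit_simps id_map_def word_top_def word_weight_def)
next
  case (snoc w x \<delta> D k b ps \<delta>')
  let ?e = "eps_word B k b" and ?p = "phi_word B k b" and ?\<beta> = "crossings_map B cr ps \<delta>"
  have x: "highest_weight_elt (W w) x" "x \<in> elts (W w)" "wt (W w) x = word_weight \<delta>"
      "crys_emb (W w) (W \<delta>) D" "D x = Some (word_top \<delta>)"
    using snoc.IH by (auto simp: highest_arrow)
  have "x @ [b] \<in> elts (W (w @ [k]))" using snoc.hyps(2) by (simp add: highest_arrow)
  then have b: "b \<in> elts (B k)" by (rule word_snocD) simp
  have adm: "admissible_crossings \<delta> ps"
    unfolding snoc.hyps(3) by (rule minimal_crossings, rule eps_word_subset) (use snoc.hyps x b in auto)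
  note at = atom_basic_map[OF b]
  have ate: "crys_emb (W (?e @ [k])) (W ?p) (atom B k b)"
    using at by (simp add: basic_map_def crys_emb_def)
  have atv: "atom B k b (word_top ?e @ [b]) = Some (word_top ?p)"
    using at by (simp add: basic_map_def)
  have "total_emb \<delta> (\<delta>' @ ?e) ?\<beta>" using total_emb_admissible[OF adm] snoc.hyps(4) by simp
  then have "crys_emb (W w) (W (\<delta>' @ ?e)) (?\<beta> \<circ>\<^sub>m D)"
    unfolding total_emb_def by (blast intro: crys_emb_comp[OF x(4)])
  from crys_emb_tensor_map[OF this crys_emb_id_map[of "[k]"]]
  have "crys_emb (W (w @ [k])) (W (\<delta>' @ ?e @ [k])) (tensor_map (length w) (?\<beta> \<circ>\<^sub>m D) (id_map B [k]))"
    by simp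
  from crys_emb_comp[OF this crys_emb_tensor_map[OF crys_emb_id_map ate]]
  have e: "crys_emb (W (w @ [k])) (W (\<delta>' @ ?p))
      (tensor_map (length \<delta>') (id_map B \<delta>') (atom B k b) \<circ>\<^sub>m
        tensor_map (length w) (?\<beta> \<circ>\<^sub>m D) (id_map B [k]))" .
  have "(?\<beta> \<circ>\<^sub>m D) x = Some (word_top \<delta>' @ word_top ?e)"
    using crossings_map_top[OF adm] x(5) snoc.hyps(4) by (simp add: map_comp_def word_top_append)
  then have "tensor_map (length w) (?\<beta> \<circ>\<^sub>m D) (id_map B [k]) (x @ [b]) =
      Some (word_top \<delta>' @ word_top ?e @ [b])"
    using tensor_map_append[OF x(2)] letter_word(1)[OF b] by (simp add: id_map_def)
  moreover have "tensor_map (length \<delta>') (id_map B \<delta>') (atom B k b) (word_top \<delta>' @ word_top ?e @ [b]) =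
      Some (word_top (\<delta>' @ ?p))"
    using tensor_map_append[OF word_top_elts] atv word_top_elts
    by (simp add: id_map_def word_top_append)
  ultimately have v: "(tensor_map (length \<delta>') (id_map B \<delta>') (atom B k b) \<circ>\<^sub>m
        tensor_map (length w) (?\<beta> \<circ>\<^sub>m D) (id_map B [k])) (x @ [b]) = Some (word_top (\<delta>' @ ?p))"
    by (simp add: map_comp_def)
  have "wt (W (w @ [k])) (x @ [b]) = word_weight (\<delta>' @ ?p)"
    using crys_homD(3)[OF crys_emb_hom[OF e] v] wt_word_top by simp
  then show ?case using snoc.hyps(2) e v by blast
qed

lemma bottom_exists: "highest_weight_elt (W w) x \<Longrightarrow> \<exists>\<delta> D. bottom B cr w x \<delta> D"
proof (induction w arbitrary: x rule: rev_induct)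
  case Nil
  then have "x = []" by (simp add: highest_arrow unit_simps)
  then show ?case using bottom.empty by blast
next
  case (snoc k w)
  have "x \<in> elts (W (w @ [k]))" using snoc.prems by (simp add: highest_arrow)
  then obtain y b where x: "x = y @ [b]" "y \<in> elts (W w)" "b \<in> elts (B k)" by (rule word_snocD)
  have "highest_weight_elt (W w) y" using snoc.prems highest_snoc_iff[OF x(2,3)] x(1) by simp
  then obtain \<delta> D where D: "bottom B cr w y \<delta> D" using snoc.IH by blast
  have "mset (eps_word B k b) \<subseteq># mset \<delta>"
    using eps_word_subset[OF _ x(2,3)] snoc.prems x(1) bottom_top[OF D] by blast
  then obtain \<delta>' where "swap_all \<delta> (minimal_crossings \<delta> (eps_word B k b)) = \<delta>' @ eps_word B k b"
    using minimal_crossings(2) by blast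
  then show ?case using bottom.snoc[OF D _ refl] snoc.prems x(1) by blast
qed

text \<open>The minimal permutation is one fixed choice, so word and highest weight element
  determine the diagram; thus different diagrams of the same word belong to different
  elements.\<close>

lemma bottom_deterministic:
  assumes "bottom B cr w x \<delta> D" and "bottom B cr w x \<delta>' D'"
  shows "\<delta> = \<delta>' \<and> D = D'"
  using assms
proof (induction arbitrary: \<delta>' D')
  case empty
  then show ?case by (auto elim: bottom.cases)
next
  case (snoc w x \<delta> D k b ps \<delta>1)
  note IH = snoc.IH and ps = snoc.hyps(3,4)
  from snoc.prems show ?case
  proof cases
    case (snoc w' x' \<delta>2 D2 k' b' ps' \<delta>3)
    have eq: "w' = w" "x' = x" "k' = k" "b' = b" using snoc(1,2) by auto
    have \<delta>D: "\<delta>2 = \<delta>" "D2 = D" using IH[of \<delta>2 D2] snoc(5) unfolding eq by auto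
    have "ps' = ps" using snoc(7) ps(1) unfolding eq \<delta>D by simp
    moreover from this have "\<delta>3 = \<delta>1" using snoc(8) ps(2) unfolding eq \<delta>D by simp
    ultimately show ?thesis unfolding snoc(3,4) eq \<delta>D by simp
  qed simp
qed

end


lemma (in crossing_words) hat_basic_map:
  fixes \<delta> \<delta>' :: "'i list"
  assumes g: "bottom B cr w x \<delta> D" and f: "bottom B cr w' y \<delta>' D'"
    and P: "is_permutation B cr \<delta> \<delta>' P" and wt: "word_weight \<delta> = word_weight \<delta>'"
  shows "basic_map (W w) (W w') x y (flip_map D' \<circ>\<^sub>m jones_wenzl B \<delta>' \<circ>\<^sub>m P \<circ>\<^sub>m D)"
proof -
  note g' = bottom_top[OF g] and f' = bottom_top[OF f]
  have P': "total_emb \<delta> \<delta>' P" using P total_emb_admissible by (auto simp: is_permutation_def)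
  have jw: "jones_wenzl B \<delta>' = (\<lambda>z. if z \<in> component (W \<delta>') (word_top \<delta>') then Some z else None)"
    by (simp add: jones_wenzl_def top_component_def word_highest_eq)
  have ejw: "crys_emb (W \<delta>') (W \<delta>') (jones_wenzl B \<delta>')"
    unfolding jw by (rule crys_emb_restrict_component[OF is_crystal_word word_top_elts])
  have eP: "crys_emb (W \<delta>) (W \<delta>') P" using P' by (simp add: total_emb_def)
  have ef: "crys_emb (W \<delta>') (W w') (flip_map D')"
    using crys_emb_flip[OF is_crystal_word is_crystal_word] f' by blast
  have ePD: "crys_emb (W w) (W \<delta>') (P \<circ>\<^sub>m D)" using crys_emb_comp[OF _ eP] g' by blast
  have PDx: "(P \<circ>\<^sub>m D) x = Some (word_top \<delta>')"
    using g' total_emb_top[OF P' wt] by (simp add: map_comp_def)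
  have "flip_map D' (word_top \<delta>') = Some y"
    using f' flip_map_eq_Some_iff unfolding crys_emb_def by metis
  then have "(flip_map D' \<circ>\<^sub>m jones_wenzl B \<delta>' \<circ>\<^sub>m P \<circ>\<^sub>m D) x = Some y"
    using g' total_emb_top[OF P' wt] by (simp add: map_comp_def jw component_self)
  moreover have "crys_emb (W w) (W w') (flip_map D' \<circ>\<^sub>m jones_wenzl B \<delta>' \<circ>\<^sub>m P \<circ>\<^sub>m D)"
    using g' by (intro crys_emb_comp[OF _ crys_emb_comp[OF eP crys_emb_comp[OF ejw ef]]]) blast
  moreover have "dom (flip_map D' \<circ>\<^sub>m jones_wenzl B \<delta>' \<circ>\<^sub>m P \<circ>\<^sub>m D) \<subseteq> component (W w) x"
  proof
    fix z assume "z \<in> dom (flip_map D' \<circ>\<^sub>m jones_wenzl B \<delta>' \<circ>\<^sub>m P \<circ>\<^sub>m D)"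
    then obtain d p q where "D z = Some d" "P d = Some p" "jones_wenzl B \<delta>' p = Some q"
      by (auto simp: map_comp_Some_iff)
    then have p: "(P \<circ>\<^sub>m D) z = Some p" "p \<in> component (W \<delta>') (word_top \<delta>')"
      by (auto simp: jw map_comp_def split: if_splits)
    \<comment> \<open>\<open>P\<close> after \<open>D\<close> maps the component of \<open>x\<close>
      onto the top component, so \<open>p\<close> has a preimage there, and by injectivity this is
      \<open>z\<close>.\<close>
    then obtain z' where "z' \<in> component (W w) x" "(P \<circ>\<^sub>m D) z' = Some p"
      using hom_component_lift[OF crys_emb_hom[OF ePD] PDx] by blast
    then show "z \<in> component (W w) x" using crys_emb_inj[OF ePD p(1)] by blast
  qed
  ultimately show ?thesis by (simp add: basic_map_def crys_emb_def)
qed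


section \<open>The linear category\<close>

interpretation lin: module "lin_scale :: 'k::field \<Rightarrow> ('b, 'c, 'k) lin \<Rightarrow> ('b, 'c, 'k) lin"
  by unfold_locales (auto simp: lin_scale_def fun_eq_iff algebra_simps)

lemma lin_comp_lin_of:
  assumes "finite (elts C)" and "ran \<psi> \<subseteq> elts C"
  shows "lin_comp C (lin_of \<chi>) (lin_of \<psi>) = lin_of (\<chi> \<circ>\<^sub>m \<psi>)"
proof (intro ext)
  fix d b
  show "lin_comp C (lin_of \<chi>) (lin_of \<psi>) d b = lin_of (\<chi> \<circ>\<^sub>m \<psi>) d b"
  proof (cases "\<psi> b")
    case None
    then show ?thesis by (simp add: lin_comp_def lin_of_def)
  next
    case (Some c)
    then have c: "c \<in> elts C" using assms(2) by (auto simp: ran_def)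
    have "lin_comp C (lin_of \<chi>) (lin_of \<psi>) d b = (\<Sum>c'\<in>elts C. if c' = c then lin_of \<chi> d c else 0)"
      unfolding lin_comp_def by (intro sum.cong) (auto simp: lin_of_def Some)
    then show ?thesis using c assms(1) Some by (simp add: lin_of_def)
  qed
qed

context crystal_family begin

lemma basic_map_highest:
  assumes "basic_map C D x y \<psi>" "highest_weight_elt C x"
  shows "highest_weight_elt D y" "wt D y = wt C x"
  using assms hom_highest crys_homD(3) unfolding basic_map_def by metis+

text \<open>The element \<open>y\<close> is then highest too, by \<open>basic_map_highest\<close>,
  so the index set consists of the pairs of highest weight elements of equal weight.\<close>

definition basic_lins :: "('i, 'c) crystal \<Rightarrow> ('i, 'd) crystal \<Rightarrow> ('c, 'd, 'k::field) lin set" where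
  "basic_lins C D = {lin_of \<psi> |\<psi> x y. highest_weight_elt C x \<and> basic_map C D x y \<psi>}"

lemma basic_lins_independent:
  assumes C: "decomposable C"
  shows "\<not> module.dependent lin_scale (basic_lins C D :: ('c, 'd, 'k::field) lin set)"
proof
  assume "module.dependent lin_scale (basic_lins C D :: ('c, 'd, 'k) lin set)"
  then obtain t and u :: "('c, 'd, 'k) lin \<Rightarrow> 'k" and v where t: "finite t" "t \<subseteq> basic_lins C D"
    and sum: "(\<Sum>v\<in>t. lin_scale (u v) v) = 0" and v: "v \<in> t" "u v \<noteq> 0"
    unfolding lin.dependent_explicit by blast
  obtain \<psi> x y where \<psi>: "v = lin_of \<psi>" "highest_weight_elt C x" "basic_map C D x y \<psi>"
    using t(2) v(1) unfolding basic_lins_def by blast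
  \<comment> \<open>A matrix unit for \<open>x'\<close> lives on the component of \<open>x'\<close>,
    whose only highest element is \<open>x'\<close>; hence it sees \<open>x\<close> only if
    \<open>x' = x\<close>.\<close>
  have other: "v' y x = 0" if v': "v' \<in> t" "v' \<noteq> v" for v'
  proof -
    obtain \<psi>' x' y' where \<psi>': "v' = lin_of \<psi>'" "highest_weight_elt C x'" "basic_map C D x' y' \<psi>'"
      using t(2) v'(1) unfolding basic_lins_def by blast
    have "\<psi>' x \<noteq> Some y"
    proof
      assume a: "\<psi>' x = Some y"
      then have "x \<in> component C x'" using \<psi>'(3) by (auto simp: basic_map_def)
      then have "x = x'" using decomposable_highest_unique[OF C \<psi>'(2) \<psi>(2)] by blast
      moreover from this have "y' = y" using a \<psi>'(3) by (simp add: basic_map_def)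
      ultimately have "basic_map C D x y \<psi>'" using \<psi>'(3) by simp
      then have "\<psi>' = \<psi>" by (rule basic_map_unique[OF _ \<psi>(3)])
      then show False using \<psi>(1) \<psi>'(1) v'(2) by simp
    qed
    then show ?thesis by (simp add: \<psi>'(1) lin_of_def)
  qed
  have at: "(\<Sum>v\<in>s. lin_scale (u v) v) y x = (\<Sum>v\<in>s. u v * v y x)" for s
    by (induction s rule: infinite_finite_induct) (simp_all add: lin_scale_def)
  have "0 = (\<Sum>v'\<in>t. u v' * v' y x)" using at[of t] sum by simp
  also have "\<dots> = (\<Sum>v'\<in>t. if v' = v then u v * v y x else 0)"
    using other by (intro sum.cong) auto
  also have "\<dots> = u v" using t(1) v(1) \<psi>(3) by (simp add: \<psi>(1) lin_of_def basic_map_def)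
  finally show False using v(2) by simp
qed

text \<open>A strict morphism is the sum of its restrictions to components, and the nonzero ones are
  the matrix units for the pairs of a surviving highest element and its image.\<close>

lemma basic_lins_span:
  assumes C: "decomposable C" and D: "decomposable D"
  shows "module.span lin_scale (basic_lins C D :: ('c, 'd, 'k::field) lin set) = gcrys_hom C D"
proof
  have "basic_lins C D \<subseteq> (lin_of ` crys_hom C D :: ('c, 'd, 'k) lin set)"
    unfolding basic_lins_def basic_map_def by blast
  then show "module.span lin_scale (basic_lins C D :: ('c, 'd, 'k) lin set) \<subseteq> gcrys_hom C D"
    unfolding gcrys_hom_def by (rule lin.span_mono)
  have "lin_of \<psi> \<in> lin.span (basic_lins C D :: ('c, 'd, 'k) lin set)" if \<psi>: "\<psi> \<in> crys_hom C D" for \<psi>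
  proof -
    note cC = decomposable_crystal[OF C]
    define S where "S = {x \<in> dom \<psi>. highest_weight_elt C x}"
    have fin: "finite S"
      using is_crystalD(1)[OF cC] by (rule finite_subset[rotated]) (auto simp: S_def highest_arrow)
    have "\<exists>\<chi>. basic_map C D x (the (\<psi> x)) \<chi>" if xS: "x \<in> S" for x
    proof -
      obtain y where y: "\<psi> x = Some y" "highest_weight_elt C x" using xS by (auto simp: S_def)
      then show ?thesis
        using basic_map_exists[OF C D y(2) hom_highest[OF \<psi> y]] crys_homD(3)[OF \<psi> y(1)] by auto
    qed
    then obtain \<chi> where \<chi>: "\<And>x. x \<in> S \<Longrightarrow> basic_map C D x (the (\<psi> x)) (\<chi> x)" by metis
    have at: "(\<Sum>x\<in>s. lin_of (\<chi> x) :: ('c, 'd, 'k) lin) d b = (\<Sum>x\<in>s. lin_of (\<chi> x) d b)" for s d b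
      by (induction s rule: infinite_finite_induct) simp_all
    have "lin_of \<psi> d b = (\<Sum>x\<in>S. lin_of (\<chi> x) d b :: 'k)" for d b
    proof (cases "b \<in> elts C")
      case False
      then have "\<psi> b = None" using crys_homD(1)[OF \<psi>] by (cases "\<psi> b") auto
      moreover have "\<chi> x b = None" if "x \<in> S" for x
        using False crys_homD(1)[of "\<chi> x" C D b] \<chi>[OF that] unfolding basic_map_def
        by (cases "\<chi> x b") auto
      ultimately show ?thesis by (simp add: lin_of_def)
    next
      case True
      obtain h where h: "highest_weight_elt C h" "b \<in> component C h"
        using decomposable_emb_top[OF C True] by blast
      \<comment> \<open>Only the summand of the highest element in the component of \<open>b\<close>
        can act on \<open>b\<close>.\<close>
      have other: "\<chi> x b = None" if x: "x \<in> S" "x \<noteq> h" for x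
      proof (rule ccontr)
        assume "\<chi> x b \<noteq> None"
        then have "b \<in> component C x" using \<chi>[OF x(1)] by (auto simp: basic_map_def)
        then have "h \<in> component C x" using component_sym[OF cC h(2)] component_trans by fast
        then have "h = x" using decomposable_highest_unique[OF C _ h(1)] x(1) by (simp add: S_def)
        then show False using x(2) by simp
      qed
      show ?thesis
      proof (cases "h \<in> S")
        case hS: True
        have "\<chi> h h = \<psi> h" using \<chi>[OF hS] hS by (auto simp: basic_map_def S_def)
        then have "\<chi> h b = \<psi> b"
          using hom_unique_on_component[OF _ \<psi> _ h(2)] \<chi>[OF hS] by (simp add: basic_map_def)
        have "(\<Sum>x\<in>S. lin_of (\<chi> x) d b :: 'k) = (\<Sum>x\<in>S. if x = h then lin_of (\<chi> h) d b else 0)"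
          using other by (intro sum.cong) (auto simp: lin_of_def)
        then show ?thesis using fin hS \<open>\<chi> h b = \<psi> b\<close> by (simp add: lin_of_def)
      next
        case False
        \<comment> \<open>A morphism that kills the highest element kills the whole component: a
          value at \<open>b\<close> would propagate back to \<open>h\<close>.\<close>
        then have "\<psi> h = None" using h(1) by (auto simp: S_def)
        then have "\<psi> b = None"
          using hom_component[OF cC \<psi> _ component_sym[OF cC h(2)]] by (cases "\<psi> b") auto
        moreover have "\<chi> x b = None" if "x \<in> S" for x
          using other[OF that] False that by blast
        then have "(\<Sum>x\<in>S. lin_of (\<chi> x) d b :: 'k) = 0"
          by (intro sum.neutral) (simp add: lin_of_def)
        ultimately show ?thesis by (simp add: lin_of_def)
      qed
    qed
    then have "lin_of \<psi> = (\<Sum>x\<in>S. lin_of (\<chi> x) :: ('c, 'd, 'k) lin)" by (intro ext) (simp add: at)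
    moreover have "lin_of (\<chi> x) \<in> (basic_lins C D :: ('c, 'd, 'k) lin set)" if "x \<in> S" for x
      using \<chi>[OF that] that unfolding basic_lins_def S_def by blast
    ultimately show ?thesis by (simp add: lin.span_sum lin.span_base)
  qed
  then have "lin_of ` crys_hom C D \<subseteq> lin.span (basic_lins C D :: ('c, 'd, 'k) lin set)" by blast
  then show "gcrys_hom C D \<subseteq> module.span lin_scale (basic_lins C D :: ('c, 'd, 'k) lin set)"
    unfolding gcrys_hom_def by (rule lin.span_minimal) (rule lin.subspace_span)
qed

lemma basic_lins_basis:
  assumes "decomposable C" "decomposable D"
  shows "is_basis_of (basic_lins C D :: ('c, 'd, 'k::field) lin set) (gcrys_hom C D)"
  unfolding is_basis_of_def by (intro conjI basic_lins_independent basic_lins_span assms)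

lemma basic_lins_basic:
  assumes "M \<in> basic_lins C D"
  shows "basic_morphism C M"
proof -
  obtain \<psi> x y where M: "M = lin_of \<psi>" "highest_weight_elt C x" "basic_map C D x y \<psi>"
    using assms unfolding basic_lins_def by blast
  have "\<psi> b = None" if "b \<notin> component C x" for b
    using that M(3) by (auto simp: basic_map_def)
  then show ?thesis unfolding basic_morphism_def
    using M(1,2) by (intro bexI[of _ "component C x"]) (auto simp: components_def highest_arrow lin_of_def)
qed

section \<open>Products of matrix units\<close>

lemma basic_map_comp:
  assumes C: "is_crystal A C" and \<psi>: "basic_map C D x y \<psi>" and \<chi>: "basic_map D E y z \<chi>"
  shows "basic_map C E x z (\<chi> \<circ>\<^sub>m \<psi>)"
  using assms crys_hom_comp[of \<psi> C D \<chi> E] unfolding basic_map_def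
  by (auto simp: map_comp_Some_iff dom_def subset_iff)

text \<open>The image of \<open>\<psi>\<close> lies in the component of \<open>y\<close>, the domain
  of \<open>\<chi>\<close> in that of \<open>y'\<close>, and different highest elements have
  disjoint components.\<close>

lemma basic_map_comp_empty:
  assumes C: "is_crystal A C" and D: "decomposable D"
    and x: "highest_weight_elt C x" and y': "highest_weight_elt D y'"
    and \<psi>: "basic_map C D x y \<psi>" and \<chi>: "basic_map D E y' z \<chi>" and neq: "y' \<noteq> y"
  shows "\<chi> \<circ>\<^sub>m \<psi> = Map.empty"
proof (rule ext, rule ccontr)
  fix b assume "(\<chi> \<circ>\<^sub>m \<psi>) b \<noteq> None"
  then obtain d e where d: "\<psi> b = Some d" "\<chi> d = Some e" by (auto simp: map_comp_Some_iff)
  have "b \<in> component C x" using d(1) \<psi> by (auto simp: basic_map_def)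
  then have "d \<in> component D y"
    using hom_component[OF C, of \<psi> D x y b] \<psi> d(1) by (auto simp: basic_map_def)
  moreover have "d \<in> component D y'" using d(2) \<chi> by (auto simp: basic_map_def)
  ultimately have "y \<in> component D y'"
    using component_sym[OF decomposable_crystal[OF D]] component_trans by fast
  then show False
    using decomposable_highest_unique[OF D y' basic_map_highest(1)[OF \<psi> x]] neq by simp
qed

end

context crossing_words begin

lemma bottom_diagrams_iff:
  "g \<in> bottom_diagrams B cr w lam \<longleftrightarrow>
     (\<exists>x. bottom B cr w x (cod_word g) (dmap g)) \<and> dom_word g = w \<and> word_weight (cod_word g) = lam"
  by (cases g) (auto simp: bottom_diagrams_def)

text \<open>Conversely to \<open>hat_basic_map\<close>, a pair of highest elements of equal weight
  has two bottom diagrams of that weight, and uniqueness of the matrix unit makes the result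
  independent of the chosen permutation.\<close>

lemma hat_basis_eq:
  fixes P :: "('i, 'b) diagram \<Rightarrow> ('i, 'b) diagram \<Rightarrow> 'b wmap"
  assumes P: "\<And>w w' lam f g. dominant lam \<Longrightarrow> f \<in> bottom_diagrams B cr w' lam \<Longrightarrow>
    g \<in> bottom_diagrams B cr w lam \<Longrightarrow> is_permutation B cr (cod_word g) (cod_word f) (P f g)"
  shows "hat_basis B cr P w w' = (basic_lins (W w) (W w') :: ('b list, 'b list, 'k::field) lin set)"
proof (intro subset_antisym subsetI)
  fix M :: "('b list, 'b list, 'k) lin"
  assume "M \<in> hat_basis B cr P w w'"
  then obtain f g lam where fg: "M = hat B f (P f g) g" "dominant lam"
      "f \<in> bottom_diagrams B cr w' lam" "g \<in> bottom_diagrams B cr w lam"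
    unfolding hat_basis_def by blast
  obtain x y where x: "bottom B cr w x (cod_word g) (dmap g)" and y: "bottom B cr w' y (cod_word f) (dmap f)"
    using fg by (auto simp: bottom_diagrams_iff)
  have "word_weight (cod_word g) = word_weight (cod_word f)" using fg by (simp add: bottom_diagrams_iff)
  then show "M \<in> basic_lins (W w) (W w')"
    using hat_basic_map[OF x y P[OF fg(2-4)]] bottom_top[OF x]
    unfolding fg(1) hat_def basic_lins_def by blast
next
  fix M :: "('b list, 'b list, 'k) lin"
  assume "M \<in> basic_lins (W w) (W w')"
  then obtain \<psi> x y where M: "M = lin_of \<psi>" "highest_weight_elt (W w) x" "basic_map (W w) (W w') x y \<psi>"
    unfolding basic_lins_def by blast
  obtain \<delta> D where x: "bottom B cr w x \<delta> D" using bottom_exists M(2) by blast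
  obtain \<delta>' D' where y: "bottom B cr w' y \<delta>' D'"
    using bottom_exists basic_map_highest(1)[OF M(3,2)] by blast
  have wt: "word_weight \<delta> = word_weight \<delta>'"
    using bottom_top[OF x] bottom_top[OF y] basic_map_highest(2)[OF M(3,2)] by simp
  let ?g = "\<lparr>dom_word = w, cod_word = \<delta>, dmap = D\<rparr>" and ?f = "\<lparr>dom_word = w', cod_word = \<delta>', dmap = D'\<rparr>"
  have d: "dominant (word_weight \<delta>)" by (simp add: dominant_def word_weight_count)
  have f: "?f \<in> bottom_diagrams B cr w' (word_weight \<delta>)" and g: "?g \<in> bottom_diagrams B cr w (word_weight \<delta>)"
    using x y wt by (auto simp: bottom_diagrams_iff)
  have "is_permutation B cr \<delta> \<delta>' (P ?f ?g)" using P[OF d f g] by simp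
  from basic_map_unique[OF hat_basic_map[OF x y this wt] M(3)] have "M = hat B ?f (P ?f ?g) ?g"
    unfolding M(1) hat_def by simp
  then show "M \<in> hat_basis B cr P w w'" unfolding hat_basis_def using d f g by blast
qed

text \<open>For \<open>g' = f\<close> the composite and the map built with \<open>P''\<close> are
  matrix units for the same pair \<open>x\<close>, \<open>z\<close>; this is why any permutation
  will do.\<close>

lemma hat_comp:
  fixes P P' P'' :: "'b wmap"
  assumes f: "f \<in> bottom_diagrams B cr w' lam" and g: "g \<in> bottom_diagrams B cr w lam"
    and f': "f' \<in> bottom_diagrams B cr w'' lam'" and g': "g' \<in> bottom_diagrams B cr w' lam'"
    and P: "is_permutation B cr (cod_word g) (cod_word f) P"
    and P': "is_permutation B cr (cod_word g') (cod_word f') P'"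
  shows "g' = f \<Longrightarrow> is_permutation B cr (cod_word g) (cod_word f') P'' \<Longrightarrow>
      lin_comp (W w') (hat B f' P' g') (hat B f P g) = (hat B f' P'' g :: ('b list, 'b list, 'k::field) lin)"
    and "g' \<noteq> f \<Longrightarrow> lin_comp (W w') (hat B f' P' g') (hat B f P g) = (0 :: ('b list, 'b list, 'k) lin)"
proof -
  obtain x where x: "bottom B cr w x (cod_word g) (dmap g)" using g by (auto simp: bottom_diagrams_iff)
  obtain y where y: "bottom B cr w' y (cod_word f) (dmap f)" using f by (auto simp: bottom_diagrams_iff)
  obtain y' where y': "bottom B cr w' y' (cod_word g') (dmap g')" using g' by (auto simp: bottom_diagrams_iff)
  obtain z where z: "bottom B cr w'' z (cod_word f') (dmap f')" using f' by (auto simp: bottom_diagrams_iff)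
  define \<psi> where "\<psi> = flip_map (dmap f) \<circ>\<^sub>m jones_wenzl B (cod_word f) \<circ>\<^sub>m P \<circ>\<^sub>m dmap g"
  define \<chi> where "\<chi> = flip_map (dmap f') \<circ>\<^sub>m jones_wenzl B (cod_word f') \<circ>\<^sub>m P' \<circ>\<^sub>m dmap g'"
  have \<psi>: "basic_map (W w) (W w') x y \<psi>"
    unfolding \<psi>_def by (rule hat_basic_map[OF x y P]) (use f g in \<open>simp add: bottom_diagrams_iff\<close>)
  have \<chi>: "basic_map (W w') (W w'') y' z \<chi>"
    unfolding \<chi>_def by (rule hat_basic_map[OF y' z P']) (use f' g' in \<open>simp add: bottom_diagrams_iff\<close>)
  have "ran \<psi> \<subseteq> elts (W w')" using \<psi> crys_homD(2) by (fastforce simp: basic_map_def ran_def)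
  then have comp: "lin_comp (W w') (hat B f' P' g') (hat B f P g) = (lin_of (\<chi> \<circ>\<^sub>m \<psi>) :: ('b list, 'b list, 'k) lin)"
    unfolding hat_def \<psi>_def[symmetric] \<chi>_def[symmetric]
    by (rule lin_comp_lin_of[OF is_crystalD(1)[OF is_crystal_word]])
  {
    assume eq: "g' = f" and P'': "is_permutation B cr (cod_word g) (cod_word f') P''"
    have "highest_weight_elt (W w') y" "highest_weight_elt (W w') y'"
      "dmap f y = Some (word_top (cod_word f))" "dmap f y' = Some (word_top (cod_word f))"
      "crys_emb (W w') (W (cod_word f)) (dmap f)"
      using bottom_top[OF y] bottom_top[OF y'] unfolding eq by auto
    \<comment> \<open>Both elements are attached to the one diagram \<open>f\<close>, which sends
      them to the top of its codomain and is injective there.\<close>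
    then have yy: "y' = y" using crys_emb_inj by metis
    have "word_weight (cod_word g) = word_weight (cod_word f')"
      using f g f' g' unfolding eq by (simp add: bottom_diagrams_iff)
    then have "basic_map (W w) (W w'') x z (flip_map (dmap f') \<circ>\<^sub>m jones_wenzl B (cod_word f') \<circ>\<^sub>m P'' \<circ>\<^sub>m dmap g)"
      by (rule hat_basic_map[OF x z P''])
    then have "\<chi> \<circ>\<^sub>m \<psi> = flip_map (dmap f') \<circ>\<^sub>m jones_wenzl B (cod_word f') \<circ>\<^sub>m P'' \<circ>\<^sub>m dmap g"
      by (rule basic_map_unique[OF basic_map_comp[OF is_crystal_word \<psi> \<chi>[unfolded yy]]])
    then show "lin_comp (W w') (hat B f' P' g') (hat B f P g) = (hat B f' P'' g :: ('b list, 'b list, 'k) lin)"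
      unfolding comp by (simp add: hat_def)
  next
    assume neq: "g' \<noteq> f"
    \<comment> \<open>Equal elements would carry the same codomain and the same map, and the domain
      words agree, so the diagrams would coincide.\<close>
    have "y' \<noteq> y"
    proof
      assume "y' = y"
      then have "cod_word g' = cod_word f \<and> dmap g' = dmap f" using bottom_deterministic y y' by blast
      then show False using neq f g' by (auto simp: bottom_diagrams_iff)
    qed
    then have "\<chi> \<circ>\<^sub>m \<psi> = Map.empty"
      using bottom_top[OF x] bottom_top[OF y']
      by (intro basic_map_comp_empty[OF is_crystal_word decomposable_word _ _ \<psi> \<chi>]) auto
    then show "lin_comp (W w') (hat B f' P' g') (hat B f P g) = (0 :: ('b list, 'b list, 'k) lin)"
      unfolding comp by (simp add: lin_of_def fun_eq_iff)
  }
qed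

end

theorem proposition2p3p8:
  fixes scale :: "complex \<Rightarrow> 'g::ab_group_add \<Rightarrow> 'g"
    and br :: "'g \<Rightarrow> 'g \<Rightarrow> 'g"
    and H :: "'g set"
    and \<alpha> :: "'i::{finite,linorder} \<Rightarrow> 'g \<Rightarrow> complex"
    and \<alpha>c :: "'i \<Rightarrow> 'g"
    and A :: "'i \<Rightarrow> 'i \<Rightarrow> int"
    and BB :: "'i weight \<Rightarrow> ('i, 'b) crystal"
    and B :: "'i \<Rightarrow> ('i, 'b) crystal"
    and cr :: "'i \<Rightarrow> 'i \<Rightarrow> 'b wmap"
    and P :: "('i, 'b) diagram \<Rightarrow> ('i, 'b) diagram \<Rightarrow> 'b wmap"
  assumes lie: "simple_lie_algebra scale br"
    and cartan: "cartan_subalgebra scale br H"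
    and roots: "simple_roots scale br H \<alpha>"
    and coroots: "simple_coroots scale br H \<alpha> \<alpha>c"
    and A: "A = cartan_matrix \<alpha> \<alpha>c"
    and simple_crystals: "\<And>lam. dominant lam \<Longrightarrow> crystal_of_simple_module A lam (BB lam)"
    and monoidal: "\<And>lam \<mu>. dominant lam \<Longrightarrow> dominant \<mu> \<Longrightarrow>
          gcrys_object A BB (tensor_crystal (BB lam) (BB \<mu>))"
    and fundamental: "\<And>i. B i = BB (fund_weight i)"
    and crossings: "\<And>i j. i \<noteq> j \<Longrightarrow>
          crys_iso (word_crystal B [i, j]) (word_crystal B [j, i]) (cr i j) \<and>
          flip_map (cr i j) = cr j i"
    and permutations: "\<And>w w' lam f g. dominant lam \<Longrightarrow>
          f \<in> bottom_diagrams B cr w' lam \<Longrightarrow> g \<in> bottom_diagrams B cr w lam \<Longrightarrow>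
          is_permutation B cr (cod_word g) (cod_word f) (P f g)"
  shows "(\<forall>w w'.
            is_basis_of (hat_basis B cr P w w' :: ('b list, 'b list, 'k::field) lin set)
              (gcrys_hom (word_crystal B w) (word_crystal B w')) \<and>
            (\<forall>M \<in> (hat_basis B cr P w w' :: ('b list, 'b list, 'k) lin set).
               basic_morphism (word_crystal B w) M)) \<and>
         (\<forall>w w' w'' lam lam' f g f' g'.
            dominant lam \<and> f \<in> bottom_diagrams B cr w' lam \<and> g \<in> bottom_diagrams B cr w lam \<and>
            dominant lam' \<and> f' \<in> bottom_diagrams B cr w'' lam' \<and> g' \<in> bottom_diagrams B cr w' lam' \<longrightarrow>
            (g' = f \<longrightarrow>
               (\<forall>P''. is_permutation B cr (cod_word g) (cod_word f') P'' \<longrightarrow>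
                  lin_comp (word_crystal B w') (hat B f' (P f' g') g') (hat B f (P f g) g) =
                    (hat B f' P'' g :: ('b list, 'b list, 'k) lin))) \<and>
            (g' \<noteq> f \<longrightarrow>
               lin_comp (word_crystal B w') (hat B f' (P f' g') g') (hat B f (P f g) g) =
                 (0 :: ('b list, 'b list, 'k) lin)))"
proof -
  \<comment> \<open>The normalisation \<open>\<alpha> i (\<alpha>c i) = 2\<close> of the coroots,
    read through the floor in \<open>cartan_matrix\<close>.\<close>
  have "A i i = 2" for i
    using coroots A by (simp add: simple_coroots_def cartan_matrix_def)
  then interpret crossing_words A BB B cr
    using simple_crystals monoidal fundamental crossings by unfold_locales auto
  have eq: "hat_basis B cr P w w' = (basic_lins (W w) (W w') :: ('b list, 'b list, 'k) lin set)" for w w'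
    by (rule hat_basis_eq) (rule permutations)
  have basis: "is_basis_of (hat_basis B cr P w w' :: ('b list, 'b list, 'k) lin set)
      (gcrys_hom (W w) (W w'))" for w w'
    unfolding eq by (rule basic_lins_basis[OF decomposable_word decomposable_word])
  have basic: "basic_morphism (W w) M"
    if "M \<in> (hat_basis B cr P w w' :: ('b list, 'b list, 'k) lin set)" for w w' M
    using that unfolding eq by (rule basic_lins_basic)
  show ?thesis
  proof (intro conjI allI ballI impI)
    fix w w' show "is_basis_of (hat_basis B cr P w w' :: ('b list, 'b list, 'k) lin set)
      (gcrys_hom (W w) (W w'))" by (rule basis)
  next
    fix w w' M assume "M \<in> (hat_basis B cr P w w' :: ('b list, 'b list, 'k) lin set)"
    then show "basic_morphism (W w) M" by (rule basic)
  next
    fix w w' w'' lam lam' f g f' g' P''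
    assume d: "dominant lam \<and> f \<in> bottom_diagrams B cr w' lam \<and> g \<in> bottom_diagrams B cr w lam \<and>
      dominant lam' \<and> f' \<in> bottom_diagrams B cr w'' lam' \<and> g' \<in> bottom_diagrams B cr w' lam'"
      and gf: "g' = f" and P'': "is_permutation B cr (cod_word g) (cod_word f') P''"
    have perms: "is_permutation B cr (cod_word g) (cod_word f) (P f g)"
      "is_permutation B cr (cod_word g') (cod_word f') (P f' g')"
      using d permutations by blast+
    show "lin_comp (W w') (hat B f' (P f' g') g') (hat B f (P f g) g) =
      (hat B f' P'' g :: ('b list, 'b list, 'k) lin)"
      by (rule hat_comp(1)[OF _ _ _ _ perms gf P'']) (use d in blast)+
  next
    fix w w' w'' lam lam' f g f' g'
    assume d: "dominant lam \<and> f \<in> bottom_diagrams B cr w' lam \<and> g \<in> bottom_diagrams B cr w lam \<and>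
      dominant lam' \<and> f' \<in> bottom_diagrams B cr w'' lam' \<and> g' \<in> bottom_diagrams B cr w' lam'"
      and neq: "g' \<noteq> f"
    have perms: "is_permutation B cr (cod_word g) (cod_word f) (P f g)"
      "is_permutation B cr (cod_word g') (cod_word f') (P f' g')"
      using d permutations by blast+
    show "lin_comp (W w') (hat B f' (P f' g') g') (hat B f (P f g) g) =
      (0 :: ('b list, 'b list, 'k) lin)"
      by (rule hat_comp(2)[OF _ _ _ _ perms neq]) (use d in blast)+
  qed
qed

end
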